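(* Let $\Phi,\Psi$ be two finite simplicial graphs. Assume that $\Psi$ is triangle-free. Then $C(\Phi)$ is isomorphic to a subgroup of $C(\Psi)$ if and only if $X(\Psi)$ contains a peripheral collection of hyperplanes whose crossing graph is isomorphic to $\Phi$.
   Context: Given a simplicial graph $\Gamma$, $C(\Gamma)=\langle u\in V(\Gamma)\mid u^2=1\ (u\in V(\Gamma)),\ [u,v]=1 \text{ if } \{u,v\}\in E(\Gamma)\rangle$ is the right-angled Coxeter group. $X(\Gamma)$ is the CAT(0) cube complex whose one-skeleton is the Cayley graph of $C(\Gamma)$ with respect to $V(\Gamma)$ and whose $n$-cubes fill in the subgraphs isomorphic to one-skeleta of $n$-cubes. A hyperplane is an equivalence class of edges for the equivalence relation generated by identifying opposite edges of squares; removing the interiors of the edges dual to (i.e. in) $J$ from the one-skeleton leaves two components, the halfspaces delimited by $J$. Two distinct hyperplanes are transverse if some square contains edges dual to each. $J$ separates the vertex $1$ from another hyperplane $K$ if $J\neq K$ are not transverse and $K$ lies in the halfspace delimited by $J$ not containing $1$. A collection of hyperplanes is peripheral if none of its hyperplanes separates another one from $1$. The crossing graph of a collection of hyperplanes has these hyperplanes as vertices and edges linking transverse hyperplanes. *)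

theory Defs
  imports "HOL-Algebra.Group"
begin

section \<open>Graphs\<close>

record 'a ugraph =
  verts :: "'a set"
  edges :: "'a set set"

definition simplicial_graph :: "'a ugraph \<Rightarrow> bool" where
  "simplicial_graph \<Gamma> \<longleftrightarrow>
     (\<forall>e\<in>edges \<Gamma>. \<exists>u\<in>verts \<Gamma>. \<exists>v\<in>verts \<Gamma>. u \<noteq> v \<and> e = {u, v})"

definition triangle_free :: "'a ugraph \<Rightarrow> bool" where
  "triangle_free \<Gamma> \<longleftrightarrow>
     \<not> (\<exists>u v w. distinct [u, v, w] \<and>
          {u, v} \<in> edges \<Gamma> \<and> {v, w} \<in> edges \<Gamma> \<and> {w, u} \<in> edges \<Gamma>)"

definition graph_isomorphic :: "'a ugraph \<Rightarrow> 'b ugraph \<Rightarrow> bool" where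
  "graph_isomorphic \<Gamma> \<Delta> \<longleftrightarrow>
     (\<exists>f. bij_betw f (verts \<Gamma>) (verts \<Delta>) \<and>
          (\<forall>u\<in>verts \<Gamma>. \<forall>v\<in>verts \<Gamma>. {u, v} \<in> edges \<Gamma> \<longleftrightarrow> {f u, f v} \<in> edges \<Delta>))"

definition delete_edges :: "'a ugraph \<Rightarrow> 'a set set \<Rightarrow> 'a ugraph" where
  "delete_edges G J = \<lparr>verts = verts G, edges = edges G - J\<rparr>"

definition adjacency :: "'a ugraph \<Rightarrow> 'a rel" where
  "adjacency G = {(x, y). {x, y} \<in> edges G}"

definition components :: "'a ugraph \<Rightarrow> 'a set set" where
  "components G = verts G // (adjacency G)\<^sup>*"


section \<open>Group presentations\<close>

text \<open>A letter \<open>(s, True)\<close> stands for the generator \<open>s\<close> and \<open>(s, False)\<close> for its inverse.\<close>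

type_synonym 'a word = "('a \<times> bool) list"

definition words :: "'a set \<Rightarrow> 'a word set" where
  "words S = lists (S \<times> UNIV)"

definition inv_word :: "'a word \<Rightarrow> 'a word" where
  "inv_word w = rev (map (\<lambda>(s, e). (s, \<not> e)) w)"

inductive_set pres_rel :: "'a set \<Rightarrow> 'a word set \<Rightarrow> 'a word rel"
  for S :: "'a set" and R :: "'a word set" where
  refl: "w \<in> words S \<Longrightarrow> (w, w) \<in> pres_rel S R"
| sym: "(v, w) \<in> pres_rel S R \<Longrightarrow> (w, v) \<in> pres_rel S R"
| trans: "(u, v) \<in> pres_rel S R \<Longrightarrow> (v, w) \<in> pres_rel S R \<Longrightarrow> (u, w) \<in> pres_rel S R"
| cancel: "u \<in> words S \<Longrightarrow> v \<in> words S \<Longrightarrow> s \<in> S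
    \<Longrightarrow> (u @ [(s, e), (s, \<not> e)] @ v, u @ v) \<in> pres_rel S R"
| relator: "u \<in> words S \<Longrightarrow> v \<in> words S \<Longrightarrow> r \<in> R
    \<Longrightarrow> (u @ r @ v, u @ v) \<in> pres_rel S R"

text \<open>The group \<open>\<langle>S | R\<rangle>\<close>, for a set \<open>R \<subseteq> words S\<close> of relators.\<close>

definition presented_group :: "'a set \<Rightarrow> 'a word set \<Rightarrow> 'a word set monoid" where
  "presented_group S R =
     \<lparr>carrier = words S // pres_rel S R,
      mult = (\<lambda>A B. \<Union>a\<in>A. \<Union>b\<in>B. pres_rel S R `` {a @ b}),
      one = pres_rel S R `` {[]}\<rparr>"

definition gen_class :: "'a set \<Rightarrow> 'a word set \<Rightarrow> 'a \<Rightarrow> 'a word set" where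
  "gen_class S R s = pres_rel S R `` {[(s, True)]}"

lemma pres_rel_in_words:
  assumes "R \<subseteq> words S" and "(v, w) \<in> pres_rel S R"
  shows "v \<in> words S \<and> w \<in> words S"
  using assms(2) by induction (use assms(1) in \<open>auto simp: words_def\<close>)

lemma equiv_pres_rel:
  assumes "R \<subseteq> words S"
  shows "equiv (words S) (pres_rel S R)"
proof (rule equivI)
  show "pres_rel S R \<subseteq> words S \<times> words S"
    using pres_rel_in_words[OF assms] by auto
  show "refl_on (words S) (pres_rel S R)"
    by (auto simp: refl_on_def intro: pres_rel.refl)
  show "Relation.sym (pres_rel S R)"
    by (auto simp: sym_def intro: pres_rel.sym)
  show "Relation.trans (pres_rel S R)"
    by (auto simp: trans_def intro: pres_rel.trans)
qed

lemma words_append [simp]: "u @ v \<in> words S \<longleftrightarrow> u \<in> words S \<and> v \<in> words S"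
  by (auto simp: words_def)

lemma words_Nil [simp]: "[] \<in> words S"
  by (simp add: words_def)

lemma pres_rel_append_context:
  assumes "(v, w) \<in> pres_rel S R" and "x \<in> words S" "y \<in> words S"
  shows "(x @ v @ y, x @ w @ y) \<in> pres_rel S R"
  using assms(1)
proof induction
  case (refl w)
  then show ?case using assms by (intro pres_rel.refl) simp
next
  case (sym v w)
  then show ?case by (blast intro: pres_rel.sym)
next
  case (trans u v w)
  then show ?case by (blast intro: pres_rel.trans)
next
  case (cancel u v s e)
  then show ?case
    using pres_rel.cancel[of "x @ u" S "v @ y" s e R] assms by simp
next
  case (relator u v r)
  then show ?case
    using pres_rel.relator[of "x @ u" S "v @ y" r R] assms by simp
qed

lemma pres_rel_append:
  assumes R: "R \<subseteq> words S"
    and "(a, a') \<in> pres_rel S R" "(b, b') \<in> pres_rel S R"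
  shows "(a @ b, a' @ b') \<in> pres_rel S R"
proof -
  have "(a @ b, a' @ b) \<in> pres_rel S R"
    using pres_rel_append_context[of a a' S R "[]" b] assms pres_rel_in_words[OF R] by auto
  moreover have "(a' @ b, a' @ b') \<in> pres_rel S R"
    using pres_rel_append_context[of b b' S R a' "[]"] assms pres_rel_in_words[OF R] by auto
  ultimately show ?thesis by (rule pres_rel.trans)
qed

lemma presented_group_mult_class:
  assumes R: "R \<subseteq> words S" and "a \<in> words S" "b \<in> words S"
  shows "pres_rel S R `` {a} \<otimes>\<^bsub>presented_group S R\<^esub> pres_rel S R `` {b}
           = pres_rel S R `` {a @ b}" (is "?l = ?r")
proof
  show "?l \<subseteq> ?r"
    by (auto simp: presented_group_def intro: pres_rel.trans pres_rel_append[OF R])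
  show "?r \<subseteq> ?l"
    using assms by (auto simp: presented_group_def intro: pres_rel.refl)
qed

lemma inv_word_in_words: "w \<in> words S \<Longrightarrow> inv_word w \<in> words S"
  by (auto simp: words_def inv_word_def)

lemma inv_word_cancel:
  assumes "w \<in> words S"
  shows "(inv_word w @ w, []) \<in> pres_rel S R"
  using assms
proof (induction w)
  case Nil
  then show ?case by (auto simp: inv_word_def intro: pres_rel.refl)
next
  case (Cons l w)
  obtain s e where l: "l = (s, e)" by (cases l)
  have s: "s \<in> S" and w: "w \<in> words S" using Cons.prems by (auto simp: words_def l)
  have "(inv_word w @ [(s, \<not> e), (s, \<not> \<not> e)] @ w, inv_word w @ w) \<in> pres_rel S R"
    using w s inv_word_in_words[OF w] by (intro pres_rel.cancel)
  then show ?case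
    using Cons.IH[OF w] by (auto simp: l inv_word_def intro: pres_rel.trans)
qed

lemma group_presented_group:
  assumes R: "R \<subseteq> words S"
  shows "group (presented_group S R)"
proof (rule groupI)
  let ?G = "presented_group S R" and ?c = "\<lambda>w. pres_rel S R `` {w}"
  have car: "x \<in> carrier ?G \<longleftrightarrow> (\<exists>w\<in>words S. x = ?c w)" for x
    by (auto simp: presented_group_def quotient_def)
  have one: "\<one>\<^bsub>?G\<^esub> = ?c []" by (simp add: presented_group_def)
  note m = presented_group_mult_class[OF R]
  show "\<one>\<^bsub>?G\<^esub> \<in> carrier ?G" unfolding car one by auto
  fix x assume "x \<in> carrier ?G"
  then obtain a where a: "a \<in> words S" "x = ?c a" unfolding car by auto
  show "\<one>\<^bsub>?G\<^esub> \<otimes>\<^bsub>?G\<^esub> x = x" using a by (simp add: one m)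
  show "\<exists>y\<in>carrier ?G. y \<otimes>\<^bsub>?G\<^esub> x = \<one>\<^bsub>?G\<^esub>"
  proof (rule bexI[of _ "?c (inv_word a)"])
    show "?c (inv_word a) \<otimes>\<^bsub>?G\<^esub> x = \<one>\<^bsub>?G\<^esub>"
      using a inv_word_in_words[OF a(1)] equiv_class_eq[OF equiv_pres_rel[OF R] inv_word_cancel[OF a(1)]]
      by (simp add: one m)
    show "?c (inv_word a) \<in> carrier ?G" using inv_word_in_words[OF a(1)] by (auto simp: car)
  qed
  fix y assume "y \<in> carrier ?G"
  then obtain b where b: "b \<in> words S" "y = ?c b" unfolding car by auto
  show "x \<otimes>\<^bsub>?G\<^esub> y \<in> carrier ?G" using a b by (auto simp: m car)
  fix z assume "z \<in> carrier ?G"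
  then obtain c where c: "c \<in> words S" "z = ?c c" unfolding car by auto
  show "x \<otimes>\<^bsub>?G\<^esub> y \<otimes>\<^bsub>?G\<^esub> z = x \<otimes>\<^bsub>?G\<^esub> (y \<otimes>\<^bsub>?G\<^esub> z)"
    using a b c by (simp add: m)
qed


section \<open>Right-angled Coxeter groups\<close>

definition commutator_word :: "'a \<Rightarrow> 'a \<Rightarrow> 'a word" where
  "commutator_word u v = [(u, True), (v, True), (u, False), (v, False)]"

definition racg_relators :: "'a ugraph \<Rightarrow> 'a word set" where
  "racg_relators \<Gamma> =
     {[(u, True), (u, True)] | u. u \<in> verts \<Gamma>} \<union>
     {commutator_word u v | u v. {u, v} \<in> edges \<Gamma>}"

definition racg :: "'a ugraph \<Rightarrow> 'a word set monoid" where
  "racg \<Gamma> = presented_group (verts \<Gamma>) (racg_relators \<Gamma>)"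

definition racg_gens :: "'a ugraph \<Rightarrow> 'a word set set" where
  "racg_gens \<Gamma> = gen_class (verts \<Gamma>) (racg_relators \<Gamma>) ` verts \<Gamma>"

lemma group_racg:
  assumes "simplicial_graph \<Gamma>"
  shows "group (racg \<Gamma>)"
  unfolding racg_def
proof (rule group_presented_group)
  have "u \<in> verts \<Gamma> \<and> v \<in> verts \<Gamma>" if "{u, v} \<in> edges \<Gamma>" for u v
    using assms that unfolding simplicial_graph_def by (metis insert_iff singletonD)
  then show "racg_relators \<Gamma> \<subseteq> words (verts \<Gamma>)"
    by (auto simp: racg_relators_def words_def commutator_word_def)
qed

text \<open>
  The undirected Cayley graph without edge labels. For a generating set of involutions, as in a
  right-angled Coxeter group, it has no loops and \<open>g\<close>, \<open>g \<otimes> s\<close> are joined by a single edge.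
\<close>

definition cayley_graph :: "('a, 'b) monoid_scheme \<Rightarrow> 'a set \<Rightarrow> 'a ugraph" where
  "cayley_graph G S =
     \<lparr>verts = carrier G, edges = {{g, g \<otimes>\<^bsub>G\<^esub> s} | g s. g \<in> carrier G \<and> s \<in> S}\<rparr>"


section \<open>Hyperplanes\<close>

text \<open>
  A cube complex whose cubes fill in all subgraphs of its one-skeleton \<open>G\<close> isomorphic to
  one-skeleta of cubes is determined by \<open>G\<close>; its squares are the 4-cycles of \<open>G\<close>.
  Hyperplanes, transversality and halfspaces only involve \<open>G\<close> and these squares, so the
  complex is represented by \<open>G\<close>. A hyperplane is the set of its dual edges.
\<close>

definition square :: "'a ugraph \<Rightarrow> 'a \<Rightarrow> 'a \<Rightarrow> 'a \<Rightarrow> 'a \<Rightarrow> bool" where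
  "square G a b c d \<longleftrightarrow> distinct [a, b, c, d] \<and>
     {a, b} \<in> edges G \<and> {b, c} \<in> edges G \<and> {c, d} \<in> edges G \<and> {d, a} \<in> edges G"

definition opposite_edges :: "'a ugraph \<Rightarrow> 'a set rel" where
  "opposite_edges G = {({a, b}, {c, d}) | a b c d. square G a b c d}"

lemma sym_opposite_edges: "sym (opposite_edges G)"
proof (rule symI)
  fix e f assume "(e, f) \<in> opposite_edges G"
  then obtain a b c d where s: "square G a b c d" "e = {a, b}" "f = {c, d}"
    by (auto simp: opposite_edges_def)
  then have "square G c d a b" by (auto simp: square_def)
  with s show "(f, e) \<in> opposite_edges G" by (auto simp: opposite_edges_def)
qed

text \<open>
  As \<^const>\<open>opposite_edges\<close> is symmetric, its reflexive transitive closure is the equivalence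
  relation it generates.
\<close>

definition hyperplanes :: "'a ugraph \<Rightarrow> 'a set set set" where
  "hyperplanes G = edges G // (opposite_edges G)\<^sup>*"

definition halfspaces :: "'a ugraph \<Rightarrow> 'a set set \<Rightarrow> 'a set set" where
  "halfspaces G J = components (delete_edges G J)"

definition transverse :: "'a ugraph \<Rightarrow> 'a set set \<Rightarrow> 'a set set \<Rightarrow> bool" where
  "transverse G J K \<longleftrightarrow> J \<noteq> K \<and>
     (\<exists>a b c d. square G a b c d \<and>
        {{a, b}, {b, c}, {c, d}, {d, a}} \<inter> J \<noteq> {} \<and>
        {{a, b}, {b, c}, {c, d}, {d, a}} \<inter> K \<noteq> {})"

text \<open>
  A hyperplane \<open>K\<close> lies in the halfspace \<open>D\<close> if the endpoints of all edges dual to \<open>K\<close>, which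
  make up \<open>\<Union>K\<close>, lie in \<open>D\<close>.
\<close>

definition separates :: "'a ugraph \<Rightarrow> 'a set set \<Rightarrow> 'a \<Rightarrow> 'a set set \<Rightarrow> bool" where
  "separates G J x K \<longleftrightarrow> J \<noteq> K \<and> \<not> transverse G J K \<and>
     (\<exists>D\<in>halfspaces G J. x \<notin> D \<and> \<Union>K \<subseteq> D)"

definition peripheral :: "'a ugraph \<Rightarrow> 'a \<Rightarrow> 'a set set set \<Rightarrow> bool" where
  "peripheral G x \<H> \<longleftrightarrow> (\<forall>J\<in>\<H>. \<forall>K\<in>\<H>. \<not> separates G J x K)"

definition crossing_graph :: "'a ugraph \<Rightarrow> 'a set set set \<Rightarrow> 'a set set ugraph" where
  "crossing_graph G \<H> =
     \<lparr>verts = \<H>, edges = {{J, K} | J K. J \<in> \<H> \<and> K \<in> \<H> \<and> transverse G J K}\<rparr>"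

text \<open>The one-skeleton of \<open>X(\<Gamma>)\<close>.\<close>

definition X_skeleton :: "'a ugraph \<Rightarrow> 'a word set ugraph" where
  "X_skeleton \<Gamma> = cayley_graph (racg \<Gamma>) (racg_gens \<Gamma>)"

end

theory Submission
  imports Defs
begin

text \<open>
  Say that elements \<open>f v\<close>, for \<open>v\<close> a vertex of \<open>\<Phi>\<close>, form a basis if two words in the \<open>f v\<close> have the
  same value only when the relations of \<open>C(\<Phi>)\<close> force it; so \<open>C(\<Phi>)\<close> embeds in \<open>C(\<Psi>)\<close> iff \<open>C(\<Psi>)\<close>
  contains a basis. The hyperplanes of \<open>X(\<Psi>)\<close> are the walls of the reflections of \<open>C(\<Psi>)\<close>, and two of
  them are transverse iff the reflections are distinct and commute. The reflections in a peripheral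
  collection play ping-pong on the halfspaces not containing \<open>1\<close>, hence form a basis.

  Conversely, since \<open>\<Psi>\<close> is triangle-free, every \<open>f v\<close> is a reflection or a product of two commuting
  ones. If \<open>f u\<close> is a product and \<open>u\<close> has a neighbour \<open>v\<close>, then \<open>v\<close> is the only one, \<open>f v\<close> is one of
  the two factors, and the transvection \<open>u \<mapsto> u v\<close> turns \<open>f u\<close> into the other factor. If \<open>u\<close> is
  isolated and some \<open>f v\<close> is a reflection, replace \<open>u\<close> by \<open>u v u\<close>. Otherwise \<open>\<Phi>\<close> has no edges and
  one constructs reflections directly. Finally, a basis of reflections whose walls are at minimal
  total distance from \<open>1\<close> is peripheral, as partial conjugations would shorten any other one.
\<close>

section \<open>Right-angled Coxeter bases\<close>

text \<open>No normal forms and no CAT(0) geometry are used. Words are told apart by letting the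
  generators act by involutions that commute along edges, for instance on a parity, on the integers
  or on sets of reflections. The last action yields the cocycle \<open>Inv\<close>, which carries
  the arguments about walls; the Cayley graph itself enters only at the end, through a dictionary
  between hyperplanes and reflections. Stating bases by words lets one theory serve twice: for
  \<open>C(\<Psi>)\<close> and for the copy of \<open>C(\<Phi>)\<close> inside it, which has
  reflections and walls of its own. The obstacle is that an embedding sends generators to arbitrary
  involutions. Without triangles these stay small, and the centralizer of a product of two commuting
  generators has at most four elements; this makes an invertible substitution possible at vertices
  with a neighbour. At an isolated vertex nothing confines the image, so its generator is traded for
  a reflection at the price of a smaller subgroup. If no reflection is at hand, a dichotomy for
  \<open>\<Psi>\<close> decides: either there are arbitrarily many disjoint halfspaces, or all
  squares in \<open>C(\<Psi>)\<close> commute, which bounds \<open>\<Phi>\<close>.\<close>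

text \<open>Cayley's theorem moves \<open>C(\<Psi>)\<close> into a type of class \<open>group_add\<close> (non-commutative, despite the
  additive notation), where no carrier conditions arise.\<close>

typedef 'a symm = "{f :: 'a \<Rightarrow> 'a. bij f}"
  morphisms app Symm by (auto intro: bij_id)

instantiation symm :: (type) group_add
begin

definition "0 = Symm id"
definition "f + g = Symm (app f \<circ> app g)"
definition "- f = Symm (inv_into UNIV (app f))"
definition "f - (g :: 'a symm) = f + - g"

lemma bij_app: "bij (app f)"
  using app by auto

lemma app_zero [simp]: "app 0 = id"
  by (simp add: zero_symm_def Symm_inverse)

lemma app_plus [simp]: "app (f + g) = app f \<circ> app g"
  by (simp add: plus_symm_def Symm_inverse bij_app bij_comp)

lemma app_uminus [simp]: "app (- f) = inv_into UNIV (app f)"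
  by (simp add: uminus_symm_def Symm_inverse bij_app bij_imp_bij_inv)

instance
proof
  fix a b c :: "'a symm"
  show "a + b + c = a + (b + c)" by (simp add: app_inject[symmetric] o_assoc)
  show "0 + a = a" "a + 0 = a" by (simp_all add: app_inject[symmetric])
  show "- a + a = 0"
    by (simp add: app_inject[symmetric] inv_o_cancel bij_is_inj[OF bij_app])
  show "a + - b = a - b" by (simp add: minus_symm_def)
qed

end

section \<open>The left regular representation\<close>

definition left_mult :: "('a, 'b) monoid_scheme \<Rightarrow> 'a \<Rightarrow> 'a symm" where
  "left_mult G g = Symm (\<lambda>x. if x \<in> carrier G then g \<otimes>\<^bsub>G\<^esub> x else x)"

context group
begin

lemma app_left_mult:
  assumes "g \<in> carrier G"
  shows "app (left_mult G g) = (\<lambda>x. if x \<in> carrier G then g \<otimes> x else x)"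
proof -
  have "bij (\<lambda>x. if x \<in> carrier G then g \<otimes> x else x)"
    by (rule o_bij[where g = "\<lambda>x. if x \<in> carrier G then inv g \<otimes> x else x"])
       (use assms in \<open>auto simp: fun_eq_iff m_assoc[symmetric]\<close>)
  then show ?thesis by (simp add: left_mult_def Symm_inverse)
qed

lemma left_mult_mult:
  "g \<in> carrier G \<Longrightarrow> h \<in> carrier G \<Longrightarrow> left_mult G (g \<otimes> h) = left_mult G g + left_mult G h"
  by (auto simp: app_inject[symmetric] app_left_mult fun_eq_iff m_assoc)

lemma left_mult_one: "left_mult G \<one> = 0"
  by (auto simp: app_inject[symmetric] app_left_mult fun_eq_iff)

lemma inj_on_left_mult: "inj_on (left_mult G) (carrier G)"
proof (rule inj_onI)
  fix g h assume gh: "g \<in> carrier G" "h \<in> carrier G" and "left_mult G g = left_mult G h"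
  then have "app (left_mult G g) \<one> = app (left_mult G h) \<one>" by simp
  then show "g = h" using gh by (simp add: app_left_mult)
qed

end

text \<open>As the generators are involutions, words without signs suffice.\<close>

inductive weq :: "'v ugraph \<Rightarrow> 'v list \<Rightarrow> 'v list \<Rightarrow> bool" for \<Gamma> where
  refl: "weq \<Gamma> w w"
| sym: "weq \<Gamma> v w \<Longrightarrow> weq \<Gamma> w v"
| trans: "weq \<Gamma> u v \<Longrightarrow> weq \<Gamma> v w \<Longrightarrow> weq \<Gamma> u w"
| cancel: "s \<in> verts \<Gamma> \<Longrightarrow> weq \<Gamma> (u @ [s, s] @ v) (u @ v)"
| swap: "{s, t} \<in> edges \<Gamma> \<Longrightarrow> weq \<Gamma> (u @ [s, t] @ v) (u @ [t, s] @ v)"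

lemma weq_context: "weq \<Gamma> v w \<Longrightarrow> weq \<Gamma> (x @ v @ y) (x @ w @ y)"
proof (induction rule: weq.induct)
  case (cancel s u v)
  then show ?case using weq.cancel[of s \<Gamma> "x @ u" "v @ y"] by simp
next
  case (swap s t u v)
  then show ?case using weq.swap[of s t \<Gamma> "x @ u" "v @ y"] by simp
qed (blast intro: weq.intros)+

lemma weq_Cons: "weq \<Gamma> v w \<Longrightarrow> weq \<Gamma> (x # v) (x # w)"
  using weq_context[of \<Gamma> v w "[x]" "[]"] by simp

lemma weq_Cons_swap: "{s, t} \<in> edges \<Gamma> \<Longrightarrow> weq \<Gamma> (s # t # w) (t # s # w)"
  using weq.swap[of s t \<Gamma> "[]" w] by simp

lemma weq_Cons_cancel: "s \<in> verts \<Gamma> \<Longrightarrow> weq \<Gamma> (s # s # w) w"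
  using weq.cancel[of s \<Gamma> "[]" w] by simp

text \<open>Source of all word invariants below: to separate two words it suffices to find maps
  \<open>act s\<close> satisfying the Coxeter relations under which the words act
  differently.\<close>

lemma weq_foldr:
  assumes "weq \<Gamma> v w"
    and "\<And>s x. s \<in> verts \<Gamma> \<Longrightarrow> act s (act s x) = x"
    and "\<And>s t x. {s, t} \<in> edges \<Gamma> \<Longrightarrow> act s (act t x) = act t (act s x)"
  shows "foldr act v = foldr act w"
  using assms(1)
proof induction
  case (swap s t u v)
  then show ?case using assms(3)[OF swap] by (simp add: fun_eq_iff)
qed (auto simp: fun_eq_iff assms(2))

lemma edge_verts:
  assumes "simplicial_graph \<Gamma>" "{s, t} \<in> edges \<Gamma>"
  shows "s \<in> verts \<Gamma>" "t \<in> verts \<Gamma>" "s \<noteq> t"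
proof -
  obtain u v where "u \<in> verts \<Gamma>" "v \<in> verts \<Gamma>" "u \<noteq> v" "{s, t} = {u, v}"
    using assms unfolding simplicial_graph_def by (auto dest!: bspec)
  then show "s \<in> verts \<Gamma>" "t \<in> verts \<Gamma>" "s \<noteq> t" by (auto simp: doubleton_eq_iff)
qed

section \<open>Bases: criteria and substitutions\<close>

definition racg_basis :: "'v ugraph \<Rightarrow> ('v \<Rightarrow> 'g :: monoid_add) \<Rightarrow> bool" where
  "racg_basis \<Gamma> f \<longleftrightarrow> (\<forall>v \<in> lists (verts \<Gamma>). \<forall>w \<in> lists (verts \<Gamma>).
     weq \<Gamma> v w \<longleftrightarrow> sum_list (map f v) = sum_list (map f w))"

definition racg_relations :: "'v ugraph \<Rightarrow> ('v \<Rightarrow> 'g :: monoid_add) \<Rightarrow> bool" where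
  "racg_relations \<Gamma> f \<longleftrightarrow> (\<forall>s \<in> verts \<Gamma>. f s + f s = 0) \<and>
     (\<forall>s t. {s, t} \<in> edges \<Gamma> \<longrightarrow> f s + f t = f t + f s)"

lemma weq_sum_list:
  assumes "racg_relations \<Gamma> f" and "weq \<Gamma> v w"
  shows "sum_list (map f v) = sum_list (map f w)"
  using assms(2)
proof induction
  case (cancel s u v)
  then have "f s + (f s + x) = x" for x
    using assms(1) by (simp add: racg_relations_def flip: add.assoc)
  then show ?case by simp
next
  case (swap s t u v)
  then have "f s + f t = f t + f s" using assms(1) by (auto simp only: racg_relations_def)
  then have "f s + (f t + x) = f t + (f s + x)" for x
    by (simp flip: add.assoc)
  then show ?case by simp
qed auto

lemma racg_basis_imp_relations:
  assumes "simplicial_graph \<Gamma>" "racg_basis \<Gamma> f"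
  shows "racg_relations \<Gamma> f"
proof -
  have iff: "weq \<Gamma> v w \<longleftrightarrow> sum_list (map f v) = sum_list (map f w)"
    if "v \<in> lists (verts \<Gamma>)" "w \<in> lists (verts \<Gamma>)" for v w
    using assms(2) that by (simp only: racg_basis_def)
  have "f s + f s = 0" if "s \<in> verts \<Gamma>" for s
    using iff[of "[s, s]" "[]"] weq_Cons_cancel[OF that, of "[]"] that by simp
  moreover have "f s + f t = f t + f s" if "{s, t} \<in> edges \<Gamma>" for s t
    using iff[of "[s, t]" "[t, s]"] weq_Cons_swap[OF that, of "[]"] edge_verts[OF assms(1) that]
    by simp
  ultimately show ?thesis by (auto simp only: racg_relations_def)
qed

lemma weq_rev_append:
  "w \<in> lists (verts \<Gamma>) \<Longrightarrow> weq \<Gamma> (v @ rev w @ w) v"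
proof (induction w arbitrary: v)
  case Nil
  then show ?case by (simp add: weq.refl)
next
  case (Cons s w)
  then have "weq \<Gamma> ((v @ rev w) @ [s, s] @ w) (v @ rev w @ w)"
    using weq.cancel[of s \<Gamma> "v @ rev w" w] by simp
  then show ?case using Cons by (auto intro: weq.trans)
qed

text \<open>Reversing a word inverts it, so equality of two values reduces to the triviality of
  one.\<close>

lemma racg_basisI:
  fixes f :: "'v \<Rightarrow> 'g :: group_add"
  assumes rel: "racg_relations \<Gamma> f"
    and inj: "\<And>w. w \<in> lists (verts \<Gamma>) \<Longrightarrow> sum_list (map f w) = 0 \<Longrightarrow> weq \<Gamma> w []"
  shows "racg_basis \<Gamma> f"
  unfolding racg_basis_def
proof (intro ballI iffI)
  fix v w assume vw: "v \<in> lists (verts \<Gamma>)" "w \<in> lists (verts \<Gamma>)"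
  show "sum_list (map f v) = sum_list (map f w)" if "weq \<Gamma> v w"
    using weq_sum_list[OF rel that] .
  assume eq: "sum_list (map f v) = sum_list (map f w)"
  have "sum_list (map f (rev w)) + sum_list (map f w) = 0"
    using weq_sum_list[OF rel weq_rev_append[OF vw(2), of "[]"]] by simp
  then have "- sum_list (map f (rev w)) = sum_list (map f w)" by (rule minus_unique)
  then have "sum_list (map f w) + sum_list (map f (rev w)) = 0"
    using left_minus[of "sum_list (map f (rev w))"] by simp
  then have "sum_list (map f (v @ rev w)) = 0" by (simp add: eq)
  from inj[OF _ this] vw have "weq \<Gamma> (v @ rev w) []" by (simp add: in_lists_conv_set ball_Un)
  then have "weq \<Gamma> (v @ rev w @ w) w" using weq_context[of \<Gamma> "v @ rev w" "[]" "[]" w] by simp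
  then show "weq \<Gamma> v w" using weq_rev_append[OF vw(2), of v] by (blast intro: weq.intros)
qed

text \<open>Ping-pong: a reduced word whose value lies in \<open>D v\<close> can be rewritten to start with \<open>v\<close>.\<close>

lemma racg_basis_pingpong:
  fixes f :: "'v \<Rightarrow> 'g :: group_add"
  assumes rel: "racg_relations \<Gamma> f"
    and zero: "\<And>v. v \<in> verts \<Gamma> \<Longrightarrow> 0 \<notin> D v"
    and W: "\<And>w. w \<in> lists (verts \<Gamma>) \<Longrightarrow> sum_list (map f w) \<in> W"
    and into: "\<And>v g. v \<in> verts \<Gamma> \<Longrightarrow> g \<in> W \<Longrightarrow> g \<notin> D v \<Longrightarrow> f v + g \<in> D v"
    and adj: "\<And>u v g. {u, v} \<in> edges \<Gamma> \<Longrightarrow> u \<in> verts \<Gamma> \<Longrightarrow> v \<in> verts \<Gamma> \<Longrightarrow>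
                g \<in> W \<Longrightarrow> f u + g \<in> D v \<Longrightarrow> g \<in> D v"
    and disj: "\<And>u v g. u \<noteq> v \<Longrightarrow> {u, v} \<notin> edges \<Gamma> \<Longrightarrow> u \<in> verts \<Gamma> \<Longrightarrow> v \<in> verts \<Gamma> \<Longrightarrow>
                g \<in> W \<Longrightarrow> g \<in> D u \<Longrightarrow> g \<notin> D v"
  shows "racg_basis \<Gamma> f"
proof (rule racg_basisI[OF rel])
  define red where "red w \<longleftrightarrow> w \<in> lists (verts \<Gamma>) \<and>
    (\<forall>w' \<in> lists (verts \<Gamma>). weq \<Gamma> w w' \<longrightarrow> length w \<le> length w')" for w
  have red_le: "length w \<le> length w'"
    if "red w" "w' \<in> lists (verts \<Gamma>)" "weq \<Gamma> w w'" for w w'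
    using that by (simp add: red_def)
  have red_tl: "red w" if uw: "red (u # w)" for u w
    unfolding red_def
  proof (intro conjI ballI impI)
    show "w \<in> lists (verts \<Gamma>)" using uw by (simp add: red_def)
    fix w' assume w': "w' \<in> lists (verts \<Gamma>)" "weq \<Gamma> w w'"
    have "u # w' \<in> lists (verts \<Gamma>)" using uw w' by (simp add: red_def)
    from red_le[OF uw this weq_Cons[OF w'(2)]] have "length (u # w) \<le> length (u # w')" .
    then show "length w \<le> length w'" by simp
  qed
  define P where "P w \<longleftrightarrow> (\<forall>v\<in>verts \<Gamma>. sum_list (map f w) \<in> D v \<longrightarrow>
       (\<exists>w'\<in>lists (verts \<Gamma>). weq \<Gamma> w (v # w') \<and> length w' < length w))" for w
  have PE: "\<exists>w'\<in>lists (verts \<Gamma>). weq \<Gamma> w (v # w') \<and> length w' < length w"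
    if "P w" "v \<in> verts \<Gamma>" "sum_list (map f w) \<in> D v" for v w
    using that by (simp add: P_def)
  \<comment> \<open>Otherwise \<open>into\<close> puts the tail \<open>w\<close> into
    \<open>D u\<close>; then \<open>w\<close> can be rewritten to start with \<open>u\<close>, which
    cancels against the first letter and contradicts minimality.\<close>
  have step: "sum_list (map f (u # w)) \<in> D u" if r: "red (u # w)" and "P w" for u w
  proof (rule ccontr)
    have uw: "u \<in> verts \<Gamma>" "w \<in> lists (verts \<Gamma>)" using r by (auto simp: red_def)
    assume "\<not> ?thesis"
    with into[OF uw(1) W[OF uw(2)]] have "sum_list (map f w) \<in> D u" by auto
    from PE[OF \<open>P w\<close> uw(1) this]
    obtain w' where w': "w' \<in> lists (verts \<Gamma>)" "weq \<Gamma> w (u # w')" "length w' < length w"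
      by blast
    have "weq \<Gamma> (u # w) w'"
      using weq_Cons[OF w'(2), of u] weq_Cons_cancel[OF uw(1), of w'] by (rule weq.trans)
    then have "length (u # w) \<le> length w'" using red_le[OF r w'(1)] by simp
    then show False using w'(3) by simp
  qed
  have P: "red w \<Longrightarrow> P w" for w
  proof (induction w)
    case Nil
    then show ?case using zero by (simp add: P_def)
  next
    case (Cons u w)
    note Pw = Cons.IH[OF red_tl[OF Cons.prems]]
    have uw: "u \<in> verts \<Gamma>" "w \<in> lists (verts \<Gamma>)" using Cons.prems by (auto simp: red_def)
    show ?case unfolding P_def
    proof (intro ballI impI)
      fix v assume v: "v \<in> verts \<Gamma>" and in_D: "sum_list (map f (u # w)) \<in> D v"
      consider "v = u" | "v \<noteq> u" "{u, v} \<in> edges \<Gamma>" | "v \<noteq> u" "{u, v} \<notin> edges \<Gamma>" by blast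
      then show "\<exists>w'\<in>lists (verts \<Gamma>). weq \<Gamma> (u # w) (v # w') \<and> length w' < length (u # w)"
      proof cases
        case 1
        then show ?thesis using uw by (intro bexI[of _ w]) (auto intro: weq.refl)
      next
        case 2
        then have "sum_list (map f w) \<in> D v" using adj[OF 2(2) uw(1) v W[OF uw(2)]] in_D by simp
        from PE[OF Pw v this]
        obtain w' where w': "w' \<in> lists (verts \<Gamma>)" "weq \<Gamma> w (v # w')" "length w' < length w"
          by blast
        have "weq \<Gamma> (u # w) (v # u # w')"
          using weq_Cons[OF w'(2), of u] weq_Cons_swap[OF 2(2), of w'] by (rule weq.trans)
        then show ?thesis using w' uw by (intro bexI[of _ "u # w'"]) auto
      next
        case 3
        have "u # w \<in> lists (verts \<Gamma>)" using uw by simp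
        then have False
          using disj[OF _ 3(2) uw(1) v W[of "u # w"] step[OF Cons.prems Pw]] 3 in_D by auto
        then show ?thesis ..
      qed
    qed
  qed
  fix w assume w: "w \<in> lists (verts \<Gamma>)" and 0: "sum_list (map f w) = 0"
  define Q where "Q w' \<longleftrightarrow> w' \<in> lists (verts \<Gamma>) \<and> weq \<Gamma> w w'" for w'
  have "Q w" using w by (auto simp: Q_def intro: weq.refl)
  then obtain w0 where Q: "Q w0" and le: "\<forall>y. Q y \<longrightarrow> length w0 \<le> length y"
    using ex_has_least_nat[of Q w length] by blast
  have w0: "w0 \<in> lists (verts \<Gamma>)" "weq \<Gamma> w w0" using Q by (simp_all only: Q_def)
  have min: "length w0 \<le> length w'" if "w' \<in> lists (verts \<Gamma>)" "weq \<Gamma> w w'" for w'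
    using le that by (auto simp: Q_def)
  have red: "red w0"
    unfolding red_def using w0(1) min weq.trans[OF w0(2)] by simp
  show "weq \<Gamma> w []"
  proof (cases w0)
    case Nil
    then show ?thesis using w0 by simp
  next
    case (Cons u w1)
    then have "sum_list (map f w0) \<in> D u" using step[of u w1] red P[OF red_tl[of u w1]] by simp
    moreover have "sum_list (map f w0) = 0" using weq_sum_list[OF rel w0(2)] 0 by simp
    ultimately show ?thesis using zero[of u] Cons w0 by auto
  qed
qed

text \<open>One substitution serves in both directions: a relation \<open>w\<close> among the
  \<open>f'\<close> is the relation \<open>concat (map \<sigma> w)\<close> among the
  \<open>f\<close>, hence holds for the \<open>f'\<close> too, where it reads as \<open>w\<close>
  among the \<open>f\<close>. Transvections and partial conjugations have this involutive
  form.\<close>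

lemma racg_basis_subst:
  fixes f f' :: "'v \<Rightarrow> 'g :: group_add"
  assumes "racg_basis \<Gamma> f" and rel: "racg_relations \<Gamma> f'"
    and \<sigma>: "\<And>v. v \<in> verts \<Gamma> \<Longrightarrow> \<sigma> v \<in> lists (verts \<Gamma>)"
    and f': "\<And>v. v \<in> verts \<Gamma> \<Longrightarrow> f' v = sum_list (map f (\<sigma> v))"
    and f: "\<And>v. v \<in> verts \<Gamma> \<Longrightarrow> f v = sum_list (map f' (\<sigma> v))"
  shows "racg_basis \<Gamma> f'"
proof (rule racg_basisI[OF rel])
  fix w assume w: "w \<in> lists (verts \<Gamma>)" and 0: "sum_list (map f' w) = 0"
  let ?\<sigma> = "concat (map \<sigma> w)"
  have \<sigma>w: "?\<sigma> \<in> lists (verts \<Gamma>)" using w by (induction w) (use \<sigma> in auto)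
  have e1: "sum_list (map f' w) = sum_list (map f ?\<sigma>)" using w by (induction w) (use f' in auto)
  have e2: "sum_list (map f w) = sum_list (map f' ?\<sigma>)" using w by (induction w) (use f in auto)
  have iff: "weq \<Gamma> v [] \<longleftrightarrow> sum_list (map f v) = 0" if "v \<in> lists (verts \<Gamma>)" for v
    using assms(1) that by (simp add: racg_basis_def)
  have "weq \<Gamma> ?\<sigma> []" using iff \<sigma>w e1 0 by simp
  then have "sum_list (map f w) = 0" using weq_sum_list[OF rel, of ?\<sigma> "[]"] e2 by simp
  then show "weq \<Gamma> w []" using iff w by simp
qed


section \<open>Reflections and walls\<close>

text \<open>Bracketed to the right and written with unary minus so that conjugates are stable under
  the simp rules declared in the locale below.\<close>

abbreviation cj :: "'g :: group_add \<Rightarrow> 'g \<Rightarrow> 'g" where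
  "cj g t \<equiv> g + (t + - g)"

lemma cj_eq_iff: "cj g t = u \<longleftrightarrow> t = cj (- g) (u :: 'g :: group_add)"
  by (auto simp: add.assoc simp del: add_uminus_conv_diff)

lemma cj_inject: "cj g t = cj g u \<longleftrightarrow> t = (u :: 'g :: group_add)"
  by (auto simp del: add_uminus_conv_diff)

lemma cj_add: "cj (g + h) t = cj g (cj h (t :: 'g :: group_add))"
  by (simp add: add.assoc minus_add del: add_uminus_conv_diff)

lemma cj_eq_commute: "cj g t = t \<longleftrightarrow> g + t = t + (g :: 'g :: group_add)"
  by (metis add.assoc add_uminus_conv_diff diff_eq_eq)

text \<open>Interpreted for \<open>\<Psi>\<close> with left translations and, inside that theory,
  for \<open>\<Phi>\<close> with an embedding. The \<open>refls\<close> and \<open>Inv\<close> of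
  the second interpretation need not be those of the ambient group.\<close>

locale racg_rep =
  fixes \<Gamma> :: "'v ugraph" and e :: "'v \<Rightarrow> 'g :: group_add"
  assumes simplicial: "simplicial_graph \<Gamma>" and basis: "racg_basis \<Gamma> e"
begin

declare add_uminus_conv_diff [simp del] add.assoc [simp] minus_add [simp]

abbreviation "V \<equiv> verts \<Gamma>"
abbreviation "ev w \<equiv> sum_list (map e w)"

definition "adj s t \<longleftrightarrow> {s, t} \<in> edges \<Gamma>"
definition "W = ev ` lists V"

lemma adj_sym: "adj s t \<Longrightarrow> adj t s"
  by (simp add: adj_def insert_commute)

lemma adj_verts: "adj s t \<Longrightarrow> s \<in> V \<and> t \<in> V \<and> s \<noteq> t"
  using edge_verts[OF simplicial] by (auto simp: adj_def)

lemmas relations = racg_basis_imp_relations[OF simplicial basis]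

lemma e_uminus [simp]: "s \<in> V \<Longrightarrow> - e s = e s"
  using relations by (intro minus_unique) (simp add: racg_relations_def)

lemma e_double [simp]: "s \<in> V \<Longrightarrow> e s + e s = 0"
  using relations by (simp add: racg_relations_def)

lemma e_cancel [simp]: "s \<in> V \<Longrightarrow> e s + (e s + x) = x"
  by (simp flip: add.assoc)

lemma e_commute: "adj s t \<Longrightarrow> e s + e t = e t + e s"
  using relations unfolding racg_relations_def adj_def by blast

lemma e_commute2: "adj s t \<Longrightarrow> e s + (e t + x) = e t + (e s + x)"
  using e_commute[of s t] by (simp flip: add.assoc)

lemma ev_rev: "w \<in> lists V \<Longrightarrow> ev (rev w) = - ev w"
  by (induction w) auto

lemma W_ev [intro]: "w \<in> lists V \<Longrightarrow> ev w \<in> W"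
  by (simp add: W_def)

lemma W_E: "g \<in> W \<Longrightarrow> (\<And>w. w \<in> lists V \<Longrightarrow> g = ev w \<Longrightarrow> thesis) \<Longrightarrow> thesis"
  by (auto simp: W_def)

lemma W_0 [simp]: "0 \<in> W"
  using W_ev[of "[]"] by simp

lemma W_e [simp]: "s \<in> V \<Longrightarrow> e s \<in> W"
  using W_ev[of "[s]"] by simp

lemma W_add [simp]: "g \<in> W \<Longrightarrow> h \<in> W \<Longrightarrow> g + h \<in> W"
  by (elim W_E) (metis W_ev append_in_lists_conv map_append sum_list_append)

lemma W_uminus [simp]: "g \<in> W \<Longrightarrow> - g \<in> W"
proof (elim W_E)
  fix w assume w: "w \<in> lists V" "g = ev w"
  then have "rev w \<in> lists V" by (simp add: in_lists_conv_set)
  then show "- g \<in> W" using w W_ev ev_rev by metis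
qed

lemma foldr_act_eq:
  assumes "v \<in> lists V" "w \<in> lists V" "ev v = ev w"
    and "\<And>s x. s \<in> V \<Longrightarrow> act s (act s x) = x"
    and "\<And>s t x. adj s t \<Longrightarrow> act s (act t x) = act t (act s x)"
  shows "foldr act v = foldr act w"
proof (rule weq_foldr)
  show "weq \<Gamma> v w" using basis assms(1-3) by (simp add: racg_basis_def)
qed (use assms(4,5) in \<open>auto simp: adj_def\<close>)

text \<open>The letter \<open>s\<close> negates a bit and the other letters fix it: this is the
  coordinate of \<open>s\<close> in the abelianization.\<close>

lemma ev_eq_parity:
  assumes "v \<in> lists V" "w \<in> lists V" "ev v = ev w"
  shows "even (count_list v s) \<longleftrightarrow> even (count_list w s)"
proof -
  define act where "act t b \<longleftrightarrow> (b \<noteq> (t = s))" for t b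
  have "foldr act w False = odd (count_list w s)" for w
    by (induction w) (auto simp: act_def)
  moreover have "foldr act v = foldr act w"
    by (rule foldr_act_eq[OF assms]) (auto simp: act_def)
  ultimately show ?thesis by metis
qed

lemma e_inject:
  assumes "s \<in> V" "t \<in> V" "e s = e t"
  shows "s = t"
  using ev_eq_parity[of "[s]" "[t]" s] assms by (auto split: if_splits)

text \<open>A pair of non-adjacent generators generates an infinite dihedral group, which is detected by
  its action on the integers.\<close>

definition dih :: "'v \<Rightarrow> 'v \<Rightarrow> 'v \<Rightarrow> int \<Rightarrow> int" where
  "dih s t u n = (if u = s then - n else if u = t then 1 - n else n)"

lemma foldr_dih_eq:
  assumes "v \<in> lists V" "w \<in> lists V" "ev v = ev w" and "\<not> adj s t"
  shows "foldr (dih s t) v = foldr (dih s t) w"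
  by (rule foldr_act_eq[OF assms(1-3)])
     (use assms(4) adj_verts adj_sym in \<open>auto simp: dih_def\<close>)

text \<open>Here \<open>s\<close> reflects the line at 0 and \<open>t\<close> at 1/2. These two play
  ping-pong, so the position of the image of 0 reveals the first letter of an alternating
  word.\<close>

lemma foldr_dih_alternating:
  assumes "distinct_adj w" "set w \<subseteq> {s, t}" "s \<noteq> t" "w \<noteq> []"
  shows "if hd w = s then foldr (dih s t) w 0 \<le> 0 else foldr (dih s t) w 0 \<ge> 1"
  using assms
proof (induction w)
  case (Cons u w)
  then show ?case by (cases w) (auto simp: dih_def split: if_splits)
qed simp

lemma commute_imp_adj:
  assumes "s \<in> V" "t \<in> V" "s \<noteq> t" "e s + e t = e t + e s"
  shows "adj s t"
proof (rule ccontr)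
  assume "\<not> adj s t"
  then have "foldr (dih s t) [s, t] = foldr (dih s t) [t, s]"
    by (rule foldr_dih_eq[rotated 3]) (use assms in auto)
  then show False using assms(3) by (auto simp: dih_def fun_eq_iff dest: spec[of _ 0])
qed

section \<open>The reflection cocycle\<close>

text \<open>\<open>Inv g\<close> is the set of reflections whose wall separates \<open>0\<close> from \<open>g\<close>, in the sense that a
  path from \<open>0\<close> to \<open>g\<close> in the Cayley graph crosses the wall an odd number of times.\<close>

lemma e_conj_eq: "s \<in> V \<Longrightarrow> e s + (t + e s) = u \<longleftrightarrow> t = e s + (u + e s)"
  using cj_eq_iff[of "e s" t u] by simp

text \<open>The symmetric difference of \<open>{e s}\<close> and the conjugate of \<open>X\<close>
  by \<open>e s\<close>. Folded along a word from \<open>{}\<close>, it collects the reflections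
  whose walls the path crosses an odd number of times.\<close>

definition wact :: "'v \<Rightarrow> 'g set \<Rightarrow> 'g set" where
  "wact s X = {t. (t = e s) \<noteq> (e s + (t + e s) \<in> X)}"

lemma mem_wact: "t \<in> wact s X \<longleftrightarrow> (t = e s) \<noteq> (e s + (t + e s) \<in> X)"
  by (simp add: wact_def)

lemma foldr_wact:
  "w \<in> lists V \<Longrightarrow> t \<in> foldr wact w X \<longleftrightarrow> (t \<in> foldr wact w {}) \<noteq> (cj (- ev w) t \<in> X)"
  by (induction w arbitrary: t) (auto simp: mem_wact)

definition Inv :: "'g \<Rightarrow> 'g set" where
  "Inv g = foldr wact (SOME w. w \<in> lists V \<and> ev w = g) {}"

text \<open>The maps \<open>wact s\<close> satisfy the Coxeter relations, so the word chosen in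
  \<open>Inv\<close> is immaterial.\<close>

lemma Inv_ev:
  assumes "w \<in> lists V"
  shows "Inv (ev w) = foldr wact w {}"
proof -
  define v where "v = (SOME v. v \<in> lists V \<and> ev v = ev w)"
  have "v \<in> lists V \<and> ev v = ev w" unfolding v_def by (rule someI[of _ w]) (use assms in simp)
  then have "foldr wact v = foldr wact w"
  proof (intro foldr_act_eq)
    fix s X assume s: "s \<in> V"
    have "e s + (t + e s) = e s \<longleftrightarrow> t = e s" for t using s by (simp add: e_conj_eq)
    then show "wact s (wact s X) = X" using s by (auto simp: mem_wact)
  next
    fix s u X assume su: "adj s u"
    then have V: "s \<in> V" "u \<in> V" using adj_verts by auto
    note c = e_commute[OF su] e_commute2[OF su]
    have "e s + (t + e s) = e u \<longleftrightarrow> t = e u" for t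
      using V c(1) by (simp add: e_conj_eq flip: c(1))
    moreover have "e u + (t + e u) = e s \<longleftrightarrow> t = e s" for t
      using V by (simp add: e_conj_eq c(1))
    moreover have "e s + (e u + (t + (e u + e s))) = e u + (e s + (t + (e s + e u)))" for t
      using c by simp
    ultimately show "wact s (wact u X) = wact u (wact s X)" by (auto simp: mem_wact)
  qed (use assms in auto)
  then show ?thesis by (simp add: Inv_def v_def)
qed

lemma Inv_0 [simp]: "Inv 0 = {}"
  using Inv_ev[of "[]"] by simp

lemma Inv_e [simp]: "s \<in> V \<Longrightarrow> Inv (e s) = {e s}"
  using Inv_ev[of "[s]"] by (auto simp: wact_def)

text \<open>A path to \<open>g\<close> is continued by the translate by \<open>g\<close> of a path
  to \<open>h\<close>. This cocycle identity is the main computational tool of the theory of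
  walls.\<close>

lemma Inv_add: "g \<in> W \<Longrightarrow> h \<in> W \<Longrightarrow> t \<in> Inv (g + h) \<longleftrightarrow> (t \<in> Inv g) \<noteq> (cj (- g) t \<in> Inv h)"
proof (elim W_E)
  fix v w assume vw: "v \<in> lists V" "w \<in> lists V" "g = ev v" "h = ev w"
  then have "Inv (g + h) = foldr wact v (foldr wact w {})" using Inv_ev[of "v @ w"] by simp
  then show ?thesis using vw foldr_wact[of v t "foldr wact w {}"] by (simp add: Inv_ev)
qed

lemma Inv_uminus: "g \<in> W \<Longrightarrow> t \<in> Inv (- g) \<longleftrightarrow> cj g t \<in> Inv g"
  using Inv_add[of g "- g" "cj g t"] by simp

section \<open>Reflections and the exchange condition\<close>

definition "refls = {cj g (e s) | g s. g \<in> W \<and> s \<in> V}"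

lemma reflsE:
  assumes "r \<in> refls"
  obtains g s where "g \<in> W" "s \<in> V" "r = cj g (e s)"
  using assms by (auto simp: refls_def)

lemma refls_W [simp]: "r \<in> refls \<Longrightarrow> r \<in> W"
  by (elim reflsE) simp

lemma refls_uminus [simp]: "r \<in> refls \<Longrightarrow> - r = r"
  by (elim reflsE) simp

lemma refls_double [simp]: "r \<in> refls \<Longrightarrow> r + r = 0"
  by (elim reflsE) simp

lemma refls_cancel [simp]: "r \<in> refls \<Longrightarrow> r + (r + x) = x"
  by (simp flip: add.assoc)

lemma refls_e: "s \<in> V \<Longrightarrow> e s \<in> refls"
  unfolding refls_def by (rule CollectI, rule exI[of _ 0]) auto

lemma refls_cj: "r \<in> refls \<Longrightarrow> g \<in> W \<Longrightarrow> cj g r \<in> refls"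
proof (elim reflsE)
  fix h s assume *: "g \<in> W" "h \<in> W" "s \<in> V" and r: "r = cj h (e s)"
  have "cj g r = cj (g + h) (e s)" by (simp add: r)
  then show "cj g r \<in> refls" unfolding refls_def using * W_add by blast
qed

text \<open>On the path to \<open>g\<close>, across one edge and back by the mirror image, crossings
  pair off except for the one in the middle.\<close>

lemma refls_Inv_self: "r \<in> refls \<Longrightarrow> r \<in> Inv r"
proof (elim reflsE)
  fix g s assume gs: "g \<in> W" "s \<in> V" and r: "r = cj g (e s)"
  have "r \<in> Inv r \<longleftrightarrow> (r \<in> Inv g) \<noteq> (e s \<in> Inv (e s + - g))"
    using Inv_add[of g "e s + - g" r] gs unfolding r by simp
  also have "e s \<in> Inv (e s + - g) \<longleftrightarrow> \<not> e s \<in> Inv (- g)"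
    using Inv_add[of "e s" "- g" "e s"] gs by simp
  also have "e s \<in> Inv (- g) \<longleftrightarrow> r \<in> Inv g" using Inv_uminus gs r by simp
  finally show ?thesis by blast
qed

lemma refls_Inv_add: "r \<in> refls \<Longrightarrow> g \<in> W \<Longrightarrow> r \<in> Inv (r + g) \<longleftrightarrow> r \<notin> Inv g"
  using Inv_add[of r g r] refls_Inv_self by simp

lemma Inv_add_e:
  "g \<in> W \<Longrightarrow> s \<in> V \<Longrightarrow> t \<in> Inv (g + e s) \<longleftrightarrow> (t \<in> Inv g) \<noteq> (t = cj g (e s))"
  using Inv_add[of g "e s" t] cj_eq_iff[of g "e s" t] by auto

text \<open>The strong exchange condition: the word splits where the wall of \<open>t\<close> is
  crossed, and multiplying by \<open>t\<close> from the left deletes the letter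
  \<open>s\<close>.\<close>

lemma foldr_wact_exchange:
  "w \<in> lists V \<Longrightarrow> t \<in> foldr wact w {} \<Longrightarrow> \<exists>a s b. w = a @ s # b \<and> t = cj (ev a) (e s)"
proof (induction w arbitrary: t)
  case (Cons u w)
  show ?case
  proof (cases "t = e u")
    case True
    then show ?thesis by (intro exI[of _ "[]"]) auto
  next
    case False
    with Cons.prems(2) have "e u + (t + e u) \<in> foldr wact w {}" by (simp add: mem_wact)
    with Cons.IH[OF _ this] Cons.prems(1)
    obtain a s b where "w = a @ s # b" "e u + (t + e u) = cj (ev a) (e s)" by auto
    moreover from this have "t = e u + (cj (ev a) (e s) + e u)"
      using Cons.prems(1) by (simp add: e_conj_eq)
    ultimately show ?thesis using Cons.prems(1) by (intro exI[of _ "u # a"]) auto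
  qed
qed simp

lemma exchange:
  assumes "w \<in> lists V" "t \<in> Inv (ev w)"
  obtains a s b where "w = a @ s # b" "t = cj (ev a) (e s)"
  using foldr_wact_exchange[of w t] assms Inv_ev by auto

section \<open>Word length and descents\<close>

definition "len g = (LEAST n. \<exists>w \<in> lists V. length w = n \<and> ev w = g)"

lemma reduced_word:
  assumes "g \<in> W"
  obtains w where "w \<in> lists V" "ev w = g" "length w = len g"
proof -
  have "\<exists>n. \<exists>w \<in> lists V. length w = n \<and> ev w = g" using assms by (auto simp: W_def)
  from LeastI_ex[OF this] show thesis using that unfolding len_def by blast
qed

lemma len_ev_le: "w \<in> lists V \<Longrightarrow> len (ev w) \<le> length w"
  unfolding len_def by (rule Least_le) auto

text \<open>By exchange, \<open>r\<close> deletes a letter from a shortest word for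
  \<open>g\<close>.\<close>

lemma Inv_imp_len_less:
  assumes "g \<in> W" "r \<in> Inv g"
  shows "len (r + g) < len g"
proof -
  obtain w where w: "w \<in> lists V" "ev w = g" "length w = len g" using reduced_word assms by blast
  obtain a s b where asb: "w = a @ s # b" "r = cj (ev a) (e s)"
    using exchange[of w r] w assms by auto
  then have "r + g = ev (a @ b)" using w by auto
  moreover have "a @ b \<in> lists V" "length (a @ b) < length w" using asb w by auto
  ultimately show ?thesis using len_ev_le[of "a @ b"] w by simp
qed

lemma len_less_iff: "r \<in> refls \<Longrightarrow> g \<in> W \<Longrightarrow> len (r + g) < len g \<longleftrightarrow> r \<in> Inv g"
  using Inv_imp_len_less[of g r] Inv_imp_len_less[of "r + g" r] refls_Inv_add[of r g] by auto

lemma left_descent: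
  assumes "g \<in> W" "g \<noteq> 0"
  obtains s where "s \<in> V" "e s \<in> Inv g" "len (e s + g) < len g"
proof -
  obtain w where w: "w \<in> lists V" "ev w = g" "length w = len g" using reduced_word assms by blast
  then obtain s u where su: "w = s # u" using assms by (cases w) auto
  then have "len (e s + g) < len g" using w len_ev_le[of u] by auto
  then show thesis using that[of s] len_less_iff[of "e s" g] refls_e su w assms by auto
qed

lemma right_descent:
  assumes "g \<in> W" "g \<noteq> 0"
  obtains s where "s \<in> V" "len (g + e s) < len g" "cj g (e s) \<in> Inv g"
proof -
  obtain w where w: "w \<in> lists V" "ev w = g" "length w = len g" using reduced_word assms by blast
  then obtain s u where su: "w = u @ [s]" using assms by (cases w rule: rev_cases) auto
  then have s: "s \<in> V" using w by auto
  have "g + e s = ev u" using w su s by auto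
  then have l: "len (g + e s) < len g" using w su len_ev_le[of u] by auto
  have "cj g (e s) + g = g + e s" using s by simp
  then show thesis
    using that[OF s l] l len_less_iff[OF refls_cj[OF refls_e[OF s] assms(1)] assms(1)] by simp
qed

lemma distinct_adj_word:
  "w \<in> lists V \<Longrightarrow> \<exists>v. distinct_adj v \<and> set v \<subseteq> set w \<and> ev v = ev w"
proof (induction w)
  case (Cons s w)
  then obtain v where v: "distinct_adj v" "set v \<subseteq> set w" "ev v = ev w" by auto
  show ?case
  proof (cases "v \<noteq> [] \<and> hd v = s")
    case True
    then obtain u where "v = s # u" by (cases v) auto
    moreover have "ev u = e s + ev v" using calculation Cons.prems by simp
    ultimately show ?thesis using v by (intro exI[of _ u]) (auto simp: distinct_adj_Cons)
  next
    case False
    then show ?thesis using v by (intro exI[of _ "s # v"]) (auto simp: distinct_adj_Cons)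
  qed
qed simp

text \<open>Take an alternating word for the element and let \<open>z\<close> be the letter that it
  does not start with. If \<open>e z\<close> were a descent, exchange and parity would give an
  initial part \<open>c\<close>, followed by \<open>z\<close>, that commutes with \<open>z\<close>.
  Then \<open>c @ [z]\<close> and \<open>z # c\<close> are alternating words of equal value with
  different first letters, which the action on the integers excludes.\<close>

lemma dihedral_descents:
  assumes "s \<in> V" "t \<in> V" "s \<noteq> t" "\<not> adj s t" "set w \<subseteq> {s, t}"
  shows "\<not> (e s \<in> Inv (ev w) \<and> e t \<in> Inv (ev w))"
proof
  assume both: "e s \<in> Inv (ev w) \<and> e t \<in> Inv (ev w)"
  have wV: "w \<in> lists V" using assms by (auto simp: in_lists_conv_set)
  obtain v where v: "distinct_adj v" "set v \<subseteq> {s, t}" "ev v = ev w"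
    using distinct_adj_word[OF wV] assms(5) by blast
  have vV: "v \<in> lists V" using assms v by (auto simp: in_lists_conv_set)
  have "v \<noteq> []" using both v by auto
  define z where "z = (if hd v = s then t else s)"
  have "e z \<in> Inv (ev v)" using both v by (simp add: z_def)
  then obtain c u d where cud: "v = c @ u # d" "e z = cj (ev c) (e u)"
    using exchange vV by blast
  have V: "c \<in> lists V" "u \<in> V" "z \<in> V" using vV cud assms by (auto simp: z_def)
  have "ev (z # c) = ev (c @ [u])" unfolding list.map sum_list.Cons cud(2) using V by simp
  then have "even (count_list (z # c) z) \<longleftrightarrow> even (count_list (c @ [u]) z)"
    by (intro ev_eq_parity) (use V in auto)
  then have "u = z" by (auto split: if_splits)
  have "c \<noteq> []" using \<open>u = z\<close> cud \<open>v \<noteq> []\<close> assms(3) v(2) by (cases c) (auto simp: z_def split: if_splits)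
  then have hd: "hd c = hd v" using cud by simp
  have zhd: "hd v \<noteq> z" using assms(3) by (auto simp: z_def)
  have "hd v \<in> {s, t}" using v(2) \<open>v \<noteq> []\<close> by (meson hd_in_set subsetD)
  define m n where "m = foldr (dih s t) (c @ [z]) 0" and "n = foldr (dih s t) (z # c) 0"
  have "if hd (c @ [z]) = s then m \<le> 0 else m \<ge> 1" unfolding m_def
    by (rule foldr_dih_alternating)
       (use v(1,2) cud \<open>u = z\<close> assms(3) in \<open>auto simp: distinct_adj_append_iff\<close>)
  moreover have "if hd (z # c) = s then n \<le> 0 else n \<ge> 1" unfolding n_def
    by (rule foldr_dih_alternating)
       (use v(1,2) cud hd zhd \<open>c \<noteq> []\<close> \<open>u = z\<close> assms(3) in
         \<open>auto simp: distinct_adj_Cons distinct_adj_append_iff\<close>)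
  moreover have "m = n" unfolding m_def n_def
    using foldr_dih_eq[OF _ _ \<open>ev (z # c) = ev (c @ [u])\<close> assms(4)] V \<open>u = z\<close>
    by (metis Cons_in_lists_iff append_in_lists_conv lists.Nil)
  ultimately show False
    using \<open>c \<noteq> []\<close> hd zhd assms(3) \<open>hd v \<in> {s, t}\<close> by (auto simp: z_def split: if_splits)
qed

text \<open>Reduce to the dihedral group \<open>P\<close> generated by \<open>s\<close> and \<open>t\<close> by splitting off a shortest
  representative of the coset of \<open>P\<close>.\<close>

lemma descents_adj:
  assumes "s \<in> V" "t \<in> V" "s \<noteq> t" "g \<in> W" "e s \<in> Inv g" "e t \<in> Inv g"
  shows "adj s t"
proof (rule ccontr)
  assume nadj: "\<not> adj s t"
  define P where "P = ev ` lists {s, t}"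
  have PW: "p \<in> W" if "p \<in> P" for p
    using that assms(1,2) by (auto simp: P_def intro!: W_ev)
  have P_add: "p + q \<in> P" if "p \<in> P" "q \<in> P" for p q
  proof -
    obtain v w where "v \<in> lists {s, t}" "w \<in> lists {s, t}" "p = ev v" "q = ev w"
      using \<open>p \<in> P\<close> \<open>q \<in> P\<close> by (auto simp: P_def)
    then show ?thesis unfolding P_def by (intro image_eqI[of _ _ "v @ w"]) auto
  qed
  have P_uminus: "- p \<in> P" if "p \<in> P" for p
  proof -
    obtain v where v: "v \<in> lists {s, t}" "p = ev v" using \<open>p \<in> P\<close> by (auto simp: P_def)
    moreover have "v \<in> lists V" using v assms(1,2) by (auto simp: in_lists_conv_set)
    ultimately show ?thesis
      unfolding P_def using ev_rev by (intro image_eqI[of _ _ "rev v"]) (auto simp: in_lists_conv_set)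
  qed
  have Pe: "e s \<in> P" "e t \<in> P"
    unfolding P_def by (auto intro: image_eqI[of _ _ "[s]"] image_eqI[of _ _ "[t]"])
  define p where "p = arg_min (\<lambda>p. len (- p + g)) (\<lambda>p. p \<in> P)"
  note arg_min = arg_min_nat_lemma[of "\<lambda>p. p \<in> P", OF Pe(1), of "\<lambda>p. len (- p + g)"]
  have p: "p \<in> P" using arg_min by (simp add: p_def)
  have min: "len (- p + g) \<le> len (- q + g)" if "q \<in> P" for q
    using arg_min that by (auto simp: p_def)
  have no: "r \<notin> Inv (- p + g)" if "r \<in> P" "r \<in> refls" for r
  proof
    assume "r \<in> Inv (- p + g)"
    then have "len (r + (- p + g)) < len (- p + g)"
      by (rule Inv_imp_len_less[rotated]) (use PW p assms in auto)
    then show False using min[OF P_add[OF p that(1)]] that(2) by simp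
  qed
  \<comment> \<open>As no reflection of \<open>P\<close> lies in \<open>Inv (- p + g)\<close>, the
    cocycle identity hands the descent \<open>e u\<close> of \<open>g\<close> down to the dihedral
    part \<open>p\<close>.\<close>
  have "e u \<in> Inv p" if "u \<in> V" "e u \<in> P" "e u \<in> Inv g" for u
    using Inv_add[of p "- p + g" "e u"] PW[OF p] assms(4) that
      no[of "cj (- p) (e u)"] refls_cj[OF refls_e[OF that(1)], of "- p"]
      P_add[OF P_uminus[OF p] P_add[OF that(2) p]] by auto
  moreover obtain w where "w \<in> lists {s, t}" "p = ev w" using p by (auto simp: P_def)
  ultimately show False using dihedral_descents[OF assms(1-3) nadj, of w] assms Pe
    by (auto simp: in_lists_conv_set)
qed

section \<open>Centralizers of reflections and paths along a wall\<close>

text \<open>Letters are peeled off on the left. If \<open>e s\<close> is not a descent of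
  \<open>k\<close>, then \<open>e s\<close> and any descent \<open>e x\<close> of \<open>k\<close>
  are both descents of \<open>k + e s = e s + k\<close>, so \<open>x\<close> is adjacent to
  \<open>s\<close>.\<close>

lemma centralizer_e:
  assumes "k \<in> W" "s \<in> V" "k + e s = e s + k"
  shows "\<exists>w. set w \<subseteq> {x. x = s \<or> adj s x} \<and> ev w = k"
  using assms(1,3)
proof (induction "len k" arbitrary: k rule: less_induct)
  case less
  have step: ?case if "x = s \<or> adj s x" "e x \<in> Inv k" for x
  proof -
    have x: "x \<in> V" using that adj_verts assms by auto
    have "e s + e x = e x + e s" using that e_commute[of s x] by auto
    then have "e x + k + e s = e s + (e x + k)" using less.prems(2) by (metis add.assoc)
    moreover have "len (e x + k) < len k" using Inv_imp_len_less less.prems that by simp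
    ultimately obtain w where "set w \<subseteq> {x. x = s \<or> adj s x}" "ev w = e x + k"
      using less.hyps[of "e x + k"] less.prems x by auto
    then show ?thesis using that x by (intro exI[of _ "x # w"]) auto
  qed
  show ?case
  proof (cases "k = 0")
    case True
    then show ?thesis by (intro exI[of _ "[]"]) auto
  next
    case False
    then obtain x where x: "x \<in> V" "e x \<in> Inv k" using left_descent less.prems by blast
    show ?thesis
    proof (cases "e s \<in> Inv k \<or> x = s")
      case True
      then show ?thesis using step x by auto
    next
      case False
      have cj: "cj k (e s) = e s" using less.prems cj_eq_commute by blast
      have "e x \<noteq> e s" using e_inject x assms False by blast
      then have "e x \<in> Inv (k + e s)" "e s \<in> Inv (k + e s)"
        using Inv_add_e[OF less.prems(1) assms(2)] cj x False by auto
      then have "adj s x" using descents_adj[of s x "k + e s"] less.prems assms x False by auto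
      then show ?thesis using step x by blast
    qed
  qed
qed

text \<open>In \<open>v @ s # rev v\<close> only \<open>s\<close> occurs an odd number of
  times.\<close>

lemma cj_e_type:
  assumes "g \<in> W" "h \<in> W" "s \<in> V" "t \<in> V" "cj g (e s) = cj h (e t)"
  shows "s = t"
proof -
  obtain v w where vw: "v \<in> lists V" "w \<in> lists V" "g = ev v" "h = ev w"
    using assms(1,2) by (auto elim!: W_E)
  then have "ev (v @ s # rev v) = ev (w @ t # rev w)" using assms ev_rev by simp
  then have "even (count_list (v @ s # rev v) s) \<longleftrightarrow> even (count_list (w @ t # rev w) s)"
    by (rule ev_eq_parity[rotated 2]) (use vw assms in \<open>auto simp: in_lists_conv_set\<close>)
  then show ?thesis by (auto split: if_splits)
qed

text \<open>Two edges dual to the same wall differ by an element centralizing \<open>e s\<close>.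
  The letters of \<open>w\<close> slide an edge across squares or, in the case of \<open>s\<close>
  itself, flip it.\<close>

lemma wall_path:
  assumes "g \<in> W" "h \<in> W" "s \<in> V" "cj g (e s) = cj h (e s)"
  obtains w where "set w \<subseteq> {x. x = s \<or> adj s x}" "h = g + ev w"
proof -
  have "cj (- g + h) (e s) = e s" using assms(4) cj_eq_iff[of g "e s" "cj h (e s)"] by simp
  then have "(- g + h) + e s = e s + (- g + h)" using cj_eq_commute by blast
  moreover have "- g + h \<in> W" using assms by simp
  ultimately obtain w where "set w \<subseteq> {x. x = s \<or> adj s x}" "ev w = - g + h"
    using centralizer_e assms(3) by blast
  then show thesis using that by simp
qed

text \<open>Somewhere along the path of \<open>wall_path\<close> the membership of \<open>r\<close>
  changes; the step where it does exhibits a place where the two walls cross or coincide.\<close>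

lemma wall_crossing:
  assumes "g \<in> W" "h \<in> W" "s \<in> V" "cj g (e s) = cj h (e s)" "r \<in> Inv g" "r \<notin> Inv h"
  obtains k x where "k \<in> W" "cj k (e s) = cj g (e s)" "x = s \<or> adj s x" "r = cj k (e x)"
proof -
  obtain w where w: "set w \<subseteq> {x. x = s \<or> adj s x}" "h = g + ev w"
    using wall_path[OF assms(1-4)] .
  have "r \<notin> Inv (g + ev w)" using w assms by simp
  then have "\<exists>k x. k \<in> W \<and> cj k (e s) = cj g (e s) \<and> (x = s \<or> adj s x) \<and> r = cj k (e x)"
    using w(1) assms(1,5)
  proof (induction w arbitrary: g)
    case (Cons x w)
    then have x: "x \<in> V" "x = s \<or> adj s x" using adj_verts assms(3) by auto
    show ?case
    proof (cases "r = cj g (e x)")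
      case True
      then show ?thesis using Cons.prems x by blast
    next
      case False
      have "r \<in> Inv (g + e x)" using Inv_add_e Cons.prems False x by simp
      moreover have "cj (e x) (e s) = e s" using x cj_eq_commute e_commute[of s x] by metis
      then have "cj (g + e x) (e s) = cj g (e s)" by (simp only: cj_add)
      ultimately show ?thesis using Cons.IH[of "g + e x"] Cons.prems x by auto
    qed
  qed simp
  then show thesis using that by blast
qed

text \<open>Since \<open>r\<close> fixes \<open>t\<close> under conjugation, it carries an edge dual
  to the wall of \<open>t\<close> to another such edge, on the other side of the wall of
  \<open>r\<close>. Moving between the two along the wall of \<open>t\<close> crosses the wall of
  \<open>r\<close>.\<close>

lemma commuting_refls:
  assumes "r \<in> refls" "t \<in> refls" "r \<noteq> t" "r + t = t + r"
  obtains g s x where "g \<in> W" "adj s x" "r = cj g (e s)" "t = cj g (e x)"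
proof -
  obtain g x where g: "g \<in> W" "x \<in> V" "t = cj g (e x)" using assms reflsE by metis
  have "cj (r + g) (e x) = cj r t" using g by (simp add: cj_add)
  also have "\<dots> = t" using assms cj_eq_commute by blast
  finally have rg: "cj (r + g) (e x) = cj g (e x)" using g by simp
  have rgW: "r + g \<in> W" using assms(1) g(1) by simp
  have "\<exists>k s. k \<in> W \<and> cj k (e x) = t \<and> (s = x \<or> adj x s) \<and> r = cj k (e s)"
  proof (cases "r \<in> Inv g")
    case True
    then have "r \<notin> Inv (r + g)" using refls_Inv_add assms(1) g(1) by blast
    from wall_crossing[OF g(1) rgW g(2) rg[symmetric] True this]
    obtain k s where "k \<in> W" "cj k (e x) = cj g (e x)" "s = x \<or> adj x s" "r = cj k (e s)" .
    then show ?thesis unfolding g(3) by blast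
  next
    case False
    then have "r \<in> Inv (r + g)" using refls_Inv_add assms(1) g(1) by blast
    from wall_crossing[OF rgW g(1,2) rg this False]
    obtain k s where "k \<in> W" "cj k (e x) = cj (r + g) (e x)" "s = x \<or> adj x s" "r = cj k (e s)" .
    then show ?thesis unfolding g(3) rg by blast
  qed
  then obtain k s where k: "k \<in> W" "cj k (e x) = t" "s = x \<or> adj x s" "r = cj k (e s)" by blast
  then have "adj s x" using assms(3) adj_sym by auto
  then show thesis using that[of k s x] k by simp
qed

text \<open>\<open>below r t\<close>: all end points of edges dual to the wall of \<open>t\<close> are separated from \<open>0\<close> by
  the wall of \<open>r\<close>.\<close>

definition "below r t \<longleftrightarrow> (\<forall>g \<in> W. \<forall>s \<in> V. cj g (e s) = t \<longrightarrow> r \<in> Inv g)"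

section \<open>Nested and disjoint walls\<close>

lemma cj_commute:
  assumes "s = x \<or> adj s x" "r = cj k (e s)" "t = cj k (e x)"
  shows "r + t = t + r"
  using assms e_commute[of s x] e_commute2[of s x] by auto

text \<open>One edge decides for the whole wall: if another dual edge were on the other side of
  \<open>r\<close>, \<open>wall_crossing\<close> would make the reflections commute.\<close>

lemma belowI:
  assumes "r + t \<noteq> t + r" "g \<in> W" "s \<in> V" "cj g (e s) = t" "r \<in> Inv g"
  shows "below r t"
  unfolding below_def
proof (intro ballI impI, rule ccontr)
  fix h u assume h: "h \<in> W" "u \<in> V" "cj h (e u) = t" "r \<notin> Inv h"
  then have "u = s" using cj_e_type[of h g u s] assms by simp
  then obtain k x where "cj k (e s) = t" "x = s \<or> adj s x" "r = cj k (e x)"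
    using wall_crossing[of g h s r] assms h by metis
  then show False using cj_commute[of x s r k t] assms(1) adj_sym by auto
qed

text \<open>On a path from 0, consider the step that enters the intersection of the two far sides.
  Its edge is dual to one wall and lies beyond the other, so \<open>belowI\<close> makes the walls
  nested.\<close>

lemma Inv_disjoint:
  assumes "r + t \<noteq> t + r" "\<not> below r t" "\<not> below t r" "g \<in> W"
  shows "\<not> (r \<in> Inv g \<and> t \<in> Inv g)"
proof -
  obtain w where w: "w \<in> lists V" "g = ev w" using assms(4) by (elim W_E)
  have "\<not> (r \<in> Inv (ev w) \<and> t \<in> Inv (ev w))" using w(1)
  proof (induction w rule: rev_induct)
    case (snoc s w)
    then have s: "s \<in> V" "ev w \<in> W" by auto
    have "r \<noteq> t" using assms(1) by auto
    moreover have "t \<notin> Inv (ev w)" if "cj (ev w) (e s) = r"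
      using belowI[of t r "ev w" s] that s assms by auto
    moreover have "r \<notin> Inv (ev w)" if "cj (ev w) (e s) = t"
      using belowI[of r t "ev w" s] that s assms by auto
    ultimately show ?case using snoc Inv_add_e[OF s(2,1)] by auto
  qed simp
  then show ?thesis using w by simp
qed

text \<open>One element conjugates both reflections to adjacent generators. The crossings on the way
  there and back cancel, so \<open>t \<notin> Inv r\<close>, and the cocycle identity does the
  rest.\<close>

lemma commuting_Inv:
  assumes "r \<in> refls" "t \<in> refls" "r \<noteq> t" "r + t = t + r" "g \<in> W"
  shows "t \<in> Inv (r + g) \<longleftrightarrow> t \<in> Inv g"
proof -
  obtain k s x where k: "k \<in> W" "adj s x" "r = cj k (e s)" "t = cj k (e x)"
    using commuting_refls assms by metis
  then have V: "s \<in> V" "x \<in> V" "s \<noteq> x" using adj_verts by auto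
  then have ne: "e x \<noteq> e s" using e_inject by metis
  have cjs: "cj (e s) (e x) = e x" using k cj_eq_commute e_commute by blast
  have "t \<in> Inv r \<longleftrightarrow> (t \<in> Inv k) \<noteq> (e x \<in> Inv (e s + - k))"
    using Inv_add[of k "e s + - k" t] k V by simp
  also have "e x \<in> Inv (e s + - k) \<longleftrightarrow> e x \<in> Inv (- k)"
    using Inv_add[of "e s" "- k" "e x"] k V cjs ne by simp
  also have "e x \<in> Inv (- k) \<longleftrightarrow> t \<in> Inv k" using Inv_uminus k by simp
  finally have "t \<notin> Inv r" by blast
  moreover have "cj (- r) t = t" using cj_eq_commute assms by (metis refls_uminus)
  ultimately show ?thesis using Inv_add[of r g t] assms by simp
qed

end


section \<open>Embeddings in the triangle-free case\<close>

lemma commute_add: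
  fixes a b c :: "'g :: semigroup_add"
  assumes "a + b = b + a" "a + c = c + a"
  shows "a + (b + c) = (b + c) + a"
  using assms by (metis add.assoc)

context racg_rep
begin

section \<open>Involutions and their centralizers without triangles\<close>

lemma len_uminus:
  assumes "g \<in> W"
  shows "len (- g) = len g"
proof -
  have "len (- h) \<le> len h" if h: "h \<in> W" for h
  proof -
    obtain w where w: "w \<in> lists V" "ev w = h" "length w = len h" using reduced_word h by blast
    then have "rev w \<in> lists V" by (simp add: in_lists_conv_set)
    then show ?thesis using w len_ev_le[of "rev w"] ev_rev[of w] by simp
  qed
  from this[of g] this[of "- g"] show ?thesis using assms by simp
qed

lemma Inv_e_add_e:
  assumes "adj s t"
  shows "Inv (e s + e t) = {e s, e t}"
proof -
  have V: "s \<in> V" "t \<in> V" "s \<noteq> t" using adj_verts assms by auto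
  have cj: "cj (e s) (e t) = e t" using assms cj_eq_commute e_commute by blast
  have ne: "e s \<noteq> e t" using V e_inject by metis
  show ?thesis
  proof (rule Set.set_eqI)
    fix x
    have "x \<in> Inv (e s + e t) \<longleftrightarrow> (x \<in> Inv (e s)) \<noteq> (x = cj (e s) (e t))"
      by (rule Inv_add_e) (simp_all add: V)
    also have "\<dots> \<longleftrightarrow> (x \<in> {e s}) \<noteq> (x = e t)" by (simp only: cj Inv_e V)
    also have "\<dots> \<longleftrightarrow> x \<in> {e s, e t}" using ne by auto
    finally show "x \<in> Inv (e s + e t) \<longleftrightarrow> x \<in> {e s, e t}" .
  qed
qed

lemma no_triangle:
  assumes "triangle_free \<Gamma>" "adj s t" "adj t u" "adj s u"
  shows False
proof -
  have "s \<noteq> t" "t \<noteq> u" "s \<noteq> u" using adj_verts assms(2-4) by auto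
  moreover have "{s, t} \<in> edges \<Gamma>" "{t, u} \<in> edges \<Gamma>" "{u, s} \<in> edges \<Gamma>"
    using assms(2-4) adj_sym by (auto simp: adj_def)
  ultimately show False using assms(1) unfolding triangle_free_def by auto
qed

text \<open>In a conjugate of minimal length every descent is central, so the descents form a clique
  whose product is the whole element.\<close>

lemma involution_cases:
  assumes tf: "triangle_free \<Gamma>" and "g \<in> W" "g + g = 0" "g \<noteq> 0"
  obtains h s where "h \<in> W" "s \<in> V" "g = cj h (e s)"
  | h s t where "h \<in> W" "adj s t" "g = cj h (e s + e t)"
proof -
  obtain h where h: "h \<in> W" and "\<forall>k. k \<in> W \<longrightarrow> len (cj h g) \<le> len (cj k g)"
    using ex_has_least_nat[of "\<lambda>h. h \<in> W" 0 "\<lambda>h. len (cj h g)"] by auto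
  then have min: "len (cj h g) \<le> len (cj k g)" if "k \<in> W" for k using that by blast
  define g' where "g' = cj h g"
  have g': "g' \<in> W" "g' \<noteq> 0" "- g' = g'" "g = cj (- h) g'"
    using assms h cj_eq_iff[of h g 0] minus_unique[of g g] by (auto simp: g'_def)
  \<comment> \<open>As \<open>g'\<close> is its own inverse, a left descent is also a right descent.
    If \<open>e s\<close> did not commute with \<open>g'\<close>, both occurrences could be
    stripped, and the conjugate by \<open>e s\<close> would be shorter.\<close>
  have comm: "g' + e s = e s + g'" if s: "s \<in> V" "e s \<in> Inv g'" for s
  proof (rule ccontr)
    assume ne: "g' + e s \<noteq> e s + g'"
    then have "cj g' (e s) \<noteq> e s" using cj_eq_commute by blast
    then have "e s \<in> Inv (g' + e s)" using Inv_add_e[OF g'(1) s(1)] s by auto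
    then have "len (e s + (g' + e s)) < len (g' + e s)" using Inv_imp_len_less g' s by auto
    also have "len (g' + e s) = len (e s + g')"
      using len_uminus[of "g' + e s"] g' s by simp
    also have "\<dots> < len g'" using Inv_imp_len_less g' s by auto
    finally have "len (cj (e s + h) g) < len (cj h g)" using s by (simp add: g'_def)
    then show False using min[of "e s + h"] s h by simp
  qed
  obtain s where s: "s \<in> V" "e s \<in> Inv g'" using left_descent g' by blast
  define g1 where "g1 = e s + g'"
  have g1: "g1 \<in> W" "g' = e s + g1" "g1 + e s = e s + g1"
    using s g' comm[OF s] by (auto simp: g1_def)
  have s1: "e s \<notin> Inv g1" using refls_Inv_add[of "e s" g'] refls_e s g' by (auto simp: g1_def)
  show thesis
  proof (cases "g1 = 0")
    case True
    then have "g = cj (- h) (e s)" using g' g1 by simp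
    then show thesis using that(1) h s W_uminus by blast
  next
    case False
    then obtain x where x: "x \<in> V" "e x \<in> Inv g1" using left_descent g1 by blast
    then have ne: "e x \<noteq> e s" using s1 by auto
    have "cj g1 (e s) = e s" using g1(3) cj_eq_commute by blast
    then have "e x \<in> Inv (g1 + e s)" using Inv_add_e[OF g1(1) s(1)] x ne by auto
    then have x': "e x \<in> Inv g'" using g1 by simp
    have sx: "adj s x" using descents_adj[OF s(1) x(1) _ g'(1) s(2) x'] ne by auto
    define g2 where "g2 = e x + g1"
    have g2: "g2 \<in> W" "g1 = e x + g2" "g' = e s + (e x + g2)"
      using x g1 by (auto simp: g2_def)
    have c2: "g2 + e s = e s + g2"
      using g1(3) e_commute2[OF sx] e_commute[OF sx] by (simp add: g2_def)
    have c2x: "g2 + e x = e x + g2"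
    proof -
      have "e s + (e x + g2) + e x = e x + (e s + (e x + g2))" using comm[OF x(1) x'] g2 by simp
      also have "\<dots> = e s + g2" using e_commute2[OF sx] x by simp
      finally have "e x + (g2 + e x) = g2" by simp
      then have "e x + (e x + (g2 + e x)) = e x + g2" by simp
      then show ?thesis using x by simp
    qed
    show thesis
    proof (cases "g2 = 0")
      case True
      then have "g = cj (- h) (e s + e x)" using g' g2 by simp
      then show thesis using that(2) h sx W_uminus by blast
    next
      case False
      \<comment> \<open>A third letter would be a descent of \<open>g'\<close> as well; descents are
        pairwise adjacent, so \<open>s\<close>, \<open>x\<close> and \<open>y\<close> would form a
        triangle.\<close>
      then obtain y where y: "y \<in> V" "e y \<in> Inv g2" using left_descent g2 by blast
      have "e x \<notin> Inv g2" using refls_Inv_add[of "e x" g1] refls_e x g1 by (auto simp: g2_def)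
      then have yx: "e y \<noteq> e x" using y by auto
      have "cj (e x) (e s) = e s" using cj_eq_commute e_commute[OF sx] by metis
      then have "e s \<notin> Inv g2"
        using Inv_add[of "e x" g2 "e s"] s1 g2 ne x by auto
      then have ys: "e y \<noteq> e s" using y by auto
      have "cj g2 (e s) = e s" "cj g2 (e x) = e x" using c2 c2x cj_eq_commute by blast+
      then have "cj (- g2) (e y) \<notin> {e s, e x}"
        using ys yx cj_eq_iff[of "- g2" "e y"] by auto
      then have "e y \<in> Inv (g2 + (e s + e x))"
        using Inv_add[of g2 "e s + e x" "e y"] Inv_e_add_e[OF sx] y g2 s x by auto
      moreover have "g2 + (e s + e x) = e s + (g2 + e x)" using c2 by (metis add.assoc)
      then have "g2 + (e s + e x) = g'" using c2x g2 by simp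
      ultimately have "e y \<in> Inv g'" by simp
      then have "adj s y" "adj x y"
        using descents_adj[OF s(1) y(1) _ g'(1) s(2)] descents_adj[OF x(1) y(1) _ g'(1) x'] ys yx
        by auto
      then show thesis using no_triangle[OF tf sx] by blast
    qed
  qed
qed

text \<open>As for one generator, descents \<open>e a\<close> and \<open>e b\<close> of
  \<open>k\<close> can be peeled off. If neither is present, another descent \<open>e x\<close> of
  \<open>k\<close> would join both of them as descents of \<open>k + (e a + e b)\<close>, giving a
  triangle.\<close>

lemma centralizer_pair:
  assumes tf: "triangle_free \<Gamma>" and ab: "adj a b"
    and "k \<in> W" "k + (e a + e b) = (e a + e b) + k"
  shows "k \<in> {0, e a, e b, e a + e b}"
  using assms(3,4)
proof (induction "len k" arbitrary: k rule: less_induct)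
  case less
  have V: "a \<in> V" "b \<in> V" "a \<noteq> b" using adj_verts ab by auto
  note c = e_commute[OF ab] e_commute2[OF ab]
  have ne: "e a \<noteq> e b" using V e_inject by blast
  have step: ?case if x: "x \<in> {a, b}" "e x \<in> Inv k" for x
  proof -
    have "e x + (e a + e b) = (e a + e b) + e x" using x V c by auto
    then have "e x + k + (e a + e b) = (e a + e b) + (e x + k)"
      using less.prems(2) by (metis add.assoc)
    moreover have "len (e x + k) < len k" using Inv_imp_len_less less.prems that by simp
    ultimately have "e x + k \<in> {0, e a, e b, e a + e b}"
      using less.hyps[of "e x + k"] less.prems x V by auto
    moreover have "k = e x + (e x + k)" using x V by auto
    ultimately have "k \<in> {e x, e x + e a, e x + e b, e x + (e a + e b)}" by auto
    then show ?thesis using x V c by auto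
  qed
  show ?case
  proof (cases "k = 0 \<or> e a \<in> Inv k \<or> e b \<in> Inv k")
    case True
    then show ?thesis using step by auto
  next
    case False
    then obtain x where x: "x \<in> V" "e x \<in> Inv k" using left_descent less.prems by blast
    have xab: "x \<noteq> a" "x \<noteq> b" using x False by auto
    let ?p = "e a + e b"
    have pW: "?p \<in> W" using V by simp
    have kp: "t \<in> Inv (k + ?p) \<longleftrightarrow> (t \<in> Inv k) \<noteq> (cj (- k) t \<in> {e a, e b})" for t
      using Inv_add[OF less.prems(1) pW] Inv_e_add_e[OF ab] by simp
    have pk: "y \<in> {a, b} \<Longrightarrow> e y \<in> Inv (k + ?p)" for y
      using Inv_add[OF pW less.prems(1), of "e y"] Inv_e_add_e[OF ab] less.prems(2) False V c
      by auto
    have "cj (- k) (e y) = e z \<Longrightarrow> y = z" if "y \<in> V" "z \<in> V" for y z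
      using cj_e_type[of "- k" 0 y z] less.prems that by simp
    then have "cj (- k) (e x) \<notin> {e a, e b}" using x V xab by blast
    then have "e x \<in> Inv (k + ?p)" using kp x by blast
    then have "adj x a" "adj x b"
      using descents_adj[of x a "k + ?p"] descents_adj[of x b "k + ?p"] pk x V xab less.prems by auto
    then have False using no_triangle[OF tf _ ab] by blast
    then show ?thesis ..
  qed
qed

section \<open>Replacing generators by reflections\<close>

definition embeds :: "'u ugraph \<Rightarrow> ('u \<Rightarrow> 'g) \<Rightarrow> bool" where
  "embeds \<Phi> f \<longleftrightarrow> racg_basis \<Phi> f \<and> f ` verts \<Phi> \<subseteq> W"

text \<open>After conjugating \<open>f u\<close> to \<open>e a + e b\<close>, the images of all
  neighbours of \<open>u\<close> lie in the centralizer of this pair, so they are its factors. Two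
  different neighbours would have product \<open>f u\<close>, against parity in
  \<open>\<Phi>\<close>. Hence \<open>v\<close> is the only neighbour, and the transvection respects
  every relation.\<close>

lemma transvection:
  assumes tf: "triangle_free \<Gamma>" and \<Phi>: "simplicial_graph \<Phi>" and f: "embeds \<Phi> f"
    and uv: "{u, v} \<in> edges \<Phi>" and nr: "f u \<notin> refls"
  shows "embeds \<Phi> (f(u := f u + f v))" "f u + f v \<in> refls"
proof -
  interpret P: racg_rep \<Phi> f using \<Phi> f by unfold_locales (simp_all add: embeds_def)
  have uv': "P.adj u v" using uv by (simp add: P.adj_def)
  then have V: "u \<in> verts \<Phi>" "v \<in> verts \<Phi>" "u \<noteq> v" using P.adj_verts by auto
  have fW: "f w \<in> W" if "w \<in> verts \<Phi>" for w using f that by (auto simp: embeds_def)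
  have nz: "f w \<noteq> 0" if "w \<in> verts \<Phi>" for w using P.ev_eq_parity[of "[w]" "[]" w] that by auto
  have inv: "f u + f u = 0" using P.e_double V by blast
  obtain h a b where h: "h \<in> W" "adj a b" "f u = cj h (e a + e b)"
    using involution_cases[OF tf fW[OF V(1)] inv nz[OF V(1)]] nr refls_cj refls_e by metis
  then have ab: "a \<in> V" "b \<in> V" using adj_verts by auto
  have nbr: "f w = cj h (e a) \<or> f w = cj h (e b)" if w: "P.adj u w" for w
  proof -
    have wV: "w \<in> verts \<Phi>" "w \<noteq> u" using w P.adj_verts by auto
    define k where "k = cj (- h) (f w)"
    have fw: "f w = cj h k" by (simp add: k_def)
    have "cj h (k + (e a + e b)) = f w + f u" by (simp add: fw h(3))
    also have "\<dots> = f u + f w" by (rule P.e_commute[OF P.adj_sym[OF w]])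
    also have "\<dots> = cj h ((e a + e b) + k)" by (simp add: fw h(3))
    finally have "k + (e a + e b) = (e a + e b) + k" using cj_inject by blast
    then have "k \<in> {0, e a, e b, e a + e b}"
      using centralizer_pair[OF tf h(2)] h(1) fW wV by (simp add: k_def)
    moreover have "k \<noteq> 0" using nz[OF wV(1)] fw by auto
    moreover have "k \<noteq> e a + e b" using P.e_inject[of w u] wV V fw h(3) by auto
    ultimately show ?thesis using fw by auto
  qed
  have only: "w = v" if w: "P.adj u w" for w
  proof (rule ccontr)
    assume "w \<noteq> v"
    moreover have wV: "w \<in> verts \<Phi>" "w \<noteq> u" using w P.adj_verts by auto
    ultimately have "f w \<noteq> f v" using P.e_inject V by blast
    then have "f u = f v + f w" using nbr[OF w] nbr[OF uv'] e_commute2[OF h(2)] h(3)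
      by auto
    then show False using P.ev_eq_parity[of "[u]" "[v, w]" u] V wV by auto
  qed
  note c = P.e_commute[OF uv'] P.e_commute2[OF uv']
  show "f u + f v \<in> refls"
  proof -
    have "f u + f v \<in> {cj h (e b), cj h (e a)}"
      using nbr[OF uv'] h(3) e_commute2[OF h(2)] ab by auto
    then show ?thesis using refls_cj refls_e h ab by auto
  qed
  have "racg_basis \<Phi> (f(u := f u + f v))"
  proof (rule racg_basis_subst[OF P.basis, where \<sigma> = "\<lambda>x. if x = u then [u, v] else [x]"])
    show "racg_relations \<Phi> (f(u := f u + f v))"
      unfolding racg_relations_def
    proof (intro conjI ballI allI impI)
      fix s assume "s \<in> verts \<Phi>"
      then show "(f(u := f u + f v)) s + (f(u := f u + f v)) s = 0"
        using V c by simp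
    next
      fix s t assume "{s, t} \<in> edges \<Phi>"
      then have st: "P.adj s t" by (simp add: P.adj_def)
      then have "s \<noteq> t" using P.adj_verts by blast
      consider "s = u" "t = v" | "t = u" "s = v" | "s \<noteq> u" "t \<noteq> u"
        using only st P.adj_sym by blast
      then show "(f(u := f u + f v)) s + (f(u := f u + f v)) t =
          (f(u := f u + f v)) t + (f(u := f u + f v)) s"
        using V c P.e_commute[OF st] by cases auto
    qed
  qed (use V in auto)
  then show "embeds \<Phi> (f(u := f u + f v))" using fW V by (auto simp: embeds_def)
qed

lemma nonisolated_to_refls:
  assumes tf: "triangle_free \<Gamma>" and \<Phi>: "simplicial_graph \<Phi>" "finite (verts \<Phi>)"
    and "embeds \<Phi> f"
  obtains f' where "embeds \<Phi> f'" "\<And>u v. {u, v} \<in> edges \<Phi> \<Longrightarrow> f' u \<in> refls"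
proof -
  define B where "B f = {u \<in> verts \<Phi>. f u \<notin> refls \<and> (\<exists>v. {u, v} \<in> edges \<Phi>)}" for f
  have "\<exists>f'. embeds \<Phi> f' \<and> B f' = {}"
    using assms(4)
  proof (induction "card (B f)" arbitrary: f rule: less_induct)
    case less
    show ?case
    proof (cases "B f = {}")
      case False
      then obtain u v where uv: "u \<in> verts \<Phi>" "f u \<notin> refls" "{u, v} \<in> edges \<Phi>" "u \<in> B f"
        by (auto simp: B_def)
      note t = transvection[OF tf \<Phi>(1) less.prems uv(3,2)]
      have "B (f(u := f u + f v)) \<subset> B f" using t(2) uv by (auto simp: B_def)
      moreover have "finite (B f)" using \<Phi> by (simp add: B_def)
      ultimately have "card (B (f(u := f u + f v))) < card (B f)" by (rule psubset_card_mono[rotated])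
      then show ?thesis using less.hyps t(1) by blast
    qed (use less.prems in auto)
  qed
  then obtain f' where f': "embeds \<Phi> f'" "B f' = {}" by blast
  have "f' u \<in> refls" if "{u, v} \<in> edges \<Phi>" for u v
    using f'(2) edge_verts[OF \<Phi>(1) that] that unfolding B_def by blast
  then show thesis using that f' by blast
qed

text \<open>The new family generates a smaller subgroup, so no substitution can be inverted.
  Ping-pong is played inside \<open>C(\<Phi>)\<close> instead: the wall of \<open>u v u\<close> lies
  beyond that of \<open>u\<close>, so the new far sides are contained in the old ones and inherit
  their disjointness.\<close>

lemma isolated_conjugate:
  assumes \<Phi>: "simplicial_graph \<Phi>" and f: "embeds \<Phi> f"
    and uv: "u \<in> verts \<Phi>" "v \<in> verts \<Phi>" "u \<noteq> v" and iso: "\<And>w. {u, w} \<notin> edges \<Phi>"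
  shows "embeds \<Phi> (f(u := cj (f u) (f v)))"
proof -
  interpret P: racg_rep \<Phi> f using \<Phi> f by unfold_locales (simp_all add: embeds_def)
  have nadj: "\<not> P.adj u w" "\<not> P.adj w u" for w using iso P.adj_sym unfolding P.adj_def by blast+
  define f' where "f' = f(u := cj (f u) (f v))"
  have f'u: "f' u = f u + (f v + f u)" using uv by (simp add: f'_def)
  have f'_other: "w \<noteq> u \<Longrightarrow> f' w = f w" for w by (simp add: f'_def)
  have refl: "f' w \<in> P.refls" if "w \<in> verts \<Phi>" for w
    using that P.refls_e P.refls_cj[OF P.refls_e[OF uv(2)], of "f u"] uv by (simp add: f'_def)
  \<comment> \<open>If \<open>g\<close> were not beyond the wall of \<open>u\<close>, then
    \<open>u\<close> and \<open>v\<close> would both be descents of \<open>f u + g\<close> although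
    they are not adjacent.\<close>
  have below: "f u \<in> P.Inv g" if "f' u \<in> P.Inv g" "g \<in> P.W" for g
  proof (rule ccontr)
    assume "f u \<notin> P.Inv g"
    then have "f u \<in> P.Inv (f u + g)" using P.refls_Inv_add P.refls_e uv that by blast
    moreover have "f v \<in> P.Inv (f u + g)"
      using P.Inv_add[of "f u" g "f v"] that uv P.e_inject[of u v] f'u by auto
    ultimately have "P.adj u v" using P.descents_adj[of u v "f u + g"] uv that by auto
    then show False using nadj by blast
  qed
  have below': "f x \<in> P.Inv g" if "f' x \<in> P.Inv g" "g \<in> P.W" for g x
    using below that f'_other by (cases "x = u") auto
  have edge: "x \<noteq> u" "y \<noteq> u" "P.adj x y" if "{x, y} \<in> edges \<Phi>" for x y
    using that nadj unfolding P.adj_def by blast+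
  have rel: "racg_relations \<Phi> f'"
    unfolding racg_relations_def
  proof (intro conjI ballI allI impI)
    fix s assume "s \<in> verts \<Phi>"
    then show "f' s + f' s = 0" using P.refls_double refl by blast
  next
    fix s t assume st: "{s, t} \<in> edges \<Phi>"
    then show "f' s + f' t = f' t + f' s"
      using edge(1,2)[OF st] P.e_commute[OF edge(3)[OF st]] by (simp add: f'_other)
  qed
  have "racg_basis \<Phi> f'"
  proof (rule racg_basis_pingpong[OF rel, where D = "\<lambda>w. {g. f' w \<in> P.Inv g}" and W = P.W])
    fix w assume "w \<in> lists (verts \<Phi>)"
    then show "sum_list (map f' w) \<in> P.W" using refl by (induction w) auto
  next
    fix x y g
    assume xy: "{x, y} \<in> edges \<Phi>" "x \<in> verts \<Phi>" "y \<in> verts \<Phi>" "g \<in> P.W"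
      and "f' x + g \<in> {g. f' y \<in> P.Inv g}"
    have "f x \<noteq> f y" using P.e_inject P.adj_verts[OF edge(3)[OF xy(1)]] by blast
    then show "g \<in> {g. f' y \<in> P.Inv g}"
      using P.commuting_Inv[of "f x" "f y" g] P.refls_e xy P.e_commute[OF edge(3)[OF xy(1)]]
        \<open>f' x + g \<in> _\<close> edge[OF xy(1)] by (simp add: f'_other)
  next
    fix x y g
    assume xy: "x \<noteq> y" "{x, y} \<notin> edges \<Phi>" "x \<in> verts \<Phi>" "y \<in> verts \<Phi>" "g \<in> P.W"
      and "g \<in> {g. f' x \<in> P.Inv g}"
    then have "f x \<in> P.Inv g" using below' by simp
    moreover have "\<not> P.adj x y" using xy(2) by (simp add: P.adj_def)
    ultimately have "f y \<notin> P.Inv g" using P.descents_adj xy by blast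
    then show "g \<notin> {g. f' y \<in> P.Inv g}" using below' xy(5) by blast
  qed (use refl P.refls_Inv_add in auto)
  moreover have "f w \<in> W" if "w \<in> verts \<Phi>" for w using f that by (auto simp: embeds_def)
  ultimately show ?thesis using uv f'_other f'u by (auto simp: embeds_def f'_def)
qed

lemma isolated_to_refls:
  assumes \<Phi>: "simplicial_graph \<Phi>" "finite (verts \<Phi>)" and "embeds \<Phi> f"
    and "\<And>u v. {u, v} \<in> edges \<Phi> \<Longrightarrow> f u \<in> refls" and v: "v \<in> verts \<Phi>" "f v \<in> refls"
  obtains f' where "embeds \<Phi> f'" "f' ` verts \<Phi> \<subseteq> refls"
proof -
  define B where "B f = {u \<in> verts \<Phi>. f u \<notin> refls}" for f
  have "\<exists>f'. embeds \<Phi> f' \<and> B f' = {}"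
    using assms(3-4) v(2)
  proof (induction "card (B f)" arbitrary: f rule: less_induct)
    case less
    show ?case
    proof (cases "B f = {}")
      case False
      then obtain u where u: "u \<in> verts \<Phi>" "f u \<notin> refls" "u \<in> B f" by (auto simp: B_def)
      have iso: "{u, w} \<notin> edges \<Phi>" for w using less.prems(2) u by blast
      have uv: "u \<noteq> v" using u less.prems by auto
      define f1 where "f1 = f(u := cj (f u) (f v))"
      have f1: "embeds \<Phi> f1" unfolding f1_def
        by (rule isolated_conjugate[OF \<Phi>(1) less.prems(1) u(1) v(1) uv iso])
      have "f u \<in> W" using less.prems(1) u by (auto simp: embeds_def)
      then have r: "f1 u \<in> refls" using refls_cj less.prems(3) by (simp add: f1_def)
      then have "B f1 \<subset> B f" using u by (auto simp: B_def f1_def)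
      moreover have "finite (B f)" using \<Phi> by (simp add: B_def)
      ultimately have "card (B f1) < card (B f)" by (rule psubset_card_mono[rotated])
      moreover have "f1 x \<in> refls" if "{x, y} \<in> edges \<Phi>" for x y
        using r less.prems(2)[OF that] by (simp add: f1_def)
      moreover have "f1 v \<in> refls" using less.prems(3) uv by (simp add: f1_def)
      ultimately show ?thesis using less.hyps f1 by blast
    qed (use less.prems in auto)
  qed
  then obtain f' where "embeds \<Phi> f'" "B f' = {}" by blast
  then show thesis using that[of f'] by (auto simp: B_def)
qed

lemma refl_pingpong:
  assumes \<Phi>: "simplicial_graph \<Phi>"
    and refl: "\<And>v. v \<in> verts \<Phi> \<Longrightarrow> f v \<in> refls"
    and adj: "\<And>u v. {u, v} \<in> edges \<Phi> \<Longrightarrow> f u \<noteq> f v \<and> f u + f v = f v + f u"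
    and disj: "\<And>u v g. u \<in> verts \<Phi> \<Longrightarrow> v \<in> verts \<Phi> \<Longrightarrow> u \<noteq> v \<Longrightarrow> {u, v} \<notin> edges \<Phi> \<Longrightarrow>
                 g \<in> W \<Longrightarrow> f u \<in> Inv g \<Longrightarrow> f v \<notin> Inv g"
  shows "racg_basis \<Phi> f"
proof (rule racg_basis_pingpong[where D = "\<lambda>v. {g. f v \<in> Inv g}" and W = W])
  show "racg_relations \<Phi> f" unfolding racg_relations_def using refl adj by auto
  fix w assume "w \<in> lists (verts \<Phi>)"
  then show "sum_list (map f w) \<in> W" using refl by (induction w) auto
next
  fix u v g
  assume "{u, v} \<in> edges \<Phi>" "u \<in> verts \<Phi>" "v \<in> verts \<Phi>" "g \<in> W"
    and "f u + g \<in> {g. f v \<in> Inv g}"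
  then show "g \<in> {g. f v \<in> Inv g}"
    using commuting_Inv[OF refl refl, of u v g] adj[of u v] by simp
qed (use refl refls_Inv_add disj in auto)

section \<open>Graphs without edges\<close>

lemma discrete_pingpong:
  assumes \<Phi>: "finite (verts \<Phi>)" "edges \<Phi> = {}"
    and t: "\<And>i. i < card (verts \<Phi>) \<Longrightarrow> t i \<in> refls"
    and disj: "\<And>i j g. i < j \<Longrightarrow> j < card (verts \<Phi>) \<Longrightarrow> g \<in> W \<Longrightarrow>
                 \<not> (t i \<in> Inv g \<and> t j \<in> Inv g)"
  obtains f where "racg_basis \<Phi> f" "f ` verts \<Phi> \<subseteq> refls"
proof -
  obtain n where n: "bij_betw n (verts \<Phi>) {0..<card (verts \<Phi>)}"
    using ex_bij_betw_finite_nat[OF \<Phi>(1)] by blast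
  then have nV: "n v < card (verts \<Phi>)" if "v \<in> verts \<Phi>" for v
    using that bij_betwE by fastforce
  have inj: "u \<noteq> v \<Longrightarrow> n u \<noteq> n v" if "u \<in> verts \<Phi>" "v \<in> verts \<Phi>" for u v
    using n that by (meson bij_betw_imp_inj_on inj_on_eq_iff)
  have "racg_basis \<Phi> (t \<circ> n)"
  proof (rule refl_pingpong)
    fix u v g assume uv: "u \<in> verts \<Phi>" "v \<in> verts \<Phi>" "u \<noteq> v" "g \<in> W" "(t \<circ> n) u \<in> Inv g"
    then have "n u < n v \<or> n v < n u" using inj by (meson linorder_neqE_nat)
    then show "(t \<circ> n) v \<notin> Inv g" using disj[of "n u" "n v" g] disj[of "n v" "n u" g] uv nV by auto
  qed (use \<Phi> t nV in \<open>auto simp: simplicial_graph_def\<close>)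
  then show thesis using that t nV by fastforce
qed

text \<open>The reflections are the conjugates of \<open>y\<close> by \<open>(y x)^i y z\<close>.
  With \<open>Y\<close> the elements that can start with \<open>y\<close>, everything beyond the
  wall of \<open>t i\<close> lies in \<open>q i + Y\<close>, that is, starts with
  \<open>(y x)^i y z y\<close>. For \<open>i < j\<close> two such beginnings diverge after
  \<open>(y x)^i y\<close>, into \<open>z\<close> and \<open>x\<close>.\<close>

lemma refl_family:
  assumes V: "x \<in> V" "y \<in> V" "z \<in> V" and ne: "x \<noteq> y" "x \<noteq> z" "y \<noteq> z"
    and nadj: "\<not> adj y x" "\<not> adj y z"
  obtains t :: "nat \<Rightarrow> 'g" where "\<And>i. t i \<in> refls"
    "\<And>i j g. i < j \<Longrightarrow> g \<in> W \<Longrightarrow> \<not> (t i \<in> Inv g \<and> t j \<in> Inv g)"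
proof -
  define Y where "Y = {g \<in> W. e y \<in> Inv g}"
  have notin: "e u \<notin> Inv g" if "u \<in> {x, z}" "g \<in> Y" for u g
    using descents_adj[of y u g] that V ne nadj by (auto simp: Y_def)
  have Y_step: "e y + (e u + g) \<in> Y" "e u \<in> Inv (e u + g)" if u: "u \<in> {x, z}" and g: "g \<in> Y" for u g
  proof -
    have uV: "u \<in> V" "u \<noteq> y" "\<not> adj y u" and gW: "g \<in> W" using u V ne nadj g by (auto simp: Y_def)
    show *: "e u \<in> Inv (e u + g)"
      using refls_Inv_add[OF refls_e] uV gW notin[OF u g] by blast
    have "e y \<notin> Inv (e u + g)" using descents_adj[of y u "e u + g"] * uV gW V by auto
    then show "e y + (e u + g) \<in> Y"
      using refls_Inv_add[OF refls_e[OF V(2)], of "e u + g"] uV gW V by (simp add: Y_def)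
  qed
  define \<alpha> where "\<alpha> g = e y + (e x + g)" for g
  define q where "q i = (\<alpha> ^^ i) (e y + e z)" for i
  have \<alpha>Y: "(\<alpha> ^^ i) g \<in> Y" if "g \<in> Y" for i g
    by (induction i) (use that Y_step in \<open>auto simp: \<alpha>_def\<close>)
  have \<alpha>_add: "(\<alpha> ^^ i) (g + h) = (\<alpha> ^^ i) g + h" for i g h
    by (induction i) (auto simp: \<alpha>_def)
  have \<alpha>_inj: "(\<alpha> ^^ i) g = (\<alpha> ^^ i) h \<Longrightarrow> g = h" for i g h
    by (induction i) (auto simp: \<alpha>_def)
  have qW: "q i \<in> W" for i unfolding q_def by (induction i) (use V in \<open>auto simp: \<alpha>_def\<close>)
  have qY: "q i + g \<in> Y" if "g \<in> Y" for i g
    using \<alpha>Y[OF Y_step(1)[of z g], of i] that by (simp add: q_def flip: \<alpha>_add)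
  define t where "t i = cj (q i) (e y)" for i
  have t_iff: "- q i + g \<in> Y" if "t i \<in> Inv g" "g \<in> W" for i g
  proof -
    have "- q i \<notin> Y"
    proof
      assume "- q i \<in> Y"
      from qY[OF this, of i] show False by (simp add: Y_def)
    qed
    then have "e y \<notin> Inv (- q i)" using qW by (simp add: Y_def)
    then show ?thesis
      using Inv_add[of "- q i" g "e y"] that qW by (simp add: Y_def t_def)
  qed
  show thesis
  proof (rule that)
    show "t i \<in> refls" for i unfolding t_def using refls_cj refls_e V qW by blast
    fix i j :: nat and g assume ij: "i < j" and g: "g \<in> W"
    show "\<not> (t i \<in> Inv g \<and> t j \<in> Inv g)"
    proof
      assume "t i \<in> Inv g \<and> t j \<in> Inv g"
      then have Y: "- q i + g \<in> Y" "- q j + g \<in> Y" using t_iff g by auto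
      define g1 g2 where "g1 = - q i + g" and "g2 = - q j + g"
      obtain k where k: "j = i + Suc k" using ij less_iff_Suc_add by auto
      define g3 where "g3 = (\<alpha> ^^ k) (e y + (e z + g2))"
      have g3: "g3 \<in> Y" unfolding g3_def using \<alpha>Y Y_step Y by (simp add: g2_def)
      have "q n + h = (\<alpha> ^^ n) (e y + (e z + h))" for n h by (simp add: q_def flip: \<alpha>_add)
      moreover have "q i + g1 = q j + g2" by (simp add: g1_def g2_def)
      ultimately have "(\<alpha> ^^ i) (e y + (e z + g1)) = (\<alpha> ^^ (i + Suc k)) (e y + (e z + g2))"
        by (simp only: k)
      then have "(\<alpha> ^^ i) (e y + (e z + g1)) = (\<alpha> ^^ i) (e y + (e x + g3))"
        by (simp only: funpow_add o_apply funpow.simps(2) \<alpha>_def g3_def)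
      then have eq: "e z + g1 = e x + g3" using \<alpha>_inj by fastforce
      have "g3 \<in> W" using g3 by (simp add: Y_def)
      have zx: "e z \<in> Inv (e x + g3)" "e x \<in> Inv (e x + g3)"
        using Y_step(2)[of z g1] Y_step(2)[of x g3] Y g3 eq by (auto simp: g1_def)
      \<comment> \<open>The letters \<open>x\<close> and \<open>z\<close> may indeed be adjacent.
        Then \<open>e z\<close> passes through \<open>e x\<close> and is a descent of
        \<open>g3\<close>; but \<open>g3\<close> has the descent \<open>e y\<close>, and
        \<open>y\<close> is not adjacent to \<open>z\<close>.\<close>
      then have "adj x z" using descents_adj[of x z "e x + g3"] V ne \<open>g3 \<in> W\<close> by auto
      then have "e z \<in> Inv g3"
        using commuting_Inv[of "e x" "e z" g3] refls_e V e_commute e_inject ne \<open>g3 \<in> W\<close> zx by blast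
      then show False using notin g3 by blast
    qed
  qed
qed

text \<open>If every generator commutes with all but at most one other generator, the group is a
  product of groups of order two and infinite dihedral groups; \<open>tr\<close> contains the translations.\<close>

inductive_set tr :: "'g set" where
  zero: "0 \<in> tr"
| step: "a \<in> tr \<Longrightarrow> s \<in> V \<Longrightarrow> t \<in> V \<Longrightarrow> s \<noteq> t \<Longrightarrow> \<not> adj s t \<Longrightarrow> e s + (e t + a) \<in> tr"

text \<open>The square of \<open>e v + ev w\<close> is the commutator of \<open>e v\<close> with
  \<open>ev w\<close> followed by the square of \<open>ev w\<close>, so squares are products of
  translations by induction. These commute because by \<open>deg\<close> two non-adjacent pairs
  either coincide or are adjacent letter by letter.\<close>

lemma squares_commute:
  assumes deg: "\<And>x y z. x \<in> V \<Longrightarrow> y \<in> V \<Longrightarrow> z \<in> V \<Longrightarrow> x \<noteq> y \<Longrightarrow> y \<noteq> z \<Longrightarrow> x \<noteq> z \<Longrightarrow>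
      adj y x \<or> adj y z"
    and "g \<in> W" "h \<in> W"
  shows "(g + g) + (h + h) = (h + h) + (g + g)"
proof -
  have tr_add: "a + b \<in> tr" if "a \<in> tr" "b \<in> tr" for a b
    using that by induction (auto intro: tr.intros)
  have comm1: "(e s + e t) + (e u + e v) = (e u + e v) + (e s + e t)"
    if st: "s \<in> V" "t \<in> V" "s \<noteq> t" "\<not> adj s t" and uv: "u \<in> V" "v \<in> V" "u \<noteq> v" "\<not> adj u v"
    for s t u v
  proof (cases "{s, t} \<inter> {u, v} = {}")
    case True
    then have "adj s u" "adj s v" "adj t u" "adj t v"
      using deg[of t s u] deg[of t s v] deg[of s t u] deg[of s t v] st uv adj_sym by blast+
    then show ?thesis
      by (simp add: e_commute[of s v] e_commute[of t v] e_commute2[of s u] e_commute2[of s v]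
          e_commute2[of t u])
  next
    case False
    then have "(u = s \<and> v = t) \<or> (u = t \<and> v = s)"
      using deg[of t s v] deg[of t s u] deg[of s t u] deg[of s t v] st uv adj_sym by blast
    then show ?thesis using st by auto
  qed
  have comm2: "(e s + e t) + b = b + (e s + e t)"
    if "b \<in> tr" "s \<in> V" "t \<in> V" "s \<noteq> t" "\<not> adj s t" for b s t
    using that
  proof (induction b)
    case (step b u v)
    then have "(e s + e t) + ((e u + e v) + b) = ((e u + e v) + b) + (e s + e t)"
      by (intro commute_add comm1) auto
    then show ?case by simp
  qed simp
  have tr_comm: "a + b = b + a" if "a \<in> tr" "b \<in> tr" for a b
    using that
  proof (induction a)
    case (step a s t)
    then have "b + ((e s + e t) + a) = ((e s + e t) + a) + b"
      by (intro commute_add comm2[symmetric]) auto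
    then show ?case by simp
  qed simp
  have tr_conj: "cj (e v) a \<in> tr" if "v \<in> V" "a \<in> tr" for v a
    using that(2)
  proof induction
    case (step a s t)
    have "cj (e v) (e s + (e t + a)) = cj (e v) (e s + e t) + cj (e v) a" using that by simp
    moreover have "cj (e v) (e s + e t) \<in> tr"
    proof (cases "v = s \<or> v = t")
      case True
      then have "cj (e v) (e s + e t) = e t + (e s + 0)" using step by auto
      then show ?thesis using tr.step[OF tr.zero, of t s] step adj_sym by metis
    next
      case False
      then have "adj v s" "adj v t" using deg[of s t v] deg[of t s v] step that adj_sym by blast+
      then have "cj (e v) (e s + e t) = e s + (e t + 0)"
        using that by (simp add: e_commute[of v] e_commute2[of v])
      then show ?thesis using tr.step[OF tr.zero, of s t] step by metis
    qed
    ultimately show ?case using tr_add[OF _ step.IH, of "cj (e v) (e s + e t)"] by (simp only:)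
  qed (use that tr.zero in simp)
  have tr_commutator: "e v + (ev w + (e v + - ev w)) \<in> tr" if "v \<in> V" "w \<in> lists V" for v w
    using that(2)
  proof (induction w)
    case (Cons s w)
    have s: "s \<in> V" using Cons by simp
    have "e v + (ev (s # w) + (e v + - ev (s # w))) =
      (e v + (e s + (e v + e s))) + cj (e s) (e v + (ev w + (e v + - ev w)))"
      using s that(1) by simp
    moreover have "e v + (e s + (e v + e s)) \<in> tr"
    proof (cases "v = s \<or> adj v s")
      case True
      then have "e v + (e s + (e v + e s)) = 0" using s that(1) e_commute[of v s] by auto
      then show ?thesis using tr.zero by simp
    next
      case False
      then show ?thesis using tr.step[OF tr.step[OF tr.zero]] s that(1) by fastforce
    qed
    moreover have "cj (e s) (e v + (ev w + (e v + - ev w))) \<in> tr"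
      by (rule tr_conj[OF s Cons.IH])
    ultimately show ?case
      using tr_add[of "e v + (e s + (e v + e s))" "cj (e s) (e v + (ev w + (e v + - ev w)))"]
      by (simp only:)
  qed (use that tr.zero in simp)
  have sq: "ev w + ev w \<in> tr" if "w \<in> lists V" for w
    using that
  proof (induction w)
    case (Cons v w)
    then have "(e v + (ev w + (e v + - ev w))) + (ev w + ev w) \<in> tr"
      by (intro tr_add[of "e v + (ev w + (e v + - ev w))" "ev w + ev w"] tr_commutator) auto
    then show ?case by simp
  qed (use tr.zero in simp)
  have "g + g \<in> tr" "h + h \<in> tr" using sq assms(2,3) W_E by metis+
  then show ?thesis by (rule tr_comm)
qed

lemma discrete_squares_not_commute:
  assumes "u \<in> V" "v \<in> V" "w \<in> V" "distinct [u, v, w]" "edges \<Gamma> = {}"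
  shows "let g = e u + e v; h = e u + e w in (g + g) + (h + h) \<noteq> (h + h) + (g + g)"
proof (simp only: Let_def, rule notI)
  \<comment> \<open>The letters \<open>v\<close>, \<open>u\<close>, \<open>w\<close> act as the
    transpositions (2 3), (3 4), (4 5), and the two products send 2 to 3 and to 5. As there are no
    edges, only the involution relations must hold.\<close>
  define act :: "'v \<Rightarrow> nat \<Rightarrow> nat" where "act x n =
    (if x = u then (if n = 3 then 4 else if n = 4 then 3 else n)
     else if x = v then (if n = 2 then 3 else if n = 3 then 2 else n)
     else if x = w then (if n = 4 then 5 else if n = 5 then 4 else n) else n)" for x n
  have act: "act u 2 = 2" "act u 3 = 4" "act u 4 = 3" "act v 2 = 3" "act v 3 = 2" "act v 4 = 4"
    "act u 5 = 5" "act w 2 = 2" "act w 3 = 3" "act w 4 = 5"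
    using assms(4) by (auto simp: act_def)
  assume "(e u + e v + (e u + e v)) + (e u + e w + (e u + e w)) =
    (e u + e w + (e u + e w)) + (e u + e v + (e u + e v))"
  then have "foldr act [u, v, u, v, u, w, u, w] = foldr act [u, w, u, w, u, v, u, v]"
  proof (intro foldr_act_eq)
    show "act s (act s n) = n" for s n using assms(4) by (simp add: act_def)
  qed (use assms in \<open>auto simp: adj_def\<close>)
  from fun_cong[OF this, of 2] show False by (simp add: act)
qed

text \<open>If some vertex of \<open>\<Psi>\<close> is non-adjacent to two others,
  \<open>refl_family\<close> supplies as many reflections as needed. Otherwise squares commute in
  \<open>C(\<Psi>)\<close> but not among three free involutions, so \<open>\<Phi>\<close> has at
  most two vertices.\<close>

lemma discrete_to_refls:
  assumes \<Phi>: "finite (verts \<Phi>)" "edges \<Phi> = {}" and f: "embeds \<Phi> f"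
  obtains f' where "embeds \<Phi> f'" "f' ` verts \<Phi> \<subseteq> refls"
proof -
  interpret P: racg_rep \<Phi> f
    using \<Phi> f by unfold_locales (simp_all add: embeds_def simplicial_graph_def)
  have fW: "f v \<in> W" if "v \<in> verts \<Phi>" for v using f that by (auto simp: embeds_def)
  let ?n = "card (verts \<Phi>)"
  have "\<exists>t. (\<forall>i < ?n. t i \<in> refls) \<and>
    (\<forall>i j g. i < j \<longrightarrow> j < ?n \<longrightarrow> g \<in> W \<longrightarrow> \<not> (t i \<in> Inv g \<and> t j \<in> Inv g))"
  proof (cases "\<exists>x y z. x \<in> V \<and> y \<in> V \<and> z \<in> V \<and> x \<noteq> y \<and> y \<noteq> z \<and> x \<noteq> z \<and>
      \<not> adj y x \<and> \<not> adj y z")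
    case True
    then obtain x y z where "x \<in> V" "y \<in> V" "z \<in> V" "x \<noteq> y" "x \<noteq> z" "y \<noteq> z"
      "\<not> adj y x" "\<not> adj y z" by blast
    from refl_family[OF this] show ?thesis by metis
  next
    case deg: False
    have "?n < 3"
    proof (rule ccontr)
      assume "\<not> ?n < 3"
      then obtain U where "U \<subseteq> verts \<Phi>" "card U = 3" by (meson not_less obtain_subset_with_card_n)
      then obtain u v w where uvw: "u \<in> verts \<Phi>" "v \<in> verts \<Phi>" "w \<in> verts \<Phi>" "distinct [u, v, w]"
        by (auto simp: card_3_iff)
      have "f u + f v \<in> W" "f u + f w \<in> W" using fW uvw by auto
      then show False
        using squares_commute[of "f u + f v" "f u + f w"] deg
          P.discrete_squares_not_commute[OF uvw \<Phi>(2)] unfolding Let_def by blast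
    qed
    then consider "?n = 0" | "?n = 1" | "?n = 2" by linarith
    then show ?thesis
    proof cases
      case 2
      then obtain u where u: "u \<in> verts \<Phi>" using card_1_singletonE by blast
      have "f u \<noteq> 0" using P.ev_eq_parity[of "[u]" "[]" u] u by auto
      then obtain s where "s \<in> V" using left_descent fW u by blast
      then show ?thesis using 2 refls_e by (intro exI[of _ "\<lambda>_. e s"]) auto
    next
      case 3
      then obtain u v where uv: "u \<in> verts \<Phi>" "v \<in> verts \<Phi>" "u \<noteq> v"
        by (metis card_2_iff insertCI)
      \<comment> \<open>If all generators of \<open>\<Psi>\<close> commuted, so would
        \<open>f u\<close> and \<open>f v\<close>, making \<open>u\<close> and \<open>v\<close>
        adjacent.\<close>
      have "\<exists>s t. s \<in> V \<and> t \<in> V \<and> s \<noteq> t \<and> \<not> adj s t"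
      proof (rule ccontr)
        assume "\<not> ?thesis"
        then have c: "e s + e t = e t + e s" if "s \<in> V" "t \<in> V" for s t
          using that e_commute by metis
        have c1: "ev w + e s = e s + ev w" if "w \<in> lists V" "s \<in> V" for w s
          using that(1)
        proof (induction w)
          case (Cons x w)
          then have "e s + (e x + ev w) = (e x + ev w) + e s"
            using that(2) by (intro commute_add c) auto
          then show ?case by simp
        qed simp
        have c2: "ev w + ev x = ev x + ev w" if "w \<in> lists V" "x \<in> lists V" for w x
          using that(2)
        proof (induction x)
          case (Cons s x)
          then have "ev w + (e s + ev x) = (e s + ev x) + ev w"
            using that(1) by (intro commute_add c1) auto
          then show ?case by simp
        qed simp
        obtain x y where "x \<in> lists V" "y \<in> lists V" "f u = ev x" "f v = ev y"
          using fW[OF uv(1)] fW[OF uv(2)] W_E by metis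
        then have "f u + f v = f v + f u" using c2[of x y] by simp
        then have "P.adj u v" using P.commute_imp_adj uv by blast
        then show False using \<Phi> by (simp add: P.adj_def)
      qed
      then obtain s t where st: "s \<in> V" "t \<in> V" "s \<noteq> t" "\<not> adj s t" by blast
      define r where "r i = (if i = (0::nat) then e s else e t)" for i
      have "r i \<in> refls" for i using refls_e st by (simp add: r_def)
      moreover have "\<not> (r i \<in> Inv g \<and> r j \<in> Inv g)" if "i < j" "j < 2" "g \<in> W" for i j g
        using descents_adj[OF st(1-3) that(3)] st(4) that by (auto simp: r_def)
      ultimately show ?thesis using 3 by (intro exI[of _ r]) auto
    qed auto
  qed
  then obtain t where "\<And>i. i < ?n \<Longrightarrow> t i \<in> refls"
    "\<And>i j g. i < j \<Longrightarrow> j < ?n \<Longrightarrow> g \<in> W \<Longrightarrow> \<not> (t i \<in> Inv g \<and> t j \<in> Inv g)" by blast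
  from discrete_pingpong[OF \<Phi> this]
  obtain f' where f': "racg_basis \<Phi> f'" "f' ` verts \<Phi> \<subseteq> refls" .
  then have "f' ` verts \<Phi> \<subseteq> W" using refls_W by blast
  then show thesis using that[of f'] f' by (simp add: embeds_def)
qed

lemma embeds_to_refls:
  assumes tf: "triangle_free \<Gamma>" and \<Phi>: "simplicial_graph \<Phi>" "finite (verts \<Phi>)"
    and "embeds \<Phi> f"
  obtains f' where "racg_basis \<Phi> f'" "f' ` verts \<Phi> \<subseteq> refls"
proof -
  obtain f1 where f1: "embeds \<Phi> f1" "\<And>u v. {u, v} \<in> edges \<Phi> \<Longrightarrow> f1 u \<in> refls"
    using nonisolated_to_refls[OF assms] by blast
  show thesis
  proof (cases "\<exists>v \<in> verts \<Phi>. f1 v \<in> refls")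
    case True
    then obtain v where "v \<in> verts \<Phi>" "f1 v \<in> refls" by blast
    from isolated_to_refls[OF \<Phi> f1 this]
    obtain f2 where "embeds \<Phi> f2" "f2 ` verts \<Phi> \<subseteq> refls" .
    then show thesis using that[of f2] by (simp add: embeds_def)
  next
    case False
    have "edges \<Phi> = {}"
    proof (rule ccontr)
      assume "edges \<Phi> \<noteq> {}"
      then obtain d where d: "d \<in> edges \<Phi>" by blast
      then obtain u v where "u \<in> verts \<Phi>" "d = {u, v}"
        using \<Phi>(1) unfolding simplicial_graph_def by metis
      with d have "u \<in> verts \<Phi>" "{u, v} \<in> edges \<Phi>" by auto
      then show False using f1 False by blast
    qed
    from discrete_to_refls[OF \<Phi>(2) this f1(1)]
    obtain f2 where "embeds \<Phi> f2" "f2 ` verts \<Phi> \<subseteq> refls" .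
    then show thesis using that[of f2] by (simp add: embeds_def)
  qed
qed

section \<open>Distances of walls from the origin\<close>

definition wall_dist :: "'g \<Rightarrow> nat" where
  "wall_dist t = (LEAST n. \<exists>g \<in> W. \<exists>s \<in> V. cj g (e s) = t \<and> len g = n)"

text \<open>A nearest edge dual to the wall of \<open>t\<close> lies beyond the wall of
  \<open>r\<close>, so applying \<open>r\<close> shortens its end point.\<close>

lemma wall_dist_less:
  assumes "r \<in> refls" "t \<in> refls" "below r t"
  shows "wall_dist (cj r t) < wall_dist t"
proof -
  have "\<exists>n. \<exists>g \<in> W. \<exists>s \<in> V. cj g (e s) = t \<and> len g = n" using assms(2) reflsE by metis
  from LeastI_ex[OF this] obtain g s where g: "g \<in> W" "s \<in> V" "cj g (e s) = t" "len g = wall_dist t"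
    unfolding wall_dist_def by blast
  then have "r \<in> Inv g" using assms(3) unfolding below_def by blast
  then have "len (r + g) < len g" using Inv_imp_len_less g by blast
  moreover have "cj (r + g) (e s) = cj r t" using g(3) by (metis cj_add)
  then have "wall_dist (cj r t) \<le> len (r + g)"
    unfolding wall_dist_def using g assms(1) by (intro Least_le) (metis W_add refls_W)
  ultimately show ?thesis using g by simp
qed

text \<open>A reflection basis at minimal total distance from \<open>0\<close> is peripheral: otherwise conjugating
  everything below some wall by the reflection in that wall would bring it closer.\<close>

lemma refls_to_peripheral:
  fixes f :: "'u \<Rightarrow> 'g"
  assumes \<Phi>: "simplicial_graph \<Phi>" "finite (verts \<Phi>)"
    and f: "racg_basis \<Phi> f" "f ` verts \<Phi> \<subseteq> refls"
  obtains f' where "racg_basis \<Phi> f'" "f' ` verts \<Phi> \<subseteq> refls"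
    "\<And>u v. u \<in> verts \<Phi> \<Longrightarrow> v \<in> verts \<Phi> \<Longrightarrow> f' u + f' v \<noteq> f' v + f' u \<Longrightarrow> \<not> below (f' u) (f' v)"
proof -
  define R where "R f \<longleftrightarrow> racg_basis \<Phi> f \<and> f ` verts \<Phi> \<subseteq> refls" for f :: "'u \<Rightarrow> 'g"
  define m where "m f = (\<Sum>v\<in>verts \<Phi>. wall_dist (f v))" for f
  have "R f" using f by (simp add: R_def)
  then obtain f1 where "R f1" and min: "\<forall>f2. R f2 \<longrightarrow> m f1 \<le> m f2"
    using ex_has_least_nat[of R f m] by blast
  then have refl: "f1 v \<in> refls" if "v \<in> verts \<Phi>" for v
    using that by (auto simp: R_def)
  have b: "racg_basis \<Phi> f1" using \<open>R f1\<close> by (simp add: R_def)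
  interpret P: racg_rep \<Phi> f1 using \<Phi> b by unfold_locales
  have "\<not> below (f1 u) (f1 v)" if u: "u \<in> verts \<Phi>" and v: "v \<in> verts \<Phi>"
    and ne: "f1 u + f1 v \<noteq> f1 v + f1 u" for u v
  proof
    assume below: "below (f1 u) (f1 v)"
    define S where "S = {w \<in> verts \<Phi>. f1 u + f1 w \<noteq> f1 w + f1 u \<and> below (f1 u) (f1 w)}"
    have uS: "u \<notin> S" and vS: "v \<in> S" using v ne below by (auto simp: S_def)
    define f2 where "f2 w = (if w \<in> S then cj (f1 u) (f1 w) else f1 w)" for w
    \<comment> \<open>The walls of \<open>w\<close> and \<open>w'\<close> cross at a point beyond
      the wall of \<open>u\<close>, so \<open>belowI\<close> would put \<open>w'\<close> into
      \<open>S\<close> unless \<open>f1 w'\<close> commutes with \<open>f1 u\<close>. Hence it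
      commutes, and conjugating the whole edge relation by \<open>f1 u\<close> leaves
      \<open>f1 w'\<close> fixed.\<close>
    have mixed: "f2 w + f2 w' = f2 w' + f2 w" if ww: "P.adj w w'" "w \<in> S" "w' \<notin> S" for w w'
    proof -
      have V: "w \<in> verts \<Phi>" "w' \<in> verts \<Phi>" "w \<noteq> w'" using P.adj_verts ww by auto
      then have "f1 w \<noteq> f1 w'" using P.e_inject by blast
      from commuting_refls[OF refl[OF V(1)] refl[OF V(2)] this P.e_commute[OF ww(1)]]
      obtain g s x where g: "g \<in> W" "adj s x" "f1 w = cj g (e s)" "f1 w' = cj g (e x)" .
      then have sx: "s \<in> V" "x \<in> V" using adj_verts by auto
      have "below (f1 u) (f1 w)" using ww(2) by (simp add: S_def)
      then have *: "f1 u \<in> Inv g" unfolding below_def using g(1) g(3)[symmetric] sx(1) by blast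
      have "f1 u + f1 w' = f1 w' + f1 u"
      proof (rule ccontr)
        assume ne: "f1 u + f1 w' \<noteq> f1 w' + f1 u"
        then have "below (f1 u) (f1 w')" using belowI[OF ne g(1) sx(2) g(4)[symmetric] *] by simp
        then show False using ww(3) V(2) ne by (simp add: S_def)
      qed
      then have "cj (f1 u) (f1 w') = f1 w'" using cj_eq_commute by blast
      moreover have "cj (f1 u) (f1 w + f1 w') = cj (f1 u) (f1 w' + f1 w)"
        using P.e_commute[OF ww(1)] by simp
      then have "cj (f1 u) (f1 w) + cj (f1 u) (f1 w') = cj (f1 u) (f1 w') + cj (f1 u) (f1 w)"
        by simp
      ultimately show ?thesis using ww by (simp only: f2_def if_True if_False)
    qed
    have "racg_basis \<Phi> f2"
    \<comment> \<open>This substitution is its own inverse because \<open>u\<close> is not in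
      \<open>S\<close>, so \<open>f2 u = f1 u\<close>.\<close>
    proof (rule racg_basis_subst[OF b, where \<sigma> = "\<lambda>w. if w \<in> S then [u, w, u] else [w]"])
      show "racg_relations \<Phi> f2"
        unfolding racg_relations_def
      proof (intro conjI ballI allI impI)
        fix s assume "s \<in> verts \<Phi>"
        then show "f2 s + f2 s = 0" using u by (simp add: f2_def)
      next
        fix s t assume "{s, t} \<in> edges \<Phi>"
        then have st: "P.adj s t" by (simp add: P.adj_def)
        consider "s \<in> S" "t \<in> S" | "s \<in> S" "t \<notin> S" | "s \<notin> S" "t \<in> S" | "s \<notin> S" "t \<notin> S" by blast
        then show "f2 s + f2 t = f2 t + f2 s"
        proof cases
          case 1
          then show ?thesis using P.e_commute2[OF st] by (simp add: f2_def)
        next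
          case 2
          then show ?thesis using mixed st by blast
        next
          case 3
          then show ?thesis using mixed[OF P.adj_sym[OF st]] by simp
        next
          case 4
          then show ?thesis using P.e_commute[OF st] by (simp add: f2_def)
        qed
      qed
    qed (use u uS in \<open>auto simp: f2_def\<close>)
    moreover have "f2 w \<in> refls" if "w \<in> verts \<Phi>" for w
      using refls_cj[OF refl[OF that] refls_W[OF refl[OF u]]] refl[OF that]
      by (cases "w \<in> S") (simp_all only: f2_def if_True if_False)
    ultimately have "m f1 \<le> m f2" using min by (auto simp: R_def)
    moreover have "m f2 < m f1" unfolding m_def
    proof (rule sum_strict_mono_ex1[OF \<Phi>(2)])
      have less: "wall_dist (f2 w) < wall_dist (f1 w)" if "w \<in> S" for w
        using wall_dist_less[of "f1 u" "f1 w"] refl u that by (simp add: S_def f2_def)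
      show "\<forall>w\<in>verts \<Phi>. wall_dist (f2 w) \<le> wall_dist (f1 w)"
        using less by (force simp: f2_def)
      show "\<exists>w\<in>verts \<Phi>. wall_dist (f2 w) < wall_dist (f1 w)" using less vS v by blast
    qed
    ultimately show False by simp
  qed
  then show thesis using that[of f1] b refl by blast
qed

text \<open>Non-commuting walls that are not nested have disjoint far sides by
  \<open>Inv_disjoint\<close>; these are the ping-pong sets.\<close>

lemma peripheral_imp_basis:
  assumes \<Phi>: "simplicial_graph \<Phi>"
    and refl: "\<And>v. v \<in> verts \<Phi> \<Longrightarrow> f v \<in> refls" and inj: "inj_on f (verts \<Phi>)"
    and adj: "\<And>u v. u \<in> verts \<Phi> \<Longrightarrow> v \<in> verts \<Phi> \<Longrightarrow> u \<noteq> v \<Longrightarrow>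
                {u, v} \<in> edges \<Phi> \<longleftrightarrow> f u + f v = f v + f u"
    and per: "\<And>u v. u \<in> verts \<Phi> \<Longrightarrow> v \<in> verts \<Phi> \<Longrightarrow> f u + f v \<noteq> f v + f u \<Longrightarrow>
                \<not> below (f u) (f v)"
  shows "racg_basis \<Phi> f"
proof (rule refl_pingpong[OF \<Phi> refl])
  fix u v assume uv: "{u, v} \<in> edges \<Phi>"
  then show "f u \<noteq> f v \<and> f u + f v = f v + f u"
    using edge_verts[OF \<Phi> uv] adj inj by (metis inj_on_eq_iff)
next
  fix u v g
  assume "u \<in> verts \<Phi>" "v \<in> verts \<Phi>" "u \<noteq> v" "{u, v} \<notin> edges \<Phi>" "g \<in> W" "f u \<in> Inv g"
  then show "f v \<notin> Inv g" using Inv_disjoint[of "f u" "f v" g] adj per by metis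
qed

end


section \<open>Hyperplanes of the Cayley graph\<close>

lemma racg_relators_words:
  assumes "simplicial_graph \<Gamma>"
  shows "racg_relators \<Gamma> \<subseteq> words (verts \<Gamma>)"
  using edge_verts[OF assms] by (auto simp: racg_relators_def words_def commutator_word_def)

section \<open>From the presentation to words without signs\<close>

lemma pres_rel_imp_weq:
  assumes "(a, b) \<in> pres_rel (verts \<Gamma>) (racg_relators \<Gamma>)" and "simplicial_graph \<Gamma>"
  shows "weq \<Gamma> (map fst a) (map fst b)"
  using assms(1)
proof induction
  case (cancel u v s e)
  then show ?case using weq.cancel[of s \<Gamma> "map fst u" "map fst v"] by simp
next
  case (relator u v r)
  have "weq \<Gamma> (map fst r) []"
  proof -
    consider s where "s \<in> verts \<Gamma>" "map fst r = [s, s]"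
      | s t where "{s, t} \<in> edges \<Gamma>" "map fst r = [s, t, s, t]"
      using relator(3) by (auto simp: racg_relators_def commutator_word_def)
    then show ?thesis
    proof cases
      case 1
      then show ?thesis using weq_Cons_cancel[of s \<Gamma> "[]"] by simp
    next
      case 2
      note V = edge_verts[OF assms(2) 2(1)]
      have "weq \<Gamma> [s, t, s, t] [t, s, s, t]" by (rule weq_Cons_swap[OF 2(1)])
      moreover have "weq \<Gamma> [t, s, s, t] [t, t]" by (intro weq_Cons weq_Cons_cancel V)
      moreover have "weq \<Gamma> [t, t] []" by (intro weq_Cons_cancel V)
      ultimately show ?thesis using 2(2) by (metis weq.trans)
    qed
  qed
  from weq_context[OF this, of "map fst u" "map fst v"] show ?case by simp
qed (auto intro: weq.intros)

definition racg_gen :: "'a ugraph \<Rightarrow> 'a \<Rightarrow> 'a word set symm" where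
  "racg_gen \<Gamma> s = left_mult (racg \<Gamma>) (gen_class (verts \<Gamma>) (racg_relators \<Gamma>) s)"

definition racg_elt :: "'a ugraph \<Rightarrow> 'a list \<Rightarrow> 'a word set" where
  "racg_elt \<Gamma> w = pres_rel (verts \<Gamma>) (racg_relators \<Gamma>) `` {map (\<lambda>s. (s, True)) w}"

context
  fixes \<Gamma> :: "'a ugraph"
  assumes simplicial: "simplicial_graph \<Gamma>"
begin

interpretation group "racg \<Gamma>"
  by (rule group_racg[OF simplicial])

abbreviation (input) "cls a \<equiv> pres_rel (verts \<Gamma>) (racg_relators \<Gamma>) `` {a}"
abbreviation (input) "signed w \<equiv> map (\<lambda>s. (s, True)) w"

lemma cls_carrier: "x \<in> carrier (racg \<Gamma>) \<longleftrightarrow> (\<exists>a \<in> words (verts \<Gamma>). x = cls a)"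
  by (auto simp: racg_def presented_group_def quotient_def)

lemma left_mult_append:
  assumes "a \<in> words (verts \<Gamma>)" "b \<in> words (verts \<Gamma>)"
  shows "left_mult (racg \<Gamma>) (cls (a @ b)) =
    left_mult (racg \<Gamma>) (cls a) + left_mult (racg \<Gamma>) (cls b)"
  using left_mult_mult[of "cls a" "cls b"]
    presented_group_mult_class[OF racg_relators_words[OF simplicial] assms] cls_carrier assms
  unfolding racg_def by auto

lemma left_mult_Nil: "left_mult (racg \<Gamma>) (cls []) = 0"
  using left_mult_one by (simp add: racg_def presented_group_def)

lemma cls_eq: "(a, b) \<in> pres_rel (verts \<Gamma>) (racg_relators \<Gamma>) \<Longrightarrow> cls a = cls b"
  by (rule equiv_class_eq[OF equiv_pres_rel[OF racg_relators_words[OF simplicial]]])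

lemma cls_relator: "r \<in> racg_relators \<Gamma> \<Longrightarrow> left_mult (racg \<Gamma>) (cls r) = 0"
  using cls_eq[of r "[]"] pres_rel.relator[of "[]" "verts \<Gamma>" "[]" r "racg_relators \<Gamma>"] left_mult_Nil
  by simp

lemma left_mult_letter:
  assumes "s \<in> verts \<Gamma>"
  shows "left_mult (racg \<Gamma>) (cls [(s, b)]) = racg_gen \<Gamma> s"
    and "racg_gen \<Gamma> s + racg_gen \<Gamma> s = 0"
proof -
  have w: "[(s, c)] \<in> words (verts \<Gamma>)" for c using assms by (simp add: words_def)
  have T: "left_mult (racg \<Gamma>) (cls [(s, True)]) = racg_gen \<Gamma> s"
    by (simp add: racg_gen_def gen_class_def)
  have "[(s, True), (s, True)] \<in> racg_relators \<Gamma>" using assms by (auto simp: racg_relators_def)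
  then show d: "racg_gen \<Gamma> s + racg_gen \<Gamma> s = 0"
    using left_mult_append[OF w w, of True True] cls_relator T by simp
  have "cls ([(s, False)] @ [(s, True)]) = cls []"
    using pres_rel.cancel[of "[]" "verts \<Gamma>" "[]" s False] assms by (intro cls_eq) simp
  then have "left_mult (racg \<Gamma>) (cls [(s, False)]) + racg_gen \<Gamma> s = 0"
    using left_mult_append[OF w w, of False True] left_mult_Nil T by simp
  then have "left_mult (racg \<Gamma>) (cls [(s, False)]) = racg_gen \<Gamma> s"
    using d by (metis add_right_cancel)
  then show "left_mult (racg \<Gamma>) (cls [(s, b)]) = racg_gen \<Gamma> s" using T by (cases b) auto
qed

lemma left_mult_word:
  "a \<in> words (verts \<Gamma>) \<Longrightarrow> left_mult (racg \<Gamma>) (cls a) = sum_list (map (racg_gen \<Gamma>) (map fst a))"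
proof (induction a)
  case (Cons l a)
  obtain s b where l: "l = (s, b)" by (cases l)
  then have "s \<in> verts \<Gamma>" "[l] \<in> words (verts \<Gamma>)" "a \<in> words (verts \<Gamma>)"
    using Cons.prems by (auto simp: words_def)
  then show ?case using left_mult_append[of "[l]" a] left_mult_letter(1) Cons.IH l by simp
qed (simp add: left_mult_Nil)

lemma signed_words: "w \<in> lists (verts \<Gamma>) \<Longrightarrow> signed w \<in> words (verts \<Gamma>)"
  by (auto simp: words_def)

lemma racg_elt_carrier: "w \<in> lists (verts \<Gamma>) \<Longrightarrow> racg_elt \<Gamma> w \<in> carrier (racg \<Gamma>)"
  using cls_carrier signed_words unfolding racg_elt_def by blast

lemma left_mult_racg_elt:
  "w \<in> lists (verts \<Gamma>) \<Longrightarrow> left_mult (racg \<Gamma>) (racg_elt \<Gamma> w) = sum_list (map (racg_gen \<Gamma>) w)"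
  using left_mult_word[OF signed_words] by (simp add: racg_elt_def comp_def)

lemma racg_elt_surj:
  assumes "x \<in> carrier (racg \<Gamma>)"
  obtains w where "w \<in> lists (verts \<Gamma>)" "x = racg_elt \<Gamma> w"
proof -
  obtain a where a: "a \<in> words (verts \<Gamma>)" "x = cls a" using assms cls_carrier by blast
  have w: "map fst a \<in> lists (verts \<Gamma>)" using a(1) by (force simp: words_def)
  have "left_mult (racg \<Gamma>) x = left_mult (racg \<Gamma>) (racg_elt \<Gamma> (map fst a))"
    using left_mult_word left_mult_racg_elt[OF w] a by simp
  then have "x = racg_elt \<Gamma> (map fst a)"
    using inj_on_left_mult assms racg_elt_carrier[OF w] by (simp add: inj_on_eq_iff)
  then show thesis using that w by blast
qed

lemma racg_elt_append:
  assumes "v \<in> lists (verts \<Gamma>)" "w \<in> lists (verts \<Gamma>)"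
  shows "racg_elt \<Gamma> (v @ w) = racg_elt \<Gamma> v \<otimes>\<^bsub>racg \<Gamma>\<^esub> racg_elt \<Gamma> w"
  using presented_group_mult_class[OF racg_relators_words[OF simplicial] signed_words signed_words] assms
  by (simp add: racg_elt_def racg_def)

lemma racg_elt_Nil: "racg_elt \<Gamma> [] = \<one>\<^bsub>racg \<Gamma>\<^esub>"
  by (simp add: racg_elt_def racg_def presented_group_def)

text \<open>Left translation is faithful, so a word acting trivially is trivial in the presented
  group, and forgetting signs turns this into \<open>weq\<close>.\<close>

lemma racg_gen_basis: "racg_basis \<Gamma> (racg_gen \<Gamma>)"
proof (rule racg_basisI)
  show "racg_relations \<Gamma> (racg_gen \<Gamma>)"
    unfolding racg_relations_def
  proof (intro conjI ballI allI impI)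
    fix s t assume st: "{s, t} \<in> edges \<Gamma>"
    note V = edge_verts[OF simplicial st]
    let ?s = "racg_gen \<Gamma> s" and ?t = "racg_gen \<Gamma> t"
    have "commutator_word s t \<in> racg_relators \<Gamma>" using st by (auto simp: racg_relators_def)
    moreover have "commutator_word s t \<in> words (verts \<Gamma>)"
      using V by (simp add: commutator_word_def words_def)
    ultimately have "?s + (?t + (?s + ?t)) = 0"
      using left_mult_word cls_relator by (fastforce simp: commutator_word_def)
    then have "?s + (?t + (?s + ?t)) + (?t + ?s) = ?t + ?s" by simp
    moreover have "?s + (?t + (?s + ?t)) + (?t + ?s) = ?s + (?t + (?s + ((?t + ?t) + ?s)))"
      by (simp only: add.assoc)
    ultimately show "?s + ?t = ?t + ?s" using left_mult_letter(2) V by simp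
  qed (use left_mult_letter(2) in blast)
  fix w assume w: "w \<in> lists (verts \<Gamma>)" and "sum_list (map (racg_gen \<Gamma>) w) = 0"
  then have "left_mult (racg \<Gamma>) (cls (signed w)) = left_mult (racg \<Gamma>) (cls [])"
    using left_mult_racg_elt[OF w] left_mult_Nil by (simp add: racg_elt_def)
  moreover have "cls (signed w) \<in> carrier (racg \<Gamma>)" "cls [] \<in> carrier (racg \<Gamma>)"
    using signed_words[OF w] by (auto simp: cls_carrier intro: bexI[of _ "[]"])
  ultimately have "cls (signed w) = cls []" using inj_on_left_mult by (simp add: inj_on_eq_iff)
  then have "(signed w, []) \<in> pres_rel (verts \<Gamma>) (racg_relators \<Gamma>)"
    using eq_equiv_class[OF _ equiv_pres_rel[OF racg_relators_words[OF simplicial]]] by simp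
  from pres_rel_imp_weq[OF this simplicial] show "weq \<Gamma> w []" by (simp add: comp_def)
qed

lemma racg_elt_eq_iff:
  assumes "v \<in> lists (verts \<Gamma>)" "w \<in> lists (verts \<Gamma>)"
  shows "racg_elt \<Gamma> v = racg_elt \<Gamma> w \<longleftrightarrow> weq \<Gamma> v w"
proof -
  have "racg_elt \<Gamma> v = racg_elt \<Gamma> w \<longleftrightarrow>
      left_mult (racg \<Gamma>) (racg_elt \<Gamma> v) = left_mult (racg \<Gamma>) (racg_elt \<Gamma> w)"
    using inj_on_left_mult racg_elt_carrier assms by (simp add: inj_on_eq_iff)
  also have "\<dots> \<longleftrightarrow> weq \<Gamma> v w"
    using left_mult_racg_elt assms racg_gen_basis by (simp add: racg_basis_def)
  finally show ?thesis .
qed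

end

section \<open>Embedded subgroups as bases\<close>

locale racg_skeleton =
  fixes \<Psi> :: "'b ugraph"
  assumes simplicial_\<Psi>: "simplicial_graph \<Psi>"

sublocale racg_skeleton \<subseteq> racg_rep \<Psi> "racg_gen \<Psi>"
  by unfold_locales (rule simplicial_\<Psi>, rule racg_gen_basis[OF simplicial_\<Psi>])

sublocale racg_skeleton \<subseteq> G: group "racg \<Psi>"
  by (rule group_racg[OF simplicial_\<Psi>])

context racg_skeleton
begin

abbreviation "e \<equiv> racg_gen \<Psi>"
abbreviation "\<iota> \<equiv> left_mult (racg \<Psi>)"
abbreviation "X \<equiv> X_skeleton \<Psi>"

lemma \<iota>_image: "\<iota> ` carrier (racg \<Psi>) = W"
proof (intro subset_antisym subsetI)
  fix g assume "g \<in> \<iota> ` carrier (racg \<Psi>)"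
  then obtain x where x: "x \<in> carrier (racg \<Psi>)" "g = \<iota> x" by blast
  obtain w where w: "w \<in> lists V" "x = racg_elt \<Psi> w" using racg_elt_surj[OF simplicial_\<Psi> x(1)] .
  then show "g \<in> W" using left_mult_racg_elt[OF simplicial_\<Psi> w(1)] x W_ev by simp
next
  fix g assume "g \<in> W"
  then obtain w where w: "w \<in> lists V" "g = ev w" by (rule W_E)
  then have "g = \<iota> (racg_elt \<Psi> w)" using left_mult_racg_elt[OF simplicial_\<Psi>] by simp
  then show "g \<in> \<iota> ` carrier (racg \<Psi>)" using racg_elt_carrier[OF simplicial_\<Psi> w(1)] by blast
qed

text \<open>Labels the vertices of the skeleton by elements of \<open>W\<close>, where the theory of
  walls is available.\<close>

definition pt :: "'b word set symm \<Rightarrow> 'b word set" where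
  "pt g = inv_into (carrier (racg \<Psi>)) \<iota> g"

lemma pt_\<iota>: "x \<in> carrier (racg \<Psi>) \<Longrightarrow> pt (\<iota> x) = x"
  using G.inj_on_left_mult by (simp add: pt_def)

lemma \<iota>_pt [simp]: "g \<in> W \<Longrightarrow> \<iota> (pt g) = g"
  using \<iota>_image by (simp add: pt_def f_inv_into_f)

lemma pt_carrier [simp]: "g \<in> W \<Longrightarrow> pt g \<in> carrier (racg \<Psi>)"
  using \<iota>_image by (simp add: pt_def inv_into_into)

lemma pt_inject [simp]: "g \<in> W \<Longrightarrow> h \<in> W \<Longrightarrow> pt g = pt h \<longleftrightarrow> g = h"
  by (metis \<iota>_pt)

lemma carrier_pt: "x \<in> carrier (racg \<Psi>) \<Longrightarrow> \<exists>g \<in> W. x = pt g"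
  using pt_\<iota> \<iota>_image by (metis imageI)

lemma one_pt: "\<one>\<^bsub>racg \<Psi>\<^esub> = pt 0"
  using pt_\<iota>[of "\<one>\<^bsub>racg \<Psi>\<^esub>"] G.left_mult_one by simp

lemma embeds_if_subgroup:
  assumes \<Phi>: "simplicial_graph \<Phi>" and H: "subgroup H (racg \<Psi>)"
    and iso: "racg \<Phi> \<cong> (racg \<Psi>)\<lparr>carrier := H\<rparr>"
  shows "\<exists>f. embeds \<Phi> f"
proof -
  obtain h where h: "h \<in> hom (racg \<Phi>) ((racg \<Psi>)\<lparr>carrier := H\<rparr>)"
    and bij: "bij_betw h (carrier (racg \<Phi>)) H"
    using iso by (auto simp: is_iso_def iso_def)
  define f where "f v = \<iota> (h (racg_elt \<Phi> [v]))" for v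
  note elt = racg_elt_carrier[OF \<Phi>]
  have hH: "h x \<in> H" if "x \<in> carrier (racg \<Phi>)" for x using bij that by (rule bij_betw_apply)
  have hG: "h x \<in> carrier (racg \<Psi>)" if "x \<in> carrier (racg \<Phi>)" for x
    using hH[OF that] subgroup.subset[OF H] by blast
  have mult: "h (x \<otimes>\<^bsub>racg \<Phi>\<^esub> y) = h x \<otimes>\<^bsub>racg \<Psi>\<^esub> h y"
    if "x \<in> carrier (racg \<Phi>)" "y \<in> carrier (racg \<Phi>)" for x y
    using hom_mult[OF h that] by simp
  have one: "h (racg_elt \<Phi> []) = \<one>\<^bsub>racg \<Psi>\<^esub>"
    using hom_one[OF h group_racg[OF \<Phi>] subgroup.subgroup_is_group[OF H G.is_group]]
    by (simp add: racg_elt_Nil[OF \<Phi>])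
  have sum: "sum_list (map f w) = \<iota> (h (racg_elt \<Phi> w))" if "w \<in> lists (verts \<Phi>)" for w
    using that
  proof (induction w)
    case Nil
    then show ?case using one G.left_mult_one by simp
  next
    case (Cons v w)
    then have vw: "[v] \<in> lists (verts \<Phi>)" "w \<in> lists (verts \<Phi>)" by auto
    have "\<iota> (h (racg_elt \<Phi> ([v] @ w))) = \<iota> (h (racg_elt \<Phi> [v])) + \<iota> (h (racg_elt \<Phi> w))"
      using racg_elt_append[OF \<Phi> vw] mult elt vw G.left_mult_mult hG by simp
    then show ?case using Cons by (simp add: f_def)
  qed
  have "racg_basis \<Phi> f"
    unfolding racg_basis_def
  proof (intro ballI)
    fix v w assume vw: "v \<in> lists (verts \<Phi>)" "w \<in> lists (verts \<Phi>)"
    have "weq \<Phi> v w \<longleftrightarrow> racg_elt \<Phi> v = racg_elt \<Phi> w" using racg_elt_eq_iff[OF \<Phi> vw] by simp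
    also have "\<dots> \<longleftrightarrow> h (racg_elt \<Phi> v) = h (racg_elt \<Phi> w)"
      using inj_on_eq_iff[OF bij_betw_imp_inj_on[OF bij] elt[OF vw(1)] elt[OF vw(2)]] by simp
    also have "\<dots> \<longleftrightarrow> \<iota> (h (racg_elt \<Phi> v)) = \<iota> (h (racg_elt \<Phi> w))"
      using G.inj_on_left_mult hG elt vw by (simp add: inj_on_eq_iff)
    finally show "weq \<Phi> v w \<longleftrightarrow> sum_list (map f v) = sum_list (map f w)" using sum vw by simp
  qed
  moreover have "f v \<in> W" if "v \<in> verts \<Phi>" for v
  proof -
    have "h (racg_elt \<Phi> [v]) \<in> carrier (racg \<Psi>)" using that by (intro hG elt) simp
    then show ?thesis using \<iota>_image by (auto simp: f_def)
  qed
  ultimately show ?thesis by (auto simp: embeds_def)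
qed

lemma subgroup_if_embeds:
  assumes \<Phi>: "simplicial_graph \<Phi>" and f: "embeds \<Phi> f"
  shows "\<exists>H. subgroup H (racg \<Psi>) \<and> racg \<Phi> \<cong> (racg \<Psi>)\<lparr>carrier := H\<rparr>"
proof -
  interpret P: racg_rep \<Phi> f using \<Phi> f by unfold_locales (simp_all add: embeds_def)
  have fW: "P.ev w \<in> W" if "w \<in> lists (verts \<Phi>)" for w
    using that by (induction w) (use f in \<open>auto simp: embeds_def\<close>)
  define k where "k w = pt (P.ev w)" for w
  define H where "H = k ` lists (verts \<Phi>)"
  have \<iota>k: "\<iota> (k w) = P.ev w" "k w \<in> carrier (racg \<Psi>)" if "w \<in> lists (verts \<Phi>)" for w
    using fW[OF that] by (simp_all add: k_def)
  have k_append: "k (v @ w) = k v \<otimes>\<^bsub>racg \<Psi>\<^esub> k w"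
    if "v \<in> lists (verts \<Phi>)" "w \<in> lists (verts \<Phi>)" for v w
  proof -
    have "\<iota> (k (v @ w)) = \<iota> (k v \<otimes>\<^bsub>racg \<Psi>\<^esub> k w)"
      using \<iota>k that G.left_mult_mult[of "k v" "k w"] by simp
    then show ?thesis by (rule inj_onD[OF G.inj_on_left_mult]) (use \<iota>k that in auto)
  qed
  have k_Nil: "k [] = \<one>\<^bsub>racg \<Psi>\<^esub>" by (simp add: k_def one_pt)
  have sub: "subgroup H (racg \<Psi>)"
  proof (rule G.subgroupI)
    show "H \<subseteq> carrier (racg \<Psi>)" using \<iota>k by (auto simp: H_def)
    show "H \<noteq> {}" by (auto simp: H_def)
  next
    fix a assume "a \<in> H"
    then obtain w where w: "w \<in> lists (verts \<Phi>)" "a = k w" by (auto simp: H_def)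
    then have r: "rev w \<in> lists (verts \<Phi>)" by (simp add: in_lists_conv_set)
    have "P.ev (rev w @ w) = 0" using P.ev_rev[OF w(1)] by simp
    then have "k (rev w @ w) = k []" by (simp add: k_def)
    then have "k (rev w) \<otimes>\<^bsub>racg \<Psi>\<^esub> k w = \<one>\<^bsub>racg \<Psi>\<^esub>" using k_append[OF r w(1)] k_Nil by simp
    then have "inv\<^bsub>racg \<Psi>\<^esub> a = k (rev w)" using G.inv_equality \<iota>k r w by simp
    then show "inv\<^bsub>racg \<Psi>\<^esub> a \<in> H" using r by (simp add: H_def)
  next
    fix a b assume "a \<in> H" "b \<in> H"
    then obtain v w where "v \<in> lists (verts \<Phi>)" "w \<in> lists (verts \<Phi>)" "a = k v" "b = k w"
      by (auto simp: H_def)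
    then show "a \<otimes>\<^bsub>racg \<Psi>\<^esub> b \<in> H"
      using k_append[of v w] unfolding H_def by (intro image_eqI[of _ _ "v @ w"]) auto
  qed
  define h where "h x = k (SOME w. w \<in> lists (verts \<Phi>) \<and> racg_elt \<Phi> w = x)" for x
  have h: "h (racg_elt \<Phi> w) = k w" if w: "w \<in> lists (verts \<Phi>)" for w
  proof -
    define v where "v = (SOME v. v \<in> lists (verts \<Phi>) \<and> racg_elt \<Phi> v = racg_elt \<Phi> w)"
    have v: "v \<in> lists (verts \<Phi>) \<and> racg_elt \<Phi> v = racg_elt \<Phi> w"
      unfolding v_def by (rule someI[of _ w]) (use w in simp)
    then have "weq \<Phi> v w" using racg_elt_eq_iff[OF \<Phi>, of v w] w by simp
    then have "P.ev v = P.ev w" using P.basis v w by (simp add: racg_basis_def)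
    then show ?thesis by (simp add: h_def v_def[symmetric] k_def)
  qed
  have "h \<in> hom (racg \<Phi>) ((racg \<Psi>)\<lparr>carrier := H\<rparr>)"
  proof (rule homI)
    fix x assume "x \<in> carrier (racg \<Phi>)"
    then obtain w where "w \<in> lists (verts \<Phi>)" "x = racg_elt \<Phi> w" by (rule racg_elt_surj[OF \<Phi>])
    then show "h x \<in> carrier ((racg \<Psi>)\<lparr>carrier := H\<rparr>)" using h by (simp add: H_def)
  next
    fix x y assume "x \<in> carrier (racg \<Phi>)" "y \<in> carrier (racg \<Phi>)"
    then obtain v w where vw: "v \<in> lists (verts \<Phi>)" "x = racg_elt \<Phi> v"
      "w \<in> lists (verts \<Phi>)" "y = racg_elt \<Phi> w" by (metis racg_elt_surj[OF \<Phi>])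
    then show "h (x \<otimes>\<^bsub>racg \<Phi>\<^esub> y) = h x \<otimes>\<^bsub>(racg \<Psi>)\<lparr>carrier := H\<rparr>\<^esub> h y"
      using racg_elt_append[OF \<Phi> vw(1,3)] h[of "v @ w"] h k_append by simp
  qed
  moreover have "bij_betw h (carrier (racg \<Phi>)) H"
  proof (rule bij_betw_imageI)
    show "inj_on h (carrier (racg \<Phi>))"
    proof (rule inj_onI)
      fix x y assume "x \<in> carrier (racg \<Phi>)" "y \<in> carrier (racg \<Phi>)" and eq: "h x = h y"
      then obtain v w where vw: "v \<in> lists (verts \<Phi>)" "x = racg_elt \<Phi> v"
        "w \<in> lists (verts \<Phi>)" "y = racg_elt \<Phi> w" by (metis racg_elt_surj[OF \<Phi>])
      then have "P.ev v = P.ev w" using eq h \<iota>k by metis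
      then have "weq \<Phi> v w" using P.basis vw by (simp add: racg_basis_def)
      then show "x = y" using racg_elt_eq_iff[OF \<Phi> vw(1,3)] vw by simp
    qed
    show "h ` carrier (racg \<Phi>) = H"
    proof (intro subset_antisym subsetI)
      fix x assume "x \<in> h ` carrier (racg \<Phi>)"
      then obtain y where y: "y \<in> carrier (racg \<Phi>)" "x = h y" by blast
      obtain w where "w \<in> lists (verts \<Phi>)" "y = racg_elt \<Phi> w"
        using racg_elt_surj[OF \<Phi> y(1)] .
      then show "x \<in> H" using h y by (simp add: H_def)
    next
      fix x assume "x \<in> H"
      then obtain w where w: "w \<in> lists (verts \<Phi>)" "x = k w" by (auto simp: H_def)
      then show "x \<in> h ` carrier (racg \<Phi>)"
        using h racg_elt_carrier[OF \<Phi> w(1)] by (metis imageI)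
    qed
  qed
  ultimately have "racg \<Phi> \<cong> (racg \<Psi>)\<lparr>carrier := H\<rparr>" by (auto simp: is_iso_def iso_def)
  then show ?thesis using sub by blast
qed

section \<open>Edges, squares and walls\<close>

definition "ed g s = {pt g, pt (g + e s)}"
text \<open>The condition \<open>cj g (e s) = r\<close> means \<open>r + g = g + e s\<close>: left
  translation by \<open>r\<close> swaps the end points of the edge.\<close>

definition "wall r = {ed g s | g s. g \<in> W \<and> s \<in> V \<and> cj g (e s) = r}"

lemma X_verts: "verts X = carrier (racg \<Psi>)"
  by (simp add: X_skeleton_def cayley_graph_def)

lemma X_edges: "edges X = {ed g s | g s. g \<in> W \<and> s \<in> V}"
proof -
  have pt_mult: "pt g \<otimes>\<^bsub>racg \<Psi>\<^esub> gen_class V (racg_relators \<Psi>) s = pt (g + e s)"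
    if "g \<in> W" "s \<in> V" for g s
  proof -
    have c: "gen_class V (racg_relators \<Psi>) s \<in> carrier (racg \<Psi>)"
      using racg_elt_carrier[OF simplicial_\<Psi>, of "[s]"] that
      by (simp add: racg_elt_def gen_class_def)
    then have "\<iota> (pt g \<otimes>\<^bsub>racg \<Psi>\<^esub> gen_class V (racg_relators \<Psi>) s) = g + e s"
      using G.left_mult_mult[of "pt g"] that by (simp add: racg_gen_def)
    then show ?thesis using pt_\<iota>[of "pt g \<otimes>\<^bsub>racg \<Psi>\<^esub> gen_class V (racg_relators \<Psi>) s"] c that by simp
  qed
  show ?thesis
  proof (intro subset_antisym subsetI)
    fix d assume "d \<in> edges X"
    then obtain x s where xs: "x \<in> carrier (racg \<Psi>)" "s \<in> V"
      "d = {x, x \<otimes>\<^bsub>racg \<Psi>\<^esub> gen_class V (racg_relators \<Psi>) s}"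
      by (auto simp: X_skeleton_def cayley_graph_def racg_gens_def)
    then obtain g where g: "g \<in> W" "x = pt g" using carrier_pt by blast
    then have "d = ed g s" using xs pt_mult by (simp add: ed_def)
    then show "d \<in> {ed g s | g s. g \<in> W \<and> s \<in> V}" using g xs by blast
  next
    fix d assume "d \<in> {ed g s | g s. g \<in> W \<and> s \<in> V}"
    then obtain g s where gs: "g \<in> W" "s \<in> V" "d = ed g s" by blast
    then have "d = {pt g, pt g \<otimes>\<^bsub>racg \<Psi>\<^esub> gen_class V (racg_relators \<Psi>) s}"
      using pt_mult by (simp add: ed_def)
    moreover have "edges X = {{x, x \<otimes>\<^bsub>racg \<Psi>\<^esub> y} | x y. x \<in> carrier (racg \<Psi>) \<and> y \<in> racg_gens \<Psi>}"
      by (simp add: X_skeleton_def cayley_graph_def)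
    ultimately show "d \<in> edges X"
      unfolding racg_gens_def using gs(2) pt_carrier[OF gs(1)] by blast
  qed
qed

lemma ed_eq_iff:
  assumes "g \<in> W" "s \<in> V" "h \<in> W" "t \<in> V"
  shows "ed g s = ed h t \<longleftrightarrow> s = t \<and> (h = g \<or> h = g + e s)"
proof
  assume "ed g s = ed h t"
  then have "(g = h \<and> g + e s = h + e t) \<or> (g = h + e t \<and> g + e s = h)"
    using assms by (simp add: ed_def doubleton_eq_iff)
  moreover have "s = t" if "e s = e t" using that e_inject assms by blast
  moreover have "e s = e t" if "g = h + e t" "g + e s = h"
  proof -
    have "h + (e t + e s) = h + (e t + e t)" using that assms by simp
    then show ?thesis by simp
  qed
  ultimately show "s = t \<and> (h = g \<or> h = g + e s)" by auto
next
  assume "s = t \<and> (h = g \<or> h = g + e s)"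
  then show "ed g s = ed h t" using assms by (auto simp: ed_def)
qed

lemma ed_in_edges: "g \<in> W \<Longrightarrow> s \<in> V \<Longrightarrow> ed g s \<in> edges X"
  using X_edges by blast

lemma edge_pt:
  assumes "{x, y} \<in> edges X"
  obtains g s where "g \<in> W" "s \<in> V" "x = pt g" "y = pt (g + e s)"
proof -
  obtain g s where gs: "g \<in> W" "s \<in> V" "{x, y} = {pt g, pt (g + e s)}"
    using assms unfolding X_edges ed_def by blast
  then consider "x = pt g" "y = pt (g + e s)" | "x = pt (g + e s)" "y = pt g"
    by (auto simp: doubleton_eq_iff)
  then show thesis using that[of g s] that[of "g + e s" s] gs by cases auto
qed

lemma ed_in_wall: "g \<in> W \<Longrightarrow> s \<in> V \<Longrightarrow> ed g s \<in> wall r \<longleftrightarrow> cj g (e s) = r"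
  unfolding wall_def using ed_eq_iff by fastforce

text \<open>Going around the cycle reads off letters \<open>s\<close>, \<open>t\<close>,
  \<open>u\<close>, \<open>v\<close> with product 0. Distinctness of the vertices gives
  \<open>s \<noteq> t\<close> and \<open>t \<noteq> u\<close>, so parity forces \<open>u = s\<close>
  and \<open>v = t\<close>; thus \<open>s\<close> and \<open>t\<close> commute.\<close>

lemma squareE:
  assumes "square X a b c d"
  obtains g s t where "g \<in> W" "adj s t" "a = pt g" "b = pt (g + e s)"
    "c = pt (g + (e s + e t))" "d = pt (g + e t)"
proof -
  note sq = assms[unfolded square_def]
  obtain g s where g: "g \<in> W" "s \<in> V" "a = pt g" "b = pt (g + e s)" using sq edge_pt by blast
  have "{pt (g + e s), c} \<in> edges X" using sq g by simp
  then obtain h t where h: "h \<in> W" "t \<in> V" "pt (g + e s) = pt h" "c = pt (h + e t)"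
    using edge_pt by blast
  then have "h = g + e s" using g by simp
  then have c: "c = pt (g + (e s + e t))" using h by simp
  have "{pt (g + (e s + e t)), d} \<in> edges X" using sq c by simp
  then obtain h' u where h': "h' \<in> W" "u \<in> V" "pt (g + (e s + e t)) = pt h'" "d = pt (h' + e u)"
    using edge_pt by blast
  then have "h' = g + (e s + e t)" using g h(2) by simp
  then have d: "d = pt (g + (e s + (e t + e u)))" using h' by simp
  have "{pt (g + (e s + (e t + e u))), a} \<in> edges X" using sq d by simp
  then obtain k v where k: "k \<in> W" "v \<in> V" "pt (g + (e s + (e t + e u))) = pt k" "a = pt (k + e v)"
    using edge_pt by blast
  then have "k = g + (e s + (e t + e u))" using g h(2) h'(2) by simp
  then have "g + (e s + (e t + (e u + e v))) = g" using k g h(2) h'(2) by simp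
  then have "g + (e s + (e t + (e u + e v))) = g + 0" by simp
  then have "e s + (e t + (e u + e v)) = 0" by (simp only: add_left_cancel)
  then have "e s + (e t + (e u + e v)) + (e v + e u) = e v + e u" by simp
  then have eq: "e s + e t = e v + e u" using h'(2) k(2) by simp
  have st: "s \<noteq> t" using sq g c by auto
  have tu: "t \<noteq> u" using sq g h(2) d by auto
  have par: "even (count_list [s, t] x) \<longleftrightarrow> even (count_list [v, u] x)" for x
    by (rule ev_eq_parity) (use g h(2) h'(2) k(2) eq in auto)
  have "u = s" "v = t" using par[of s] par[of t] st tu by (auto split: if_splits)
  then have "adj s t" using commute_imp_adj[of s t] eq g h(2) st by simp
  moreover have "d = pt (g + e t)" using d \<open>u = s\<close> e_commute[OF \<open>adj s t\<close>] e_commute2[OF \<open>adj s t\<close>] g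
    by simp
  ultimately show thesis using that[OF g(1) _ g(3,4) c] by blast
qed

lemma squareI:
  assumes "g \<in> W" "adj s t"
  shows "square X (pt g) (pt (g + e s)) (pt (g + (e s + e t))) (pt (g + e t))"
proof -
  have V: "s \<in> V" "t \<in> V" "s \<noteq> t" using adj_verts assms by auto
  have ne: "e s \<noteq> 0" "e t \<noteq> 0" "e s \<noteq> e t" "e s + e t \<noteq> 0"
    using ev_eq_parity[of "[s]" "[]" s] ev_eq_parity[of "[t]" "[]" t] e_inject V
      minus_unique[of "e s" "e t"] by auto
  have "{pt g, pt (g + e s)} = ed g s" "{pt (g + e s), pt (g + (e s + e t))} = ed (g + e s) t"
    "{pt (g + (e s + e t)), pt (g + e t)} = ed (g + e t) s" "{pt (g + e t), pt g} = ed g t"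
    using e_commute[OF assms(2)] by (auto simp: ed_def)
  then have "{pt g, pt (g + e s)} \<in> edges X" "{pt (g + e s), pt (g + (e s + e t))} \<in> edges X"
    "{pt (g + (e s + e t)), pt (g + e t)} \<in> edges X" "{pt (g + e t), pt g} \<in> edges X"
    using ed_in_edges V assms(1) by simp_all
  moreover have "e t \<noteq> e s + e t" "e s + e t \<noteq> e s"
    using ne by (metis add_0_left add_right_cancel, metis add_0_right add_left_cancel)
  moreover have "g = g + x \<longleftrightarrow> x = 0" for x by (metis add_0_right add_left_cancel)
  ultimately show ?thesis
    unfolding square_def using V ne assms(1) by simp
qed

lemma cj_e_ed: "s = t \<or> adj s t \<Longrightarrow> s \<in> V \<Longrightarrow> cj (g + e t) (e s) = cj g (e s)"
  using e_commute[of s t] e_commute2[of s t] adj_verts by auto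

lemma opposite_in_wall:
  assumes "(d, d') \<in> opposite_edges X" "d \<in> wall r"
  shows "d' \<in> wall r"
proof -
  obtain a b c f where sq: "square X a b c f" "d = {a, b}" "d' = {c, f}"
    using assms(1) by (auto simp: opposite_edges_def)
  obtain g s t where g: "g \<in> W" "adj s t" "a = pt g" "b = pt (g + e s)"
    "c = pt (g + (e s + e t))" "f = pt (g + e t)" using squareE[OF sq(1)] .
  then have V: "s \<in> V" "t \<in> V" using adj_verts by auto
  have "d = ed g s" "d' = ed (g + e t) s"
    using sq g e_commute[OF g(2)] by (auto simp: ed_def)
  moreover have "cj (g + e t) (e s) = cj g (e s)" using cj_e_ed g V by blast
  ultimately show ?thesis using ed_in_wall assms(2) g V by (metis W_add W_e)
qed

text \<open>Along the word of \<open>wall_path\<close>, a letter adjacent to \<open>s\<close> moves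
  the edge to the opposite side of a square, and the letter \<open>s\<close> only exchanges its end
  points.\<close>

lemma wall_opposite:
  assumes "d \<in> wall r" "d' \<in> wall r"
  shows "(d, d') \<in> (opposite_edges X)\<^sup>*"
proof -
  obtain g s where g: "g \<in> W" "s \<in> V" "cj g (e s) = r" "d = ed g s"
    using assms(1) by (auto simp: wall_def)
  obtain h t where h: "h \<in> W" "t \<in> V" "cj h (e t) = r" "d' = ed h t"
    using assms(2) by (auto simp: wall_def)
  have st: "t = s" using cj_e_type[of h g t s] g h by simp
  have "cj g (e s) = cj h (e s)" using g(3) h(3) st by metis
  then obtain w where w: "set w \<subseteq> {x. x = s \<or> adj s x}" "h = g + ev w"
    using wall_path[OF g(1) h(1) g(2)] by blast
  have "(ed g s, ed (g + ev w) s) \<in> (opposite_edges X)\<^sup>*"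
    using w(1) g(1)
  proof (induction w arbitrary: g)
    case (Cons x w)
    then have x: "x \<in> V" "s = x \<or> adj s x" using adj_verts g(2) by auto
    have "(ed g s, ed (g + e x) s) \<in> (opposite_edges X)\<^sup>*"
    proof (cases "s = x")
      case True
      then have "ed g s = ed (g + e x) s" using ed_eq_iff[of g s "g + e x" s] Cons.prems x by simp
      then show ?thesis by simp
    next
      case False
      then have sx: "adj s x" using x by blast
      have "(ed g s, {pt (g + (e s + e x)), pt (g + e x)}) \<in> opposite_edges X"
        unfolding opposite_edges_def ed_def using squareI[OF Cons.prems(2) sx] by blast
      moreover have "{pt (g + (e s + e x)), pt (g + e x)} = ed (g + e x) s"
        using e_commute[OF sx] by (auto simp: ed_def)
      ultimately show ?thesis by auto
    qed
    moreover have "(ed (g + e x) s, ed (g + e x + ev w) s) \<in> (opposite_edges X)\<^sup>*"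
      using Cons.IH[of "g + e x"] Cons.prems x(1) by simp
    ultimately show ?case by simp
  qed simp
  then show ?thesis using g(4) h(4) w(2) st by simp
qed

lemma hyperplane_of_edge:
  assumes "g \<in> W" "s \<in> V"
  shows "(opposite_edges X)\<^sup>* `` {ed g s} = wall (cj g (e s))"
proof (intro subset_antisym subsetI)
  fix d assume "d \<in> (opposite_edges X)\<^sup>* `` {ed g s}"
  then have "(ed g s, d) \<in> (opposite_edges X)\<^sup>*" by simp
  then show "d \<in> wall (cj g (e s))"
    by (induction rule: rtrancl_induct) (use opposite_in_wall ed_in_wall assms in auto)
next
  fix d assume "d \<in> wall (cj g (e s))"
  then show "d \<in> (opposite_edges X)\<^sup>* `` {ed g s}"
    using wall_opposite ed_in_wall assms by blast
qed

lemma hyperplanes_eq: "hyperplanes X = wall ` refls"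
proof (intro subset_antisym subsetI)
  fix J assume "J \<in> hyperplanes X"
  then obtain d where "d \<in> edges X" "J = (opposite_edges X)\<^sup>* `` {d}"
    by (auto simp: hyperplanes_def quotient_def)
  moreover from this obtain g s where gs: "g \<in> W" "s \<in> V" "d = ed g s"
    using X_edges by auto
  ultimately have "J = wall (cj g (e s))" using hyperplane_of_edge by simp
  then show "J \<in> wall ` refls" using refls_cj[OF refls_e[OF gs(2)] gs(1)] by blast
next
  fix J assume "J \<in> wall ` refls"
  then obtain r where r: "r \<in> refls" "J = wall r" by blast
  obtain g s where g: "g \<in> W" "s \<in> V" "r = cj g (e s)" using reflsE[OF r(1)] .
  have "(opposite_edges X)\<^sup>* `` {ed g s} \<in> edges X // (opposite_edges X)\<^sup>*"
    by (rule quotientI[OF ed_in_edges[OF g(1,2)]])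
  then show "J \<in> hyperplanes X"
    unfolding hyperplanes_def hyperplane_of_edge[OF g(1,2)] r(2) g(3) .
qed

lemma wall_inject: "r \<in> refls \<Longrightarrow> wall r = wall t \<longleftrightarrow> r = t"
proof
  assume r: "r \<in> refls" and eq: "wall r = wall t"
  obtain g s where g: "g \<in> W" "s \<in> V" "r = cj g (e s)" using reflsE[OF r] .
  then have "ed g s \<in> wall t" using ed_in_wall eq by blast
  then show "r = t" using ed_in_wall g by blast
qed simp

text \<open>A square spanned at \<open>g\<close> by adjacent letters meets exactly the walls of the
  two conjugated generators. In the other direction \<open>commuting_refls\<close> provides the
  square.\<close>

lemma transverse_wall:
  assumes r: "r \<in> refls" and t: "t \<in> refls"
  shows "transverse X (wall r) (wall t) \<longleftrightarrow> r \<noteq> t \<and> r + t = t + r"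
proof -
  have sq: "{{a, b}, {b, c}, {c, d}, {d, a}} \<inter> wall q \<noteq> {} \<longleftrightarrow> q = cj g (e s) \<or> q = cj g (e u)"
    if g: "g \<in> W" "adj s u" "a = pt g" "b = pt (g + e s)" "c = pt (g + (e s + e u))"
      "d = pt (g + e u)" for a b c d q g s u
  proof -
    have V: "s \<in> V" "u \<in> V" using g adj_verts by auto
    have "{a, b} = ed g s" "{b, c} = ed (g + e s) u" "{c, d} = ed (g + e u) s" "{d, a} = ed g u"
      using e_commute[OF g(2)] g(3-6) by (auto simp: ed_def)
    moreover have "cj (g + e s) (e u) = cj g (e u)" "cj (g + e u) (e s) = cj g (e s)"
      using cj_e_ed g(2) adj_sym V by blast+
    moreover have W: "g + e s \<in> W" "g + e u \<in> W" using g(1) V by simp_all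
    ultimately have "{a, b} \<in> wall q \<longleftrightarrow> cj g (e s) = q" "{b, c} \<in> wall q \<longleftrightarrow> cj g (e u) = q"
      "{c, d} \<in> wall q \<longleftrightarrow> cj g (e s) = q" "{d, a} \<in> wall q \<longleftrightarrow> cj g (e u) = q"
      using ed_in_wall[OF g(1) V(1), of q] ed_in_wall[OF g(1) V(2), of q]
        ed_in_wall[OF W(1) V(2), of q] ed_in_wall[OF W(2) V(1), of q] by metis+
    then show ?thesis by auto
  qed
  show ?thesis
  proof
    assume "transverse X (wall r) (wall t)"
    then obtain a b c d where s4: "square X a b c d"
      "{{a, b}, {b, c}, {c, d}, {d, a}} \<inter> wall r \<noteq> {}"
      "{{a, b}, {b, c}, {c, d}, {d, a}} \<inter> wall t \<noteq> {}" and "r \<noteq> t"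
      by (auto simp: transverse_def)
    obtain g s u where g: "g \<in> W" "adj s u" "a = pt g" "b = pt (g + e s)"
      "c = pt (g + (e s + e u))" "d = pt (g + e u)" using squareE[OF s4(1)] .
    have "r = cj g (e s) \<or> r = cj g (e u)" "t = cj g (e s) \<or> t = cj g (e u)"
      by (rule iffD1[OF sq[OF g] s4(2)], rule iffD1[OF sq[OF g] s4(3)])
    then show "r \<noteq> t \<and> r + t = t + r"
      using \<open>r \<noteq> t\<close> cj_commute[of s u r g t] cj_commute[of u s r g t] g(2) adj_sym by blast
  next
    assume ne: "r \<noteq> t \<and> r + t = t + r"
    then obtain g s u where g: "g \<in> W" "adj s u" "r = cj g (e s)" "t = cj g (e u)"
      using commuting_refls[OF r t] by blast
    note sq' = sq[OF g(1,2) HOL.refl HOL.refl HOL.refl HOL.refl]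
    show "transverse X (wall r) (wall t)"
      unfolding transverse_def
    proof (intro conjI exI)
      show "wall r \<noteq> wall t" using wall_inject r ne by blast
      show "square X (pt g) (pt (g + e s)) (pt (g + (e s + e u))) (pt (g + e u))"
        by (rule squareI[OF g(1,2)])
    qed (rule iffD2[OF sq'], use g(3,4) in blast)+
  qed
qed

section \<open>Halfspaces\<close>

abbreviation "conn r \<equiv> (adjacency (delete_edges X (wall r)))\<^sup>*"

lemma conn_sym: "(x, y) \<in> conn r \<Longrightarrow> (y, x) \<in> conn r"
proof -
  have "sym (adjacency (delete_edges X (wall r)))"
    by (auto simp: sym_def adjacency_def insert_commute)
  then show "(x, y) \<in> conn r \<Longrightarrow> (y, x) \<in> conn r" using sym_rtrancl by (metis symE)
qed

lemma conn_edge: "g \<in> W \<Longrightarrow> s \<in> V \<Longrightarrow> cj g (e s) \<noteq> r \<Longrightarrow> (pt g, pt (g + e s)) \<in> conn r"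
  using ed_in_edges[of g s] ed_in_wall[of g s r]
  by (intro r_into_rtrancl) (auto simp: adjacency_def delete_edges_def ed_def)

lemma conn_imp_same_side:
  assumes "(pt g, y) \<in> conn r" "g \<in> W"
  shows "\<exists>h \<in> W. y = pt h \<and> (r \<in> Inv h \<longleftrightarrow> r \<in> Inv g)"
  using assms(1)
proof (induction rule: rtrancl_induct)
  case base
  then show ?case using assms by blast
next
  case (step y z)
  then obtain h where h: "h \<in> W" "y = pt h" "r \<in> Inv h \<longleftrightarrow> r \<in> Inv g" by blast
  have yz: "{y, z} \<in> edges X" "{y, z} \<notin> wall r"
    using step(2) by (auto simp: adjacency_def delete_edges_def)
  obtain k s where k: "k \<in> W" "s \<in> V" "y = pt k" "z = pt (k + e s)" using edge_pt[OF yz(1)] .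
  then have "k = h" using h by simp
  have "cj k (e s) \<noteq> r" using yz(2) k ed_in_wall[of k s r] by (simp add: ed_def)
  then show ?case using Inv_add_e[OF k(1,2), of r] k h \<open>k = h\<close>
    by (intro bexI[of _ "k + e s"]) auto
qed

text \<open>A shortest path to \<open>g\<close> crosses only walls of reflections in
  \<open>Inv g\<close>, so it avoids the wall of \<open>r\<close>, and so does its mirror image
  under \<open>r\<close>. The second conjunct makes the far side connected.\<close>

lemma conn_origin:
  assumes r: "r \<in> refls" and "g \<in> W" "r \<notin> Inv g"
  shows "(pt 0, pt g) \<in> conn r \<and> (pt r, pt (r + g)) \<in> conn r"
  using assms(2,3)
proof (induction "len g" arbitrary: g rule: less_induct)
  case less
  show ?case
  proof (cases "g = 0")
    case False
    then obtain s where s: "s \<in> V" "len (g + e s) < len g" "cj g (e s) \<in> Inv g"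
      using right_descent less.prems by blast
    define h where "h = g + e s"
    have h: "h \<in> W" "g = h + e s" "len h < len g" using s less.prems by (auto simp: h_def)
    have cj: "cj h (e s) = cj g (e s)" using s(1) by (simp add: h_def)
    then have ne: "cj h (e s) \<noteq> r" using s less.prems by auto
    then have "r \<notin> Inv h" using Inv_add_e[OF h(1) s(1), of r] less.prems h(2) by auto
    then have IH: "(pt 0, pt h) \<in> conn r" "(pt r, pt (r + h)) \<in> conn r"
      using less.hyps h by blast+
    have "cj (r + h) (e s) \<noteq> r"
    proof
      assume "cj (r + h) (e s) = r"
      then have "cj r (cj h (e s)) = cj r r" using r by simp
      then show False using ne cj_inject by blast
    qed
    then have "(pt (r + h), pt (r + h + e s)) \<in> conn r"
      using conn_edge[of "r + h" s r] r h(1) s(1) by simp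
    moreover have "(pt h, pt (h + e s)) \<in> conn r" using conn_edge h s ne by blast
    ultimately show ?thesis using IH h(2) by (auto intro: rtrancl_trans)
  qed simp
qed

lemma same_side_imp_conn:
  assumes r: "r \<in> refls" and "g \<in> W" "r \<in> Inv g"
  shows "(pt r, pt g) \<in> conn r"
  using conn_origin[OF r, of "r + g"] refls_Inv_add[OF r assms(2)] assms by simp

text \<open>The component of \<open>pt r\<close> consists of the points with \<open>r\<close> in
  their \<open>Inv\<close>, and it is the side away from the origin. Equal walls and transverse
  walls are excluded together, as both mean that the reflections commute.\<close>

lemma separates_wall:
  assumes r: "r \<in> refls" and t: "t \<in> refls"
  shows "separates X (wall r) \<one>\<^bsub>racg \<Psi>\<^esub> (wall t) \<longleftrightarrow> r + t \<noteq> t + r \<and> below r t"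
proof -
  have "(\<exists>D\<in>halfspaces X (wall r). \<one>\<^bsub>racg \<Psi>\<^esub> \<notin> D \<and> \<Union> (wall t) \<subseteq> D) \<longleftrightarrow> below r t"
  proof
    assume "\<exists>D\<in>halfspaces X (wall r). \<one>\<^bsub>racg \<Psi>\<^esub> \<notin> D \<and> \<Union> (wall t) \<subseteq> D"
    then obtain x where x: "x \<in> carrier (racg \<Psi>)" "(x, \<one>\<^bsub>racg \<Psi>\<^esub>) \<notin> conn r"
      "\<Union> (wall t) \<subseteq> conn r `` {x}"
      by (auto simp: halfspaces_def components_def quotient_def delete_edges_def X_verts)
    then obtain a where a: "a \<in> W" "x = pt a" using carrier_pt by blast
    have ra: "r \<in> Inv a" using x(2) a conn_origin[OF r a(1)] conn_sym one_pt by auto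
    show "below r t" unfolding below_def
    proof (intro ballI impI)
      fix g s assume g: "g \<in> W" "s \<in> V" "cj g (e s) = t"
      then have "ed g s \<in> wall t" using ed_in_wall by blast
      then have "(pt a, pt g) \<in> conn r" using x(3) a by (auto simp: ed_def)
      then show "r \<in> Inv g" using conn_imp_same_side[of a "pt g" r] a g ra by auto
    qed
  next
    assume below: "below r t"
    define D where "D = conn r `` {pt r}"
    have "D \<in> halfspaces X (wall r)"
      unfolding halfspaces_def components_def D_def
      using r by (intro quotientI) (simp add: delete_edges_def X_verts)
    moreover have "\<one>\<^bsub>racg \<Psi>\<^esub> \<notin> D"
      using conn_imp_same_side[of r "pt 0" r] refls_Inv_self[OF r] r by (auto simp: D_def one_pt)
    moreover have "\<Union> (wall t) \<subseteq> D"
    proof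
      fix x assume "x \<in> \<Union> (wall t)"
      then obtain g s where g: "g \<in> W" "s \<in> V" "cj g (e s) = t" "x = pt g \<or> x = pt (g + e s)"
        by (auto simp: wall_def ed_def)
      have "r \<in> Inv g" using below g unfolding below_def by blast
      moreover have "cj (g + e s) (e s) = t" "g + e s \<in> W" using g(1-3) by simp_all
      then have "r \<in> Inv (g + e s)" using below g unfolding below_def by blast
      ultimately show "x \<in> D" using same_side_imp_conn[OF r] g by (auto simp: D_def)
    qed
    ultimately show "\<exists>D\<in>halfspaces X (wall r). \<one>\<^bsub>racg \<Psi>\<^esub> \<notin> D \<and> \<Union> (wall t) \<subseteq> D"
      by blast
  qed
  moreover have "wall r = wall t \<longleftrightarrow> r = t" using wall_inject r by blast
  ultimately show ?thesis unfolding separates_def using transverse_wall[OF r t] by auto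
qed

section \<open>Crossing graphs and the two implications\<close>

lemma crossing_edges_iff:
  "{J, K} \<in> edges (crossing_graph Y \<H>) \<longleftrightarrow> J \<in> \<H> \<and> K \<in> \<H> \<and> transverse Y J K"
proof -
  have "transverse Y K J" if "transverse Y J K" for J K using that by (auto simp: transverse_def)
  then show ?thesis by (auto simp: crossing_graph_def doubleton_eq_iff)
qed

lemma peripheral_if_embeds:
  assumes "simplicial_graph \<Phi>" "finite (verts \<Phi>)" and "triangle_free \<Psi>" and "embeds \<Phi> f"
  shows "\<exists>\<H> \<subseteq> hyperplanes X. peripheral X \<one>\<^bsub>racg \<Psi>\<^esub> \<H> \<and> graph_isomorphic (crossing_graph X \<H>) \<Phi>"
proof -
  obtain f0 where f0: "racg_basis \<Phi> f0" "f0 ` verts \<Phi> \<subseteq> refls"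
    using embeds_to_refls[OF assms(3,1,2,4)] by blast
  obtain f1 where basis: "racg_basis \<Phi> f1" and refl: "f1 ` verts \<Phi> \<subseteq> refls"
    and per: "\<And>u v. u \<in> verts \<Phi> \<Longrightarrow> v \<in> verts \<Phi> \<Longrightarrow> f1 u + f1 v \<noteq> f1 v + f1 u \<Longrightarrow>
      \<not> below (f1 u) (f1 v)"
    using refls_to_peripheral[OF assms(1,2) f0] by blast
  interpret P: racg_rep \<Phi> f1 using assms(1) basis by unfold_locales
  define k where "k v = wall (f1 v)" for v
  have refl': "f1 v \<in> refls" if "v \<in> verts \<Phi>" for v using refl that by blast
  have inj: "inj_on k (verts \<Phi>)"
    by (rule inj_onI) (use wall_inject refl' P.e_inject in \<open>simp add: k_def\<close>)
  let ?\<H> = "k ` verts \<Phi>"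
  have "?\<H> \<subseteq> hyperplanes X" using refl' by (auto simp: hyperplanes_eq k_def)
  moreover have "peripheral X \<one>\<^bsub>racg \<Psi>\<^esub> ?\<H>"
    unfolding peripheral_def using per separates_wall refl' by (auto simp: k_def)
  moreover have "graph_isomorphic (crossing_graph X ?\<H>) \<Phi>"
    unfolding graph_isomorphic_def
  proof (intro exI conjI ballI)
    show "bij_betw (inv_into (verts \<Phi>) k) (verts (crossing_graph X ?\<H>)) (verts \<Phi>)"
      using inj by (simp add: crossing_graph_def bij_betw_inv_into bij_betw_imageI)
    fix J K assume "J \<in> verts (crossing_graph X ?\<H>)" "K \<in> verts (crossing_graph X ?\<H>)"
    then obtain u v where uv: "u \<in> verts \<Phi>" "v \<in> verts \<Phi>" "J = k u" "K = k v"
      by (auto simp: crossing_graph_def)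
    have "{J, K} \<in> edges (crossing_graph X ?\<H>) \<longleftrightarrow> f1 u \<noteq> f1 v \<and> f1 u + f1 v = f1 v + f1 u"
      unfolding crossing_edges_iff using uv transverse_wall refl' by (simp add: k_def)
    also have "\<dots> \<longleftrightarrow> P.adj u v"
      using P.commute_imp_adj P.e_commute P.e_inject P.adj_verts uv by metis
    finally show "{J, K} \<in> edges (crossing_graph X ?\<H>) \<longleftrightarrow>
        {inv_into (verts \<Phi>) k J, inv_into (verts \<Phi>) k K} \<in> edges \<Phi>"
      using inj uv by (simp add: P.adj_def)
  qed
  ultimately show ?thesis by blast
qed

lemma embeds_if_peripheral:
  assumes \<Phi>: "simplicial_graph \<Phi>" and \<H>: "\<H> \<subseteq> hyperplanes X"
    and per: "peripheral X \<one>\<^bsub>racg \<Psi>\<^esub> \<H>"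
    and iso: "graph_isomorphic (crossing_graph X \<H>) \<Phi>"
  shows "\<exists>f. embeds \<Phi> f"
proof -
  obtain \<phi> where "bij_betw \<phi> \<H> (verts \<Phi>)"
    and edge: "\<And>J K. J \<in> \<H> \<Longrightarrow> K \<in> \<H> \<Longrightarrow>
      {J, K} \<in> edges (crossing_graph X \<H>) \<longleftrightarrow> {\<phi> J, \<phi> K} \<in> edges \<Phi>"
    using iso by (auto simp: graph_isomorphic_def crossing_graph_def)
  define k where "k = inv_into \<H> \<phi>"
  have k: "k v \<in> \<H>" "\<phi> (k v) = v" if "v \<in> verts \<Phi>" for v
    using \<open>bij_betw \<phi> \<H> (verts \<Phi>)\<close> that unfolding k_def
    by (auto simp: bij_betw_def intro: inv_into_into f_inv_into_f)
  have "\<exists>r. r \<in> refls \<and> k v = wall r" if "v \<in> verts \<Phi>" for v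
    using k(1)[OF that] \<H> hyperplanes_eq by blast
  then obtain f where f: "\<And>v. v \<in> verts \<Phi> \<Longrightarrow> f v \<in> refls" "\<And>v. v \<in> verts \<Phi> \<Longrightarrow> k v = wall (f v)"
    by metis
  have inj: "inj_on f (verts \<Phi>)" by (rule inj_onI) (metis f(2) k(2))
  have "racg_basis \<Phi> f"
  proof (rule peripheral_imp_basis[OF \<Phi> f(1) inj])
    fix u v assume uv: "u \<in> verts \<Phi>" "v \<in> verts \<Phi>"
    have "{u, v} \<in> edges \<Phi> \<longleftrightarrow> transverse X (k u) (k v)"
      using edge[OF k(1)[OF uv(1)] k(1)[OF uv(2)]] k uv by (simp add: crossing_edges_iff)
    also have "\<dots> \<longleftrightarrow> f u \<noteq> f v \<and> f u + f v = f v + f u" using transverse_wall f uv by simp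
    finally show "{u, v} \<in> edges \<Phi> \<longleftrightarrow> f u + f v = f v + f u" if "u \<noteq> v"
      using that inj uv by (simp add: inj_on_eq_iff)
    show "\<not> below (f u) (f v)" if "f u + f v \<noteq> f v + f u"
      using per k(1) uv separates_wall f that unfolding peripheral_def by metis
  qed
  then show ?thesis using f(1) refls_W by (auto simp: embeds_def)
qed

end

theorem corollary4p18:
  fixes \<Phi> :: "'a ugraph" and \<Psi> :: "'b ugraph"
  assumes "simplicial_graph \<Phi>" and "finite (verts \<Phi>)"
    and "simplicial_graph \<Psi>" and "finite (verts \<Psi>)"
    and "triangle_free \<Psi>"
  shows "(\<exists>H. subgroup H (racg \<Psi>) \<and> racg \<Phi> \<cong> (racg \<Psi>)\<lparr>carrier := H\<rparr>) \<longleftrightarrow>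
    (\<exists>\<H> \<subseteq> hyperplanes (X_skeleton \<Psi>).
       peripheral (X_skeleton \<Psi>) \<one>\<^bsub>racg \<Psi>\<^esub> \<H> \<and>
       graph_isomorphic (crossing_graph (X_skeleton \<Psi>) \<H>) \<Phi>)"
proof -
  interpret racg_skeleton \<Psi> using assms(3) by unfold_locales
  show ?thesis
    using embeds_if_subgroup[OF assms(1)] subgroup_if_embeds[OF assms(1)]
      peripheral_if_embeds[OF assms(1,2,5)] embeds_if_peripheral[OF assms(1)] by blast
qed

end
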